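(* Let $(R,\mathfrak m,k)$ be a Noetherian local domain of equicharacteristic zero with torsion class group $\operatorname{Cl}(R)$. If $\operatorname{Tor}_i^R(k,R^+)=0$ for some $i>0$, then $R$ is a unique factorization domain.
   Context: For an integral domain $R$, the absolute integral closure $R^{+}$ is the integral closure of $R$ in an algebraic closure of its fraction field. Here $k=R/\mathfrak m$, and equicharacteristic zero means that $R$ contains $\mathbb{Q}$. The class group $\operatorname{Cl}(R)$ is the divisor class group, formed by classes of divisorial ideals modulo principal ones. It is torsion when the class of every divisorial ideal $I$ has finite order, i.e. $I^{(n)}$ is principal for some $n\ge 1$, where $I^{(n)}$ is the divisorial (reflexive) hull of $I^n$. *)

theory Defs
  imports
    "HOL-Algebra.Algebra"
    "HOL-Algebra.Algebraic_Closure_Type"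
begin

section \<open>Local rings of equicharacteristic zero\<close>

definition local_ring :: "('a, 'b) ring_scheme \<Rightarrow> 'a set \<Rightarrow> bool" where
  "local_ring R m \<longleftrightarrow>
     cring R \<and> maximalideal m R \<and> (\<forall>n. maximalideal n R \<longrightarrow> n = m)"

definition contains_rationals :: "('a, 'b) ring_scheme \<Rightarrow> bool" where
  "contains_rationals R \<longleftrightarrow>
     (\<exists>f \<in> ring_hom (ring_of_type_algebra :: rat ring) R. inj f)"


section \<open>Fraction fields and the absolute integral closure\<close>

text \<open>A domain is studied through an embedding into a field L. In this section and the next, A is
  a subring of L.\<close>

definition fraction_field :: "('a, 'b) ring_scheme \<Rightarrow> 'a set \<Rightarrow> 'a set" where
  "fraction_field L A =
     {a \<otimes>\<^bsub>L\<^esub> inv\<^bsub>L\<^esub> b | a b. a \<in> A \<and> b \<in> A \<and> b \<noteq> \<zero>\<^bsub>L\<^esub>}"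

definition closure_of_fraction_field ::
  "('a, 'b) ring_scheme \<Rightarrow> ('c, 'd) ring_scheme \<Rightarrow> ('a \<Rightarrow> 'c) \<Rightarrow> bool" where
  "closure_of_fraction_field R L \<phi> \<longleftrightarrow>
     \<phi> \<in> ring_hom R L \<and> inj_on \<phi> (carrier R) \<and>
     algebraic_closure L (fraction_field L (\<phi> ` carrier R))"

text \<open>Polynomials in HOL-Algebra are coefficient lists with the leading coefficient first.\<close>

definition integral_over :: "('a, 'b) ring_scheme \<Rightarrow> 'a set \<Rightarrow> 'a \<Rightarrow> bool" where
  "integral_over L A x \<longleftrightarrow>
     (\<exists>p \<in> carrier (univ_poly L A). p \<noteq> [] \<and> hd p = \<one>\<^bsub>L\<^esub> \<and> ring.eval L p x = \<zero>\<^bsub>L\<^esub>)"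

definition integral_closure :: "('a, 'b) ring_scheme \<Rightarrow> 'a set \<Rightarrow> 'a set" where
  "integral_closure L A = {x \<in> carrier L. integral_over L A x}"


section \<open>Divisorial fractional ideals\<close>

definition fractional_ideal :: "('a, 'b) ring_scheme \<Rightarrow> 'a set \<Rightarrow> 'a set \<Rightarrow> bool" where
  "fractional_ideal L A I \<longleftrightarrow>
     I \<subseteq> fraction_field L A \<and> I \<noteq> {\<zero>\<^bsub>L\<^esub>} \<and>
     subgroup I (add_monoid L) \<and> (\<forall>a\<in>A. \<forall>x\<in>I. a \<otimes>\<^bsub>L\<^esub> x \<in> I) \<and>
     (\<exists>d\<in>A. d \<noteq> \<zero>\<^bsub>L\<^esub> \<and> (\<forall>x\<in>I. d \<otimes>\<^bsub>L\<^esub> x \<in> A))"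

definition inverse_ideal :: "('a, 'b) ring_scheme \<Rightarrow> 'a set \<Rightarrow> 'a set \<Rightarrow> 'a set" where
  "inverse_ideal L A I = {x \<in> fraction_field L A. \<forall>y\<in>I. x \<otimes>\<^bsub>L\<^esub> y \<in> A}"

definition divisorial_hull :: "('a, 'b) ring_scheme \<Rightarrow> 'a set \<Rightarrow> 'a set \<Rightarrow> 'a set" where
  "divisorial_hull L A I = inverse_ideal L A (inverse_ideal L A I)"

definition divisorial_ideal :: "('a, 'b) ring_scheme \<Rightarrow> 'a set \<Rightarrow> 'a set \<Rightarrow> bool" where
  "divisorial_ideal L A I \<longleftrightarrow> fractional_ideal L A I \<and> divisorial_hull L A I = I"

definition principal_fractional_ideal ::
  "('a, 'b) ring_scheme \<Rightarrow> 'a set \<Rightarrow> 'a set \<Rightarrow> bool" where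
  "principal_fractional_ideal L A I \<longleftrightarrow>
     (\<exists>x \<in> fraction_field L A. x \<noteq> \<zero>\<^bsub>L\<^esub> \<and> I = (\<lambda>a. a \<otimes>\<^bsub>L\<^esub> x) ` A)"

text \<open>The library's \<^const>\<open>ideal_prod\<close> consists of the finite sums of products; it is taken
  in L here, where it is the product of A-submodules.\<close>

primrec ideal_power :: "('a, 'b) ring_scheme \<Rightarrow> 'a set \<Rightarrow> 'a set \<Rightarrow> nat \<Rightarrow> 'a set" where
  "ideal_power L A I 0 = A"
| "ideal_power L A I (Suc n) = ideal_prod L (ideal_power L A I n) I"

text \<open>For a domain A that is not assumed normal, the classes of divisorial ideals only form a monoid;
  torsion is the condition that every class has a trivial power.\<close>

definition torsion_class_group :: "('a, 'b) ring_scheme \<Rightarrow> 'a set \<Rightarrow> bool" where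
  "torsion_class_group L A \<longleftrightarrow>
     (\<forall>I. divisorial_ideal L A I \<longrightarrow>
        (\<exists>n\<ge>1. principal_fractional_ideal L A (divisorial_hull L A (ideal_power L A I n))))"


section \<open>Modules\<close>

definition restrict_scalars :: "('a \<Rightarrow> 'c) \<Rightarrow> ('c, 'd) ring_scheme \<Rightarrow> ('a, 'c) module" where
  "restrict_scalars h S =
     \<lparr>carrier = carrier S, monoid.mult = monoid.mult S, one = one S, ring.zero = ring.zero S, add = add S,
      module.smult = (\<lambda>a x. h a \<otimes>\<^bsub>S\<^esub> x)\<rparr>"

definition residue_module :: "('a, 'b) ring_scheme \<Rightarrow> 'a set \<Rightarrow> ('a, 'a set) module" where
  "residue_module R m = restrict_scalars (\<lambda>a. m +>\<^bsub>R\<^esub> a) (R Quot m)"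

definition absolute_integral_closure ::
  "('a, 'b) ring_scheme \<Rightarrow> ('c, 'd) ring_scheme \<Rightarrow> ('a \<Rightarrow> 'c) \<Rightarrow> ('a, 'c) module" where
  "absolute_integral_closure R L \<phi> =
     restrict_scalars \<phi> (L\<lparr>carrier := integral_closure L (\<phi> ` carrier R)\<rparr>)"

definition linear_maps ::
  "('a, 'b) ring_scheme \<Rightarrow> ('a, 'm) module \<Rightarrow> ('a, 'n) module \<Rightarrow> ('m \<Rightarrow> 'n) set" where
  "linear_maps R M N =
     {f \<in> carrier M \<rightarrow> carrier N.
        (\<forall>x\<in>carrier M. \<forall>y\<in>carrier M. f (x \<oplus>\<^bsub>M\<^esub> y) = f x \<oplus>\<^bsub>N\<^esub> f y) \<and>
        (\<forall>a\<in>carrier R. \<forall>x\<in>carrier M. f (a \<odot>\<^bsub>M\<^esub> x) = a \<odot>\<^bsub>N\<^esub> f x)}"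

definition coefficient_families :: "('a, 'b) ring_scheme \<Rightarrow> 'm set \<Rightarrow> ('m \<Rightarrow> 'a) set" where
  "coefficient_families R B =
     {c. (\<forall>b\<in>B. c b \<in> carrier R) \<and> (\<forall>b. b \<notin> B \<longrightarrow> c b = \<zero>\<^bsub>R\<^esub>) \<and>
         finite {b. c b \<noteq> \<zero>\<^bsub>R\<^esub>}}"

definition free_module :: "('a, 'b) ring_scheme \<Rightarrow> ('a, 'm) module \<Rightarrow> bool" where
  "free_module R M \<longleftrightarrow> module R M \<and>
     (\<exists>B \<subseteq> carrier M. \<forall>x \<in> carrier M. \<exists>!c. c \<in> coefficient_families R B \<and>
        x = (\<Oplus>\<^bsub>M\<^esub>b\<in>{b. c b \<noteq> \<zero>\<^bsub>R\<^esub>}. c b \<odot>\<^bsub>M\<^esub> b))"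

text \<open>The differential d n goes from F (n + 1) to F n.\<close>

definition free_resolution ::
  "('a, 'b) ring_scheme \<Rightarrow> ('a, 'm) module \<Rightarrow>
   (nat \<Rightarrow> ('a, 'p) module) \<Rightarrow> (nat \<Rightarrow> 'p \<Rightarrow> 'p) \<Rightarrow> ('p \<Rightarrow> 'm) \<Rightarrow> bool" where
  "free_resolution R M F d \<epsilon> \<longleftrightarrow>
     (\<forall>n. free_module R (F n)) \<and>
     (\<forall>n. d n \<in> linear_maps R (F (Suc n)) (F n)) \<and>
     \<epsilon> \<in> linear_maps R (F 0) M \<and>
     \<epsilon> ` carrier (F 0) = carrier M \<and>
     d 0 ` carrier (F 1) = a_kernel (F 0) M \<epsilon> \<and>
     (\<forall>n. d (Suc n) ` carrier (F (Suc (Suc n))) = a_kernel (F (Suc n)) (F n) (d n))"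


section \<open>Tensor products and Tor\<close>

definition tensor_relations ::
  "('a, 'b) ring_scheme \<Rightarrow> ('a, 'm) module \<Rightarrow> ('a, 'n) module \<Rightarrow> ('m \<times> 'n \<Rightarrow>\<^sub>0 int) set" where
  "tensor_relations R M N =
     {frag_of (x \<oplus>\<^bsub>M\<^esub> x', y) - frag_of (x, y) - frag_of (x', y) | x x' y.
        x \<in> carrier M \<and> x' \<in> carrier M \<and> y \<in> carrier N} \<union>
     {frag_of (x, y \<oplus>\<^bsub>N\<^esub> y') - frag_of (x, y) - frag_of (x, y') | x y y'.
        x \<in> carrier M \<and> y \<in> carrier N \<and> y' \<in> carrier N} \<union>
     {frag_of (a \<odot>\<^bsub>M\<^esub> x, y) - frag_of (x, a \<odot>\<^bsub>N\<^esub> y) | a x y.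
        a \<in> carrier R \<and> x \<in> carrier M \<and> y \<in> carrier N}"

definition tensor_null ::
  "('a, 'b) ring_scheme \<Rightarrow> ('a, 'm) module \<Rightarrow> ('a, 'n) module \<Rightarrow> ('m \<times> 'n \<Rightarrow>\<^sub>0 int) set" where
  "tensor_null R M N =
     generate (free_Abelian_group (carrier M \<times> carrier N)) (tensor_relations R M N)"

text \<open>The underlying abelian group of the tensor product, written multiplicatively as everything
  built on \<^const>\<open>free_Abelian_group\<close>.\<close>

definition tensor ::
  "('a, 'b) ring_scheme \<Rightarrow> ('a, 'm) module \<Rightarrow> ('a, 'n) module \<Rightarrow> ('m \<times> 'n \<Rightarrow>\<^sub>0 int) set monoid" where
  "tensor R M N = free_Abelian_group (carrier M \<times> carrier N) Mod tensor_null R M N"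

text \<open>The map induced by a linear map f from M to M' on the tensor products with N; its arguments and
  values are cosets.\<close>

definition tensor_map ::
  "('a, 'b) ring_scheme \<Rightarrow> ('a, 'm') module \<Rightarrow> ('a, 'n) module \<Rightarrow> ('m \<Rightarrow> 'm') \<Rightarrow>
   ('m \<times> 'n \<Rightarrow>\<^sub>0 int) set \<Rightarrow> ('m' \<times> 'n \<Rightarrow>\<^sub>0 int) set" where
  "tensor_map R M' N f C =
     the_elem ((\<lambda>z. tensor_null R M' N #>\<^bsub>free_Abelian_group (carrier M' \<times> carrier N)\<^esub>
       frag_extend (\<lambda>(x, y). frag_of (f x, y)) z) ` C)"

text \<open>The i-th homology group of the complex obtained by tensoring (F, d) with N. When (F, d) is a free
  resolution of M, this is Tor of index i of M and N, independently of the resolution.\<close>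

definition Tor ::
  "('a, 'b) ring_scheme \<Rightarrow> (nat \<Rightarrow> ('a, 'p) module) \<Rightarrow> (nat \<Rightarrow> 'p \<Rightarrow> 'p) \<Rightarrow> ('a, 'n) module \<Rightarrow> nat \<Rightarrow>
   ('p \<times> 'n \<Rightarrow>\<^sub>0 int) set set monoid" where
  "Tor R F d N i =
     (let T = (\<lambda>j. tensor R (F j) N);
          \<delta> = (\<lambda>j. tensor_map R (F j) N (d j));
          Z = (case i of 0 \<Rightarrow> carrier (T 0) | Suc j \<Rightarrow> kernel (T (Suc j)) (T j) (\<delta> j))
      in (T i)\<lparr>carrier := Z\<rparr> Mod (\<delta> i ` carrier (T (Suc i))))"

end

theory Submission
  imports "Jordan_Normal_Form.Determinant" Defs
begin

text \<open>Let \<open>A\<close> be the image of \<open>R\<close> in the algebraically closed field \<open>L\<close>, and \<open>K\<close> its fraction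
  field. The proof shows that every divisorial ideal of \<open>A\<close> is principal; an irreducible
  element is then prime by the usual argument with the divisorial ideal of all \<open>x\<close> for which
  \<open>x p\<close> and \<open>x a\<close> lie in \<open>A\<close>.

  Torsion of the divisor classes makes \<open>A\<close> completely integrally closed: if \<open>c t\<^sup>k\<close> lies in
  \<open>A\<close> for all \<open>k\<close> and some \<open>c \<noteq> 0\<close>, the elements \<open>y\<close> with all \<open>y t\<^sup>k\<close> in \<open>A\<close> form a
  divisorial ideal that is stable under \<open>t\<close>, and so is its power with principal hull, which
  forces \<open>t \<in> A\<close> (\<open>torsion_imp_completely_integrally_closed\<close>). As \<open>A\<close> is also Noetherian, it
  is the intersection of its localizations at the essential primes, those of the form
  \<open>{a \<in> A. a t \<in> A}\<close> (\<open>A_eq_Inter_loc\<close>), and these localizations are valuation rings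
  (\<open>essential_loc_valuation\<close>), over which finitely generated torsion-free modules are free.

  A divisorial ideal with a finite free resolution is principal. The reason is that its
  determinant can be computed from the resolution and is trivial. Here the triviality of the
  determinant of a module \<open>N\<close> is expressed by the predicate \<open>oriented\<close>: with respect to one
  basis of \<open>N\<close> over \<open>K\<close>, bases of the localizations of \<open>N\<close> at all essential primes have the
  same determinant up to local units. Multiplicativity of determinants of block triangular
  matrices carries this property from the module of relations between generators to the
  module that they generate (\<open>oriented_quotient\<close>), and in rank one the common determinant
  yields a generator (\<open>oriented_rank_one\<close>).

  A divisorial ideal \<open>I\<close> inherits the vanishing of Tor from the absolute integral closure.
  Let \<open>f\<close> generate the divisorial hull of \<open>I\<^sup>n\<close>, and let \<open>\<alpha>\<^sup>n = f\<close> in \<open>L\<close>. Then \<open>\<alpha>\<^sup>-\<^sup>1 x\<close> is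
  integral for \<open>x \<in> I\<close>, since its \<open>n\<close>-th power lies in \<open>A\<close>, and \<open>z \<alpha>\<close> is integral for the
  same reason if \<open>z I \<subseteq> A\<close>. Dividing by \<open>\<alpha>\<close> thus embeds \<open>I\<close> in the integral closure, and a
  splitting of this embedding is multiplication by \<open>\<alpha>\<close> followed by the trace of a finite
  extension, divided by its degree: traces of integral elements lie in \<open>A\<close>
  (\<open>trace_integral\<close>), so \<open>z tr (\<alpha> y) = tr (z \<alpha> y)\<close> lies in \<open>A\<close> for integral \<open>y\<close> and every
  \<open>z\<close> as above, which puts \<open>tr (\<alpha> y)\<close> into the divisorial ideal \<open>I\<close> (\<open>exact_at_rank_one\<close>).
  The degree is invertible because \<open>R\<close> contains the rationals.

  If Tor of positive index \<open>i\<close> of the residue field and a finitely generated module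
  vanishes, shifting the index along relations (\<open>exact_at_relations\<close>) leads to a module with
  vanishing Tor of index 1, which is free by Nakayama's lemma (\<open>relations_trivial\<close>). Going
  back along the relations, the original module is oriented (\<open>exact_at_oriented\<close>). With the
  preceding paragraphs, every divisorial ideal is principal.

  The linear algebra takes place in a ring type, although \<open>L\<close> is only a ring on a carrier
  set: there is a type \<open>'c universal_ring\<close> in the class \<^class>\<open>comm_ring_1\<close> that maps onto every
  commutative ring on a subset of \<open>'c\<close>. The field \<open>L\<close> is its quotient by a maximal ideal,
  and equations in \<open>L\<close> become congruences modulo this ideal, written \<open>x \<asymp> y\<close>. Subsets of \<open>L\<close>
  such as \<open>A\<close> and \<open>K\<close> are represented by their preimages.\<close>

section \<open>Determinants\<close>

text \<open>Matrices are functions of two indices, so that block matrices can be written down by case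
  distinctions; only the entries with indices below \<open>n\<close> count.\<close>

definition leading_minor :: "nat \<Rightarrow> (nat \<Rightarrow> nat \<Rightarrow> 'u::comm_ring_1) \<Rightarrow> 'u" where
  "leading_minor n M = det (mat n n (\<lambda>(i, j). M i j))"

lemma leading_minor_leibniz: "leading_minor n M = (\<Sum>p | p permutes {0..<n}. signof p * (\<Prod>i = 0..<n. M i (p i)))"
proof -
  have "M i (p i) = mat n n (\<lambda>(i, j). M i j) $$ (i, p i)" if "p permutes {0..<n}" "i < n" for p i
    using permutes_in_image[OF that(1), of i] that(2) by simp
  then show ?thesis
    unfolding leading_minor_def det_def by (auto intro!: sum.cong prod.cong arg_cong2[where f = "(*)"])
qed

lemma leading_minor_mult: "leading_minor n (\<lambda>i j. \<Sum>k<n. M i k * N k j) = leading_minor n M * leading_minor n N"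
proof -
  have "mat n n (\<lambda>(i, j). \<Sum>k<n. M i k * N k j) = mat n n (\<lambda>(i, j). M i j) * mat n n (\<lambda>(i, j). N i j)"
    by (rule eq_matI) (auto simp: scalar_prod_def lessThan_atLeast0 intro!: sum.cong)
  then show ?thesis
    unfolding leading_minor_def by (simp add: det_mult[where n = n])
qed

lemma leading_minor_one: "leading_minor n (\<lambda>i j. if i = j then 1 else 0) = (1 :: 'a :: comm_ring_1)"
proof -
  have "mat n n (\<lambda>(i, j). if i = j then 1 else 0) = (1\<^sub>m n :: 'a mat)"
    by (rule eq_matI) auto
  then show ?thesis unfolding leading_minor_def by (metis det_one)
qed

lemma leading_minor_zero_column:
  assumes "k < n" "\<And>i. M i k = 0"
  shows "leading_minor n M = 0"
  unfolding leading_minor_leibniz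
proof (intro sum.neutral ballI)
  fix p assume "p \<in> {p. p permutes {0..<n}}"
  then have "p permutes {0..<n}" by simp
  then obtain i where "i \<in> {0..<n}" "p i = k"
    by (metis assms(1) atLeastLessThan_iff imageE less_eq_nat.simps(1) permutes_image)
  then have "(\<Prod>i = 0..<n. M i (p i)) = 0"
    using assms(2)[of i] by (intro prod_zero) (auto intro!: bexI[of _ i])
  then show "signof p * (\<Prod>i = 0..<n. M i (p i)) = 0" by simp
qed

lemma leading_minor_cong: "(\<And>i j. i < n \<Longrightarrow> j < n \<Longrightarrow> M i j = N i j) \<Longrightarrow> leading_minor n M = leading_minor n N"
  unfolding leading_minor_def by (intro arg_cong[where f = det] eq_matI) auto

lemma leading_minor_first_row:
  assumes "\<And>j. 0 < j \<Longrightarrow> j \<le> n \<Longrightarrow> M 0 j = 0"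
  shows "leading_minor (Suc n) M = M 0 0 * leading_minor n (\<lambda>i j. M (Suc i) (Suc j))"
proof -
  let ?A = "mat (Suc n) (Suc n) (\<lambda>(i, j). M i j)"
  have "det ?A = (\<Sum>j<Suc n. ?A $$ (0, j) * cofactor ?A 0 j)"
    by (rule laplace_expansion_row) auto
  also have "\<dots> = (\<Sum>j<Suc n. if j = 0 then M 0 0 * cofactor ?A 0 0 else 0)"
    using assms by (intro sum.cong) auto
  also have "\<dots> = M 0 0 * cofactor ?A 0 0"
    by simp
  also have "cofactor ?A 0 0 = leading_minor n (\<lambda>i j. M (Suc i) (Suc j))"
  proof -
    have "mat_delete ?A 0 0 = mat n n (\<lambda>(i, j). M (Suc i) (Suc j))"
      unfolding mat_delete_def by (rule eq_matI) auto
    then show ?thesis by (simp add: cofactor_def leading_minor_def)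
  qed
  finally show ?thesis unfolding leading_minor_def .
qed

lemma leading_minor_last_column:
  assumes "\<And>i. i < n \<Longrightarrow> M i n = 0"
  shows "leading_minor (Suc n) M = M n n * leading_minor n M"
proof -
  let ?A = "mat (Suc n) (Suc n) (\<lambda>(i, j). M i j)"
  have "det ?A = (\<Sum>i<Suc n. ?A $$ (i, n) * cofactor ?A i n)"
    by (rule laplace_expansion_column) auto
  also have "\<dots> = M n n * cofactor ?A n n"
    using assms by simp
  also have "cofactor ?A n n = leading_minor n M"
  proof -
    have "mat_delete ?A n n = mat n n (\<lambda>(i, j). M i j)"
      unfolding mat_delete_def by (rule eq_matI) auto
    then show ?thesis by (simp add: cofactor_def leading_minor_def flip: mult_2)
  qed
  finally show ?thesis unfolding leading_minor_def .
qed

lemma leading_minor_identity_upper_block: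
  assumes "\<And>i j. i < m \<Longrightarrow> M i j = (if i = j then 1 else 0)"
  shows "leading_minor (m + n) M = leading_minor n (\<lambda>i j. M (m + i) (m + j))"
  using assms
proof (induction m arbitrary: M)
  case (Suc m)
  have "leading_minor (Suc m + n) M = leading_minor (m + n) (\<lambda>i j. M (Suc i) (Suc j))"
    using Suc.prems by (simp add: leading_minor_first_row)
  also have "\<dots> = leading_minor n (\<lambda>i j. M (Suc (m + i)) (Suc (m + j)))"
    using Suc.prems by (subst Suc.IH) auto
  finally show ?case by simp
qed simp

lemma leading_minor_identity_lower_block:
  assumes "\<And>i j. i < m + n \<Longrightarrow> m \<le> j \<Longrightarrow> M i j = (if i = j then 1 else 0)"
  shows "leading_minor (m + n) M = leading_minor m M"
  using assms
proof (induction n)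
  case (Suc n)
  then show ?case by (simp add: leading_minor_last_column)
qed simp

text \<open>The matrix is a product of a matrix with only the block \<open>h\<close> off the identity and a matrix
  whose first \<open>m\<close> rows are those of the identity, and the determinants of both factors come
  from Laplace expansion.\<close>

lemma leading_minor_block_triangular:
  assumes M: "\<And>i j. i < m + n \<Longrightarrow> j < m + n \<Longrightarrow>
      M i j = (if i < m then if j < m then h i j else 0 else if j < m then x i j else k (i - m) (j - m))"
  shows "leading_minor (m + n) M = leading_minor m h * leading_minor n k"
proof -
  define P where "P = (\<lambda>i j. if i < m \<and> j < m then h i j else if i = j then 1 else 0)"
  define Q where "Q = (\<lambda>i j. if i < m then if i = j then 1 else 0 else if j < m then x i j else k (i - m) (j - m))"
  have "M i j = (\<Sum>l<m + n. P i l * Q l j)" if ij: "i < m + n" "j < m + n" for i j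
  proof (cases "i < m")
    case True
    have "(\<Sum>l<m + n. P i l * Q l j) = (\<Sum>l<m + n. if l = j then if j < m then h i j else 0 else 0)"
      using True by (intro sum.cong) (auto simp: P_def Q_def)
    also have "\<dots> = (if j < m then h i j else 0)"
      using ij by simp
    finally show ?thesis using True ij M by simp
  next
    case False
    have "(\<Sum>l<m + n. P i l * Q l j) = (\<Sum>l<m + n. if l = i then Q i j else 0)"
      using False by (intro sum.cong) (auto simp: P_def)
    also have "\<dots> = Q i j"
      using ij by simp
    finally show ?thesis using False ij M by (simp add: Q_def)
  qed
  then have "leading_minor (m + n) M = leading_minor (m + n) P * leading_minor (m + n) Q"
    by (subst leading_minor_mult[symmetric]) (auto intro: leading_minor_cong)
  also have "leading_minor (m + n) P = leading_minor m P"
    by (rule leading_minor_identity_lower_block) (auto simp: P_def)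
  also have "leading_minor m P = leading_minor m h"
    by (rule leading_minor_cong) (auto simp: P_def)
  also have "leading_minor (m + n) Q = leading_minor n (\<lambda>i j. Q (m + i) (m + j))"
    by (rule leading_minor_identity_upper_block) (auto simp: Q_def)
  also have "\<dots> = leading_minor n k"
    by (rule leading_minor_cong) (auto simp: Q_def)
  finally show ?thesis .
qed

section \<open>Linear algebra modulo a maximal ideal\<close>

definition lin_comb :: "nat \<Rightarrow> (nat \<Rightarrow> 'u::comm_ring_1) \<Rightarrow> (nat \<Rightarrow> 'i \<Rightarrow> 'u) \<Rightarrow> 'i \<Rightarrow> 'u" where
  "lin_comb n a y = (\<lambda>i. \<Sum>k<n. a k * y k i)"

lemma lin_comb_lin_comb: "lin_comb n a (\<lambda>k. lin_comb m (b k) x) = lin_comb m (\<lambda>j. \<Sum>k<n. a k * b k j) x"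
proof
  fix i
  have "(\<Sum>k<n. a k * (\<Sum>j<m. b k j * x j i)) = (\<Sum>k<n. \<Sum>j<m. a k * b k j * x j i)"
    by (simp add: sum_distrib_left mult.assoc)
  also have "\<dots> = (\<Sum>j<m. \<Sum>k<n. a k * b k j * x j i)"
    by (rule sum.swap)
  finally show "lin_comb n a (\<lambda>k. lin_comb m (b k) x) i = lin_comb m (\<lambda>j. \<Sum>k<n. a k * b k j) x i"
    by (simp add: lin_comb_def sum_distrib_right)
qed

lemma lin_comb_unit: "l < n \<Longrightarrow> lin_comb n (\<lambda>k. if k = l then 1 else 0) y = y l"
proof
  fix i assume "l < n"
  have "(\<Sum>k<n. (if k = l then 1 else 0) * y k i) = (\<Sum>k<n. if k = l then y k i else 0)"
    by (intro sum.cong) auto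
  then show "lin_comb n (\<lambda>k. if k = l then 1 else 0) y i = y l i"
    using \<open>l < n\<close> by (simp add: lin_comb_def)
qed

text \<open>The elements of the field are represented by those of a ring with maximal ideal \<open>Z\<close>.
  Subrings, fractional ideals and modules are sets of representatives that are closed under
  congruence modulo \<open>Z\<close>.\<close>

locale residue_field =
  fixes Z :: "'u::comm_ring_1 set"
  assumes Z_zero: "0 \<in> Z"
    and Z_add: "x \<in> Z \<Longrightarrow> y \<in> Z \<Longrightarrow> x + y \<in> Z"
    and Z_mult: "x \<in> Z \<Longrightarrow> a * x \<in> Z"
    and Z_proper: "1 \<notin> Z"
    and Z_maximal: "x \<notin> Z \<Longrightarrow> \<exists>y. x * y - 1 \<in> Z"
begin

definition eqv :: "'u \<Rightarrow> 'u \<Rightarrow> bool" (infix "\<asymp>" 50) where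
  "x \<asymp> y \<longleftrightarrow> x - y \<in> Z"

lemma Z_mult_right: "x \<in> Z \<Longrightarrow> x * a \<in> Z"
  using Z_mult[of x a] by (simp add: mult.commute)

lemma Z_minus: "x \<in> Z \<Longrightarrow> - x \<in> Z"
  using Z_mult[of x "-1"] by simp

lemma Z_diff: "x \<in> Z \<Longrightarrow> y \<in> Z \<Longrightarrow> x - y \<in> Z"
  using Z_add[of x "- y"] Z_minus[of y] by simp

lemma Z_sum: "(\<And>k. k \<in> S \<Longrightarrow> f k \<in> Z) \<Longrightarrow> sum f S \<in> Z"
  by (induction S rule: infinite_finite_induct) (auto simp: Z_zero Z_add)

lemma eqv_refl [simp]: "x \<asymp> x"
  by (simp add: eqv_def Z_zero)

lemma eqv_sym: "x \<asymp> y \<Longrightarrow> y \<asymp> x"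
  using Z_minus[of "x - y"] by (simp add: eqv_def)

lemma eqv_trans [trans]: "x \<asymp> y \<Longrightarrow> y \<asymp> z \<Longrightarrow> x \<asymp> z"
  using Z_add[of "x - y" "y - z"] by (simp add: eqv_def)

lemma eqv_eq_trans [trans]: "x \<asymp> y \<Longrightarrow> y = z \<Longrightarrow> x \<asymp> z" "x = y \<Longrightarrow> y \<asymp> z \<Longrightarrow> x \<asymp> z"
  by auto

lemma eqv_add: "x \<asymp> y \<Longrightarrow> x' \<asymp> y' \<Longrightarrow> x + x' \<asymp> y + y'"
  using Z_add[of "x - y" "x' - y'"] by (simp add: eqv_def algebra_simps)

lemma eqv_diff: "x \<asymp> y \<Longrightarrow> x' \<asymp> y' \<Longrightarrow> x - x' \<asymp> y - y'"
  using Z_diff[of "x - y" "x' - y'"] by (simp add: eqv_def algebra_simps)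

lemma eqv_mult: "x \<asymp> y \<Longrightarrow> x' \<asymp> y' \<Longrightarrow> x * x' \<asymp> y * y'"
proof -
  assume "x \<asymp> y" "x' \<asymp> y'"
  then have "x' * (x - y) + y * (x' - y') \<in> Z"
    unfolding eqv_def by (intro Z_add Z_mult)
  then show ?thesis by (simp add: eqv_def algebra_simps)
qed

lemma eqv_mult_left: "x' \<asymp> y' \<Longrightarrow> x * x' \<asymp> x * y'"
  and eqv_mult_right: "x' \<asymp> y' \<Longrightarrow> x' * x \<asymp> y' * x"
  by (simp_all add: eqv_mult)

lemma eqv_power: "x \<asymp> y \<Longrightarrow> x ^ n \<asymp> y ^ n"
  by (induction n) (auto intro: eqv_mult)

lemma eqv_sum: "(\<And>k. k \<in> S \<Longrightarrow> f k \<asymp> g k) \<Longrightarrow> sum f S \<asymp> sum g S"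
  using Z_sum[of S "\<lambda>k. f k - g k"] by (simp add: eqv_def sum_subtractf)

lemma eqv_prod: "(\<And>k. k \<in> S \<Longrightarrow> f k \<asymp> g k) \<Longrightarrow> prod f S \<asymp> prod g S"
  by (induction S rule: infinite_finite_induct) (auto intro: eqv_mult)

lemma Z_iff: "x \<in> Z \<longleftrightarrow> x \<asymp> 0"
  by (simp add: eqv_def)

lemma Z_cong: "x \<asymp> y \<Longrightarrow> x \<in> Z \<longleftrightarrow> y \<in> Z"
  unfolding Z_iff using eqv_trans eqv_sym by blast

lemma Z_prime: "x * y \<in> Z \<Longrightarrow> x \<in> Z \<or> y \<in> Z"
proof (rule disjCI)
  assume xy: "x * y \<in> Z" and "y \<notin> Z"
  then obtain u where u: "y * u \<asymp> 1"
    using Z_maximal eqv_def by blast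
  have "x * y * u \<asymp> x"
    using eqv_mult_left[OF u, of x] by (simp add: mult.assoc)
  then show "x \<in> Z"
    using Z_cong Z_mult_right[OF xy] by blast
qed

lemma inverse_exists: "x \<notin> Z \<Longrightarrow> \<exists>y. x * y \<asymp> 1"
  using Z_maximal eqv_def by blast

lemma inverse_notin: "x * y \<asymp> 1 \<Longrightarrow> x \<notin> Z" "x * y \<asymp> 1 \<Longrightarrow> y \<notin> Z"
  using Z_cong Z_proper Z_mult Z_mult_right by blast+

lemma eqv_cancel: "x * u \<asymp> 1 \<Longrightarrow> x * y \<asymp> x * z \<Longrightarrow> y \<asymp> z"
proof -
  assume u: "x * u \<asymp> 1" and yz: "x * y \<asymp> x * z"
  have "y = 1 * y" by simp
  also have "\<dots> \<asymp> (x * u) * y" using eqv_mult_right[OF eqv_sym[OF u]] .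
  also have "\<dots> = u * (x * y)" by (simp add: ac_simps)
  also have "\<dots> \<asymp> u * (x * z)" by (rule eqv_mult_left[OF yz])
  also have "\<dots> = (x * u) * z" by (simp add: ac_simps)
  also have "\<dots> \<asymp> 1 * z" by (rule eqv_mult_right[OF u])
  finally show ?thesis by simp
qed

lemma eqv_cancel': "x \<notin> Z \<Longrightarrow> x * y \<asymp> x * z \<Longrightarrow> y \<asymp> z"
  using inverse_exists eqv_cancel by blast

definition subr :: "'u set \<Rightarrow> bool" where
  "subr W \<longleftrightarrow> Z \<subseteq> W \<and> 1 \<in> W \<and> (\<forall>x\<in>W. \<forall>y\<in>W. x + y \<in> W \<and> x * y \<in> W) \<and> (\<forall>x\<in>W. - x \<in> W)"

lemma subrD:
  assumes "subr W"
  shows "0 \<in> W" "1 \<in> W" "x \<in> Z \<Longrightarrow> x \<in> W" "x \<in> W \<Longrightarrow> y \<in> W \<Longrightarrow> x + y \<in> W"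
    "x \<in> W \<Longrightarrow> y \<in> W \<Longrightarrow> x * y \<in> W" "x \<in> W \<Longrightarrow> - x \<in> W" "x \<in> W \<Longrightarrow> y \<in> W \<Longrightarrow> x - y \<in> W"
  using assms Z_zero unfolding subr_def by (auto simp only: diff_conv_add_uminus)

lemma subr_cong: "subr W \<Longrightarrow> x \<in> W \<Longrightarrow> y \<asymp> x \<Longrightarrow> y \<in> W"
  using subrD(4)[of W x "y - x"] subrD(3)[of W "y - x"] by (simp add: eqv_def)

lemma subr_sum: "subr W \<Longrightarrow> (\<And>k. k \<in> S \<Longrightarrow> f k \<in> W) \<Longrightarrow> sum f S \<in> W"
  by (induction S rule: infinite_finite_induct) (auto simp: subrD)

lemma subr_prod: "subr W \<Longrightarrow> (\<And>k. k \<in> S \<Longrightarrow> f k \<in> W) \<Longrightarrow> prod f S \<in> W"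
  by (induction S rule: infinite_finite_induct) (auto simp: subrD)

lemma subr_power: "subr W \<Longrightarrow> x \<in> W \<Longrightarrow> x ^ n \<in> W"
  by (induction n) (auto simp: subrD)

lemma leading_minor_in: "subr W \<Longrightarrow> (\<And>i j. i < n \<Longrightarrow> j < n \<Longrightarrow> M i j \<in> W) \<Longrightarrow> leading_minor n M \<in> W"
  unfolding leading_minor_leibniz
proof (intro subr_sum subrD(5)[of W] subr_prod)
  fix p assume W: "subr W" and "p \<in> {p. p permutes {0..<n}}"
  then show "signof p \<in> W"
    by (auto simp: sign_def intro: subrD)
next
  fix p i assume M: "\<And>i j. i < n \<Longrightarrow> j < n \<Longrightarrow> M i j \<in> W"
    and p: "p \<in> {p. p permutes {0..<n}}" and i: "i \<in> {0..<n}"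
  then have "p i < n"
    using permutes_in_image[of p "{0..<n}" i] by simp
  then show "M i (p i) \<in> W" using M i by simp
qed auto

lemma leading_minor_eqv: "(\<And>i j. i < n \<Longrightarrow> j < n \<Longrightarrow> M i j \<asymp> N i j) \<Longrightarrow> leading_minor n M \<asymp> leading_minor n N"
  unfolding leading_minor_leibniz
proof (intro eqv_sum eqv_mult_left eqv_prod)
  fix p i assume M: "\<And>i j. i < n \<Longrightarrow> j < n \<Longrightarrow> M i j \<asymp> N i j"
    and p: "p \<in> {p. p permutes {0..<n}}" and i: "i \<in> {0..<n}"
  then have "p i < n"
    using permutes_in_image[of p "{0..<n}" i] by simp
  then show "M i (p i) \<asymp> N i (p i)" using M i by simp
qed

text \<open>Otherwise \<open>Q\<close> can be extended by zero columns to a square matrix without changing the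
  product, whose determinant would be 0 and congruent to 1.\<close>

lemma identity_factorization_size:
  fixes m n :: nat
  assumes "\<And>i j. i < n \<Longrightarrow> j < n \<Longrightarrow> (\<Sum>k<m. Q i k * P k j) \<asymp> (if i = j then 1 else 0)"
  shows "n \<le> m"
proof (rule ccontr)
  assume "\<not> n \<le> m"
  then have mn: "m < n" by simp
  define Q' where "Q' = (\<lambda>i k. if k < m then Q i k else 0)"
  have sum: "(\<Sum>k<m. Q i k * P k j) = (\<Sum>k<n. Q' i k * P k j)" for i j
  proof -
    have "(\<Sum>k<n. Q' i k * P k j) = (\<Sum>k<m. Q' i k * P k j)"
      using mn by (intro sum.mono_neutral_right) (auto simp: Q'_def)
    then show ?thesis by (simp add: Q'_def)
  qed
  have "(1::'u) = leading_minor n (\<lambda>i j. if i = j then 1 else 0)"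
    by (rule leading_minor_one[symmetric])
  also have "\<dots> \<asymp> leading_minor n (\<lambda>i j. \<Sum>k<n. Q' i k * P k j)"
    using assms by (intro leading_minor_eqv) (metis eqv_sym sum)
  also have "\<dots> = leading_minor n Q' * leading_minor n P"
    by (rule leading_minor_mult)
  also have "leading_minor n Q' = 0"
    by (rule leading_minor_zero_column[OF mn]) (simp add: Q'_def)
  finally have "1 \<asymp> 0" by simp
  then show False using Z_proper by (simp add: Z_iff)
qed

text \<open>Vectors are families over an arbitrary index type. The submodules contain all families with
  values in \<open>Z\<close>, which makes them closed under congruence.\<close>

definition submod :: "'u set \<Rightarrow> ('i \<Rightarrow> 'u) set \<Rightarrow> bool" where
  "submod W N \<longleftrightarrow> (\<forall>v. (\<forall>i. v i \<in> Z) \<longrightarrow> v \<in> N) \<and> (\<forall>u\<in>N. \<forall>v\<in>N. (\<lambda>i. u i + v i) \<in> N) \<and>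
     (\<forall>a\<in>W. \<forall>v\<in>N. (\<lambda>i. a * v i) \<in> N)"

lemma submodD:
  assumes "submod W N"
  shows "(\<And>i. v i \<in> Z) \<Longrightarrow> v \<in> N" "u \<in> N \<Longrightarrow> v \<in> N \<Longrightarrow> (\<lambda>i. u i + v i) \<in> N"
    "a \<in> W \<Longrightarrow> v \<in> N \<Longrightarrow> (\<lambda>i. a * v i) \<in> N"
  using assms unfolding submod_def by auto

lemma submod_cong:
  assumes "submod W N" "v \<in> N" "\<And>i. w i \<asymp> v i"
  shows "w \<in> N"
  using submodD(2)[OF assms(1,2), of "\<lambda>i. w i - v i"] submodD(1)[OF assms(1), of "\<lambda>i. w i - v i"] assms(3)
  by (simp add: eqv_def)

lemma submod_diff:
  assumes "submod W N" "subr W" "u \<in> N" "v \<in> N"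
  shows "(\<lambda>i. u i - v i) \<in> N"
  using submodD(2)[OF assms(1,3) submodD(3)[OF assms(1) _ assms(4), of "-1"]] subrD[OF assms(2)]
  by simp

lemma submod_sum:
  assumes "submod W N" "\<And>k. k \<in> S \<Longrightarrow> f k \<in> N"
  shows "(\<lambda>i. \<Sum>k\<in>S. f k i) \<in> N"
  using assms(2)
  by (induction S rule: infinite_finite_induct)
    (auto intro: submodD(2)[OF assms(1)] submodD(1)[OF assms(1)] simp: Z_zero)

lemma submod_lin_comb:
  assumes "submod W N" "\<And>k. k < n \<Longrightarrow> a k \<in> W" "\<And>k. k < n \<Longrightarrow> y k \<in> N"
  shows "lin_comb n a y \<in> N"
  unfolding lin_comb_def by (rule submod_sum[OF assms(1)]) (use assms in \<open>auto intro: submodD(3)\<close>)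

lemma submod_antimono: "submod W N \<Longrightarrow> W' \<subseteq> W \<Longrightarrow> submod W' N"
  unfolding submod_def by blast

definition span :: "'u set \<Rightarrow> nat \<Rightarrow> (nat \<Rightarrow> 'i \<Rightarrow> 'u) \<Rightarrow> ('i \<Rightarrow> 'u) set" where
  "span W n y = {v. \<exists>a. (\<forall>k<n. a k \<in> W) \<and> (\<forall>i. v i \<asymp> lin_comb n a y i)}"

lemma spanI: "(\<And>k. k < n \<Longrightarrow> a k \<in> W) \<Longrightarrow> (\<And>i. v i \<asymp> lin_comb n a y i) \<Longrightarrow> v \<in> span W n y"
  unfolding span_def by blast

lemma spanE:
  assumes "v \<in> span W n y"
  obtains a where "\<And>k. k < n \<Longrightarrow> a k \<in> W" "\<And>i. v i \<asymp> lin_comb n a y i"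
  using assms unfolding span_def by blast

lemma lin_comb_eqv: "(\<And>k. k < n \<Longrightarrow> a k \<asymp> b k) \<Longrightarrow> (\<And>k i. k < n \<Longrightarrow> y k i \<asymp> z k i) \<Longrightarrow> lin_comb n a y i \<asymp> lin_comb n b z i"
  unfolding lin_comb_def by (intro eqv_sum eqv_mult) auto

lemma span_submod:
  fixes y :: "nat \<Rightarrow> 'i \<Rightarrow> 'u"
  assumes W: "subr W"
  shows "submod W (span W n y)"
  unfolding submod_def
proof (intro conjI allI ballI impI)
  fix v :: "'i \<Rightarrow> 'u" assume "\<forall>i. v i \<in> Z"
  then show "v \<in> span W n y"
    using subrD(1)[OF W] by (intro spanI[of n "\<lambda>k. 0"]) (auto simp: lin_comb_def Z_iff)
next
  fix u v assume "u \<in> span W n y" "v \<in> span W n y"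
  then obtain a b where "\<And>k. k < n \<Longrightarrow> a k \<in> W" "\<And>i. u i \<asymp> lin_comb n a y i"
    "\<And>k. k < n \<Longrightarrow> b k \<in> W" "\<And>i. v i \<asymp> lin_comb n b y i"
    by (metis spanE)
  then show "(\<lambda>i. u i + v i) \<in> span W n y"
    using subrD(4)[OF W] eqv_add[of "u _" "lin_comb n a y _" "v _" "lin_comb n b y _"]
    by (intro spanI[of n "\<lambda>k. a k + b k"]) (auto simp: lin_comb_def sum.distrib distrib_right)
next
  fix c v assume "c \<in> W" "v \<in> span W n y"
  then obtain a where "\<And>k. k < n \<Longrightarrow> a k \<in> W" "\<And>i. v i \<asymp> lin_comb n a y i"
    by (metis spanE)
  then show "(\<lambda>i. c * v i) \<in> span W n y"
    using subrD(5)[OF W] \<open>c \<in> W\<close> eqv_mult_left[of "v _" "lin_comb n a y _" c]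
    by (intro spanI[of n "\<lambda>k. c * a k"]) (auto simp: lin_comb_def sum_distrib_left mult.assoc)
qed

lemma span_generator: "subr W \<Longrightarrow> k < n \<Longrightarrow> y k \<in> span W n y"
  by (rule spanI[of n "\<lambda>l. if l = k then 1 else 0"]) (auto simp: subrD lin_comb_unit)

lemma span_least: "submod W N \<Longrightarrow> (\<And>k. k < n \<Longrightarrow> y k \<in> N) \<Longrightarrow> span W n y \<subseteq> N"
proof
  fix v assume N: "submod W N" and y: "\<And>k. k < n \<Longrightarrow> y k \<in> N" and "v \<in> span W n y"
  then obtain a where a: "\<And>k. k < n \<Longrightarrow> a k \<in> W" "\<And>i. v i \<asymp> lin_comb n a y i"
    by (metis spanE)
  then show "v \<in> N"
    using submod_cong[OF N submod_lin_comb[OF N a(1) y] a(2)] by blast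
qed

lemma span_eqI:
  assumes "subr W" "\<And>k. k < n \<Longrightarrow> y k \<in> span W m z" "\<And>k. k < m \<Longrightarrow> z k \<in> span W n y"
  shows "span W n y = span W m z"
  using span_least[OF span_submod[OF assms(1)]] assms(2,3) by (metis subset_antisym)

lemma span_mono: "W \<subseteq> W' \<Longrightarrow> v \<in> span W n y \<Longrightarrow> v \<in> span W' n y"
  unfolding span_def by blast

text \<open>A generator with an invertible coefficient in a relation is a combination of the others; its
  place is taken by the last generator.\<close>

lemma drop_generator:
  assumes W: "subr W" and a: "\<And>k. k < n \<Longrightarrow> a k \<in> W" and rel: "\<And>i. lin_comb n a y i \<in> Z"
    and l: "l < n" "u \<in> W" "a l * u \<asymp> 1"
  shows "\<exists>y'. span W (n - 1) y' = span W n y"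
proof -
  define y' where "y' = (\<lambda>k. if k = l then y (n - 1) else y k)"
  have other: "y k \<in> span W (n - 1) y'" if "k < n" "k \<noteq> l" for k
  proof (cases "k = n - 1")
    case True
    then have "y' l = y k" "l < n - 1" using that l by (auto simp: y'_def)
    then show ?thesis using span_generator[OF W, of l "n - 1" y'] by simp
  next
    case False
    then have "y' k = y k" "k < n - 1" using that by (auto simp: y'_def)
    then show ?thesis using span_generator[OF W, of k "n - 1" y'] by simp
  qed
  define w where "w = (\<lambda>i. \<Sum>k\<in>{..<n} - {l}. - u * a k * y k i)"
  have "w \<in> span W (n - 1) y'"
    unfolding w_def using a l(2) other
    by (intro submod_sum[OF span_submod[OF W]] submodD(3)[OF span_submod[OF W]])
      (auto intro: subrD[OF W])
  moreover have "y l i \<asymp> w i" for i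
  proof -
    have "u * lin_comb n a y i = u * a l * y l i - w i"
      using l(1) unfolding lin_comb_def w_def
      by (subst sum.remove[of _ l]) (auto simp: algebra_simps sum_distrib_left sum_negf)
    then have "u * a l * y l i - w i \<asymp> 0"
      using Z_mult[OF rel, of u i] by (simp add: Z_iff)
    then have "u * a l * y l i \<asymp> w i"
      by (simp add: eqv_def)
    moreover have "u * a l * y l i \<asymp> y l i"
      using eqv_mult_right[OF l(3), of "y l i"] by (simp add: mult.commute)
    ultimately show ?thesis
      using eqv_trans eqv_sym by blast
  qed
  ultimately have "y l \<in> span W (n - 1) y'"
    using submod_cong[OF span_submod[OF W]] by blast
  with other have "y k \<in> span W (n - 1) y'" if "k < n" for k
    using that by (cases "k = l") auto
  moreover have "y' k \<in> span W n y" if "k < n - 1" for k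
    using that span_generator[OF W, of _ n y] by (simp add: y'_def)
  ultimately show ?thesis
    using span_eqI[OF W] by metis
qed

text \<open>Minimality refers to the number of generators, so that minimal systems exist for every
  finitely generated module.\<close>

definition minimal_generators :: "'u set \<Rightarrow> ('i \<Rightarrow> 'u) set \<Rightarrow> nat \<Rightarrow> (nat \<Rightarrow> 'i \<Rightarrow> 'u) \<Rightarrow> bool" where
  "minimal_generators W N n y \<longleftrightarrow> N = span W n y \<and> (\<forall>m<n. \<forall>z. N \<noteq> span W m z)"

lemma minimal_generators_exist:
  assumes "N = span W n y"
  shows "\<exists>m z. minimal_generators W N m z"
proof -
  define m where "m = (LEAST m. \<exists>z. N = span W m z)"
  have "\<exists>z. N = span W m z"
    unfolding m_def by (rule LeastI[of _ n]) (use assms in blast)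
  moreover have "N \<noteq> span W m' z" if "m' < m" for m' z
    using not_less_Least[of m' "\<lambda>m. \<exists>z. N = span W m z"] that unfolding m_def by blast
  ultimately show ?thesis unfolding minimal_generators_def by blast
qed

lemma minimal_generators_nonunit:
  assumes W: "subr W" and y: "minimal_generators W N n y" and a: "\<And>k. k < n \<Longrightarrow> a k \<in> W"
    and rel: "\<And>i. lin_comb n a y i \<in> Z" and l: "l < n" "u \<in> W"
  shows "\<not> a l * u \<asymp> 1"
proof
  assume "a l * u \<asymp> 1"
  then obtain y' where "span W (n - 1) y' = span W n y"
    using drop_generator[where a = a, OF W _ rel l] a by blast
  moreover have "n - 1 < n" using l(1) by simp
  ultimately show False
    using y unfolding minimal_generators_def by blast
qed

definition indep :: "'u set \<Rightarrow> nat \<Rightarrow> (nat \<Rightarrow> 'i \<Rightarrow> 'u) \<Rightarrow> bool" where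
  "indep W n y \<longleftrightarrow> (\<forall>a. (\<forall>k<n. a k \<in> W) \<and> (\<forall>i. lin_comb n a y i \<in> Z) \<longrightarrow> (\<forall>k<n. a k \<in> Z))"

lemma indepD:
  "indep W n y \<Longrightarrow> (\<And>k. k < n \<Longrightarrow> a k \<in> W) \<Longrightarrow> (\<And>i. lin_comb n a y i \<in> Z) \<Longrightarrow> k < n \<Longrightarrow> a k \<in> Z"
  unfolding indep_def by blast

lemma indep_coeff:
  assumes "indep W n y" "subr W" "\<And>k. k < n \<Longrightarrow> a k \<in> W" "\<And>k. k < n \<Longrightarrow> b k \<in> W"
    "\<And>i. lin_comb n a y i \<asymp> lin_comb n b y i" "k < n"
  shows "a k \<asymp> b k"
proof -
  have "lin_comb n (\<lambda>k. a k - b k) y i = lin_comb n a y i - lin_comb n b y i" for i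
    by (simp add: lin_comb_def left_diff_distrib sum_subtractf)
  then have "a k - b k \<in> Z"
    using assms by (intro indepD[OF assms(1), of "\<lambda>k. a k - b k"]) (auto simp: subrD eqv_def)
  then show ?thesis by (simp add: eqv_def)
qed

text \<open>Expressing \<open>y\<close> by \<open>x\<close> and then \<open>x\<close> by \<open>y\<close> gives each \<open>y i\<close> as a combination of the
  independent family \<open>y\<close>, whose coefficients can be compared.\<close>

lemma indep_coeff_matrix:
  assumes y: "indep W n y" and W: "subr W"
    and Q: "\<And>i k. i < n \<Longrightarrow> k < m \<Longrightarrow> Q i k \<in> W" "\<And>i j. i < n \<Longrightarrow> y i j \<asymp> lin_comb m (Q i) x j"
    and P: "\<And>i k. i < m \<Longrightarrow> k < n \<Longrightarrow> P i k \<in> W" "\<And>i j. i < m \<Longrightarrow> x i j \<asymp> lin_comb n (P i) y j"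
    and ij: "i < n" "j < n"
  shows "(\<Sum>k<m. Q i k * P k j) \<asymp> (if i = j then 1 else 0)"
proof (rule indep_coeff[OF y W _ _ _ ij(2)])
  fix k assume "k < n"
  then show "(\<Sum>l<m. Q i l * P l k) \<in> W"
    using P Q ij by (intro subr_sum[OF W] subrD(5)[OF W]) auto
  show "(if i = k then 1 else 0) \<in> W"
    using subrD[OF W] by simp
next
  fix r
  have "lin_comb n (\<lambda>k. \<Sum>l<m. Q i l * P l k) y r = lin_comb m (Q i) (\<lambda>l. lin_comb n (P l) y) r"
    by (simp add: lin_comb_lin_comb)
  also have "\<dots> \<asymp> lin_comb m (Q i) x r"
    using P by (intro lin_comb_eqv) (auto intro: eqv_sym)
  also have "\<dots> \<asymp> y i r"
    using eqv_sym[OF Q(2)] ij by simp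
  also have "y i r = lin_comb n (\<lambda>k. if k = i then 1 else 0) y r"
    using ij by (simp add: lin_comb_unit)
  finally show "lin_comb n (\<lambda>k. \<Sum>l<m. Q i l * P l k) y r \<asymp> lin_comb n (\<lambda>k. if i = k then 1 else 0) y r"
    by (simp add: eq_commute[of i])
qed

lemma span_matrix:
  assumes "\<And>i. i < n \<Longrightarrow> y i \<in> span W m x"
  obtains Q where "\<And>i k. i < n \<Longrightarrow> k < m \<Longrightarrow> Q i k \<in> W" "\<And>i j. i < n \<Longrightarrow> y i j \<asymp> lin_comb m (Q i) x j"
proof -
  have "\<forall>i. \<exists>a. i < n \<longrightarrow> (\<forall>k<m. a k \<in> W) \<and> (\<forall>j. y i j \<asymp> lin_comb m a x j)"
    using assms unfolding span_def by blast
  then obtain Q where "\<forall>i. i < n \<longrightarrow> (\<forall>k<m. Q i k \<in> W) \<and> (\<forall>j. y i j \<asymp> lin_comb m (Q i) x j)"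
    by metis
  then show thesis using that[of Q] by blast
qed

lemma basis_size_le:
  assumes "indep W n y" "subr W" "\<And>i. i < n \<Longrightarrow> y i \<in> span W m x" "\<And>i. i < m \<Longrightarrow> x i \<in> span W n y"
  shows "n \<le> m"
proof -
  obtain Q where Q: "\<And>i k. i < n \<Longrightarrow> k < m \<Longrightarrow> Q i k \<in> W" "\<And>i j. i < n \<Longrightarrow> y i j \<asymp> lin_comb m (Q i) x j"
    by (rule span_matrix[of n y W m x]) (use assms(3) in auto)
  obtain P where P: "\<And>i k. i < m \<Longrightarrow> k < n \<Longrightarrow> P i k \<in> W" "\<And>i j. i < m \<Longrightarrow> x i j \<asymp> lin_comb n (P i) y j"
    by (rule span_matrix[of m x W n y]) (use assms(4) in auto)
  show ?thesis
    using indep_coeff_matrix[OF assms(1,2) Q P] identity_factorization_size by blast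
qed

lemma basis_size_eq:
  assumes "indep W n y" "indep W m x" "subr W"
    "\<And>i. i < n \<Longrightarrow> y i \<in> span W m x" "\<And>i. i < m \<Longrightarrow> x i \<in> span W n y"
  shows "n = m"
  using basis_size_le[OF assms(1,3,4,5)] basis_size_le[OF assms(2,3,5,4)] by simp

definition valuation_ring :: "'u set \<Rightarrow> 'u set \<Rightarrow> bool" where
  "valuation_ring K V \<longleftrightarrow> subr V \<and> V \<subseteq> K \<and> (\<forall>x\<in>K. x \<in> V \<or> (\<exists>y\<in>V. x * y \<asymp> 1))"

definition subfld :: "'u set \<Rightarrow> bool" where
  "subfld K \<longleftrightarrow> subr K \<and> (\<forall>x\<in>K. \<forall>y. x * y \<asymp> 1 \<longrightarrow> y \<in> K)"

text \<open>The element \<open>a l\<close> is one of least valuation among the nonzero ones, and \<open>b\<close> is its inverse.\<close>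

lemma valuation_dominant:
  fixes n :: nat
  assumes K: "subfld K" and V: "valuation_ring K V" and a: "\<And>k. k < n \<Longrightarrow> a k \<in> K"
    and "k0 < n" "a k0 \<notin> Z"
  shows "\<exists>l<n. \<exists>b\<in>K. a l * b \<asymp> 1 \<and> (\<forall>k<n. a k * b \<in> V)"
  using a assms(4,5)
proof (induction n arbitrary: k0)
  case (Suc n)
  have sK: "subr K" and sV: "subr V" using K V by (auto simp: subfld_def valuation_ring_def)
  show ?case
  proof (cases "\<exists>k<n. a k \<notin> Z")
    case False
    then have "k0 = n" "a n \<notin> Z" using Suc.prems(2,3) less_Suc_eq by auto
    then obtain b where b: "a n * b \<asymp> 1" using inverse_exists by blast
    then have "b \<in> K" using K Suc.prems(1)[of n] unfolding subfld_def by blast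
    moreover have "a k * b \<in> V" if "k < Suc n" for k
    proof (cases "k = n")
      case True then show ?thesis using b subr_cong[OF sV subrD(2)[OF sV]] by simp
    next
      case k: False
      then have "a k * b \<in> Z" using False that Z_mult_right by auto
      then show ?thesis using subrD(3)[OF sV] by blast
    qed
    ultimately show ?thesis using b by blast
  next
    case True
    then obtain l b where l: "l < n" "b \<in> K" "a l * b \<asymp> 1" "\<And>k. k < n \<Longrightarrow> a k * b \<in> V"
      using Suc.IH Suc.prems(1) by (metis less_SucI)
    have anb: "a n * b \<in> K" using l Suc.prems(1)[of n] subrD(5)[OF sK] by blast
    show ?thesis
    proof (cases "a n * b \<in> V")
      case True
      then show ?thesis using l by (metis less_Suc_eq)
    next
      case False
      then obtain y where y: "y \<in> V" "a n * b * y \<asymp> 1"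
        using V anb unfolding valuation_ring_def by blast
      have "y \<in> K" using y V unfolding valuation_ring_def by blast
      then have "b * y \<in> K" using l subrD(5)[OF sK] by blast
      moreover have "a n * (b * y) \<asymp> 1" using y by (simp add: mult.assoc)
      moreover have "a k * (b * y) \<in> V" if "k < Suc n" for k
      proof (cases "k = n")
        case True
        then show ?thesis using y(2) subr_cong[OF sV subrD(2)[OF sV]] by (simp add: mult.assoc)
      next
        case False
        then have "a k * b * y \<in> V" using l(4) y(1) that subrD(5)[OF sV] by simp
        then show ?thesis by (simp add: mult.assoc)
      qed
      ultimately show ?thesis by blast
    qed
  qed
qed simp

text \<open>Dividing a relation over \<open>K\<close> by its coefficient of least valuation gives a relation over \<open>V\<close>
  with a coefficient 1, so that a generator could be dropped. This is the freeness of
  finitely generated torsion-free modules over a valuation ring.\<close>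

lemma valuation_minimal_indep:
  assumes K: "subfld K" and V: "valuation_ring K V" and y: "minimal_generators V N n y"
  shows "indep K n y"
  unfolding indep_def
proof (intro allI impI, rule ccontr)
  fix a k0 assume *: "(\<forall>k<n. a k \<in> K) \<and> (\<forall>i. lin_comb n a y i \<in> Z)" and k0: "k0 < n" "a k0 \<notin> Z"
  from * have a: "\<forall>k<n. a k \<in> K" and rel: "\<forall>i. lin_comb n a y i \<in> Z" by auto
  have sV: "subr V" using V by (auto simp: valuation_ring_def)
  obtain l b where l: "l < n" "b \<in> K" "a l * b \<asymp> 1" "\<And>k. k < n \<Longrightarrow> a k * b \<in> V"
    using valuation_dominant[where a = a, OF K V _ k0] a by blast
  have "lin_comb n (\<lambda>k. a k * b) y i = b * lin_comb n a y i" for i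
    by (simp add: lin_comb_def sum_distrib_left ac_simps)
  then have "lin_comb n (\<lambda>k. a k * b) y i \<in> Z" for i
    using rel Z_mult by metis
  then have "\<not> a l * b * 1 \<asymp> 1"
    using minimal_generators_nonunit[OF sV y, of "\<lambda>k. a k * b"] l subrD(2)[OF sV] by blast
  then show False using l by simp
qed

lemma subfld_valuation: "subfld K \<Longrightarrow> valuation_ring K K"
  unfolding valuation_ring_def subfld_def by auto

end

section \<open>Essential primes of a Noetherian domain\<close>

locale noetherian_subdomain = residue_field +
  fixes A :: "'a set"
  assumes A_subr: "subr A"
    and A_noetherian: "J \<subseteq> A \<Longrightarrow> Z \<subseteq> J \<Longrightarrow> (\<And>x y. x \<in> J \<Longrightarrow> y \<in> J \<Longrightarrow> x + y \<in> J) \<Longrightarrow>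
      (\<And>a x. a \<in> A \<Longrightarrow> x \<in> J \<Longrightarrow> a * x \<in> J) \<Longrightarrow>
      \<exists>n y. (\<forall>k<n::nat. y k \<in> J) \<and> (\<forall>x\<in>J. \<exists>a. (\<forall>k<n. a k \<in> A) \<and> x \<asymp> (\<Sum>k<n. a k * y k))"
begin

definition ideal_in_A :: "'a set \<Rightarrow> bool" where
  "ideal_in_A J \<longleftrightarrow> J \<subseteq> A \<and> Z \<subseteq> J \<and> (\<forall>x\<in>J. \<forall>y\<in>J. x + y \<in> J) \<and> (\<forall>a\<in>A. \<forall>x\<in>J. a * x \<in> J)"

lemma ideal_cong: "ideal_in_A J \<Longrightarrow> x \<in> J \<Longrightarrow> y \<asymp> x \<Longrightarrow> y \<in> J"
  unfolding ideal_in_A_def eqv_def by (metis add_diff_cancel_left' add_diff_eq subsetD)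

lemma ideal_sum: "ideal_in_A J \<Longrightarrow> (\<And>k. k \<in> S \<Longrightarrow> f k \<in> J) \<Longrightarrow> sum f S \<in> J"
  by (induction S rule: infinite_finite_induct) (auto simp: ideal_in_A_def Z_zero subset_eq)

text \<open>The union of a chain of ideals is finitely generated and therefore belongs to the chain.\<close>

lemma maximal_in_family:
  assumes "\<F> \<noteq> {}" "\<And>J. J \<in> \<F> \<Longrightarrow> ideal_in_A J"
  shows "\<exists>M\<in>\<F>. \<forall>J\<in>\<F>. M \<subseteq> J \<longrightarrow> J = M"
proof (rule subset_Zorn_nonempty[OF assms(1)])
  fix C assume C: "C \<noteq> {}" "subset.chain \<F> C"
  then have sub: "C \<subseteq> \<F>" by (simp add: subset.chain_def)
  have id: "ideal_in_A J" if "J \<in> C" for J using that sub assms(2) by blast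
  have "\<exists>n y. (\<forall>k<n::nat. y k \<in> \<Union>C) \<and> (\<forall>x\<in>\<Union>C. \<exists>a. (\<forall>k<n. a k \<in> A) \<and> x \<asymp> (\<Sum>k<n. a k * y k))"
  proof (rule A_noetherian)
    fix x y assume "x \<in> \<Union>C" "y \<in> \<Union>C"
    then obtain J J' where J: "J \<in> C" "J' \<in> C" "x \<in> J" "y \<in> J'" by blast
    then have "J \<subseteq> J' \<or> J' \<subseteq> J" using C(2) by (auto simp: subset.chain_def)
    then show "x + y \<in> \<Union>C" using J id unfolding ideal_in_A_def by blast
  next
    show "\<Union>C \<subseteq> A" "Z \<subseteq> \<Union>C"
      using C(1) id unfolding ideal_in_A_def by blast+
    show "a * x \<in> \<Union>C" if "a \<in> A" "x \<in> \<Union>C" for a x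
      using that id unfolding ideal_in_A_def by blast
  qed
  then obtain n y where y: "\<forall>k<n::nat. y k \<in> \<Union>C"
    "\<forall>x\<in>\<Union>C. \<exists>a. (\<forall>k<n. a k \<in> A) \<and> x \<asymp> (\<Sum>k<n. a k * y k)" by (elim exE conjE) (rule that)
  obtain J where J: "J \<in> C" "y ` {..<n} \<subseteq> J"
    by (rule finite_subset_Union_chain[of "y ` {..<n}" C \<F>]) (use y(1) C in auto)
  have "\<Union>C \<subseteq> J"
  proof
    fix x assume "x \<in> \<Union>C"
    then obtain a where a: "\<forall>k<n. a k \<in> A" "x \<asymp> (\<Sum>k<n. a k * y k)" using y(2) by blast
    have "(\<Sum>k<n. a k * y k) \<in> J"
      using id[OF J(1)] a(1) J(2) by (intro ideal_sum) (auto simp: ideal_in_A_def)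
    then show "x \<in> J" using ideal_cong[OF id[OF J(1)]] a(2) by blast
  qed
  then have "\<Union>C = J" using J(1) by blast
  then show "\<Union>C \<in> \<F>" using J(1) sub by blast
qed

definition prime_in_A :: "'a set \<Rightarrow> bool" where
  "prime_in_A q \<longleftrightarrow> ideal_in_A q \<and> 1 \<notin> q \<and> (\<forall>x\<in>A. \<forall>y\<in>A. x * y \<in> q \<longrightarrow> x \<in> q \<or> y \<in> q)"

definition loc :: "'a set \<Rightarrow> 'a set" where
  "loc q = {x. \<exists>s\<in>A. s \<notin> q \<and> s * x \<in> A}"

text \<open>As \<open>Z\<close> represents the zero ideal, this is the fraction field.\<close>

abbreviation "K \<equiv> loc Z"

lemma prime_Z: "prime_in_A Z"
  using A_subr Z_proper Z_prime Z_mult Z_add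
  by (auto simp: prime_in_A_def ideal_in_A_def subr_def)

lemma prime_mult_notin: "prime_in_A q \<Longrightarrow> s \<in> A \<Longrightarrow> t \<in> A \<Longrightarrow> s \<notin> q \<Longrightarrow> t \<notin> q \<Longrightarrow> s * t \<notin> q"
  unfolding prime_in_A_def by blast

lemma prime_Z_subset: "prime_in_A q \<Longrightarrow> Z \<subseteq> q"
  unfolding prime_in_A_def ideal_in_A_def by blast

lemma A_subset_loc: "prime_in_A q \<Longrightarrow> A \<subseteq> loc q"
  using subrD[OF A_subr] by (auto simp: loc_def prime_in_A_def intro!: bexI[of _ 1])

lemma loc_subset_K: "prime_in_A q \<Longrightarrow> loc q \<subseteq> K"
  using prime_Z_subset by (auto simp: loc_def)

lemma locI: "s \<in> A \<Longrightarrow> s \<notin> q \<Longrightarrow> s * x \<in> A \<Longrightarrow> x \<in> loc q"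
  unfolding loc_def by blast

lemma loc_subr:
  assumes q: "prime_in_A q"
  shows "subr (loc q)"
  unfolding subr_def
proof (intro conjI ballI)
  show "Z \<subseteq> loc q" "1 \<in> loc q"
    using A_subset_loc[OF q] A_subr by (auto simp: subr_def)
  fix x assume "x \<in> loc q"
  then obtain s where s: "s \<in> A" "s \<notin> q" "s * x \<in> A" by (auto simp: loc_def)
  show "- x \<in> loc q"
    by (rule locI[OF s(1,2)]) (use subrD(6)[OF A_subr s(3)] in simp)
  fix y assume "y \<in> loc q"
  then obtain t where t: "t \<in> A" "t \<notin> q" "t * y \<in> A" by (auto simp: loc_def)
  have st: "s * t \<in> A" "s * t \<notin> q"
    using s t prime_mult_notin[OF q] subrD(5)[OF A_subr] by auto
  have "s * t * (x + y) = t * (s * x) + s * (t * y)" "s * t * (x * y) = (s * x) * (t * y)"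
    by (simp_all add: algebra_simps)
  moreover have "t * (s * x) + s * (t * y) \<in> A" "(s * x) * (t * y) \<in> A"
    using s t by (auto intro!: subrD(4,5)[OF A_subr])
  ultimately show "x + y \<in> loc q" "x * y \<in> loc q"
    using locI[OF st] by metis+
qed

lemma K_subfld: "subfld K"
  unfolding subfld_def
proof (intro conjI ballI allI impI)
  show "subr K" by (rule loc_subr[OF prime_Z])
  fix x y assume "x \<in> K" and xy: "x * y \<asymp> 1"
  then obtain s where s: "s \<in> A" "s \<notin> Z" "s * x \<in> A" by (auto simp: loc_def)
  have "s * x \<notin> Z" using Z_prime s(2) inverse_notin(1)[OF xy] by blast
  moreover have "s * x * y \<in> A"
    using subr_cong[OF A_subr s(1)] eqv_mult_left[OF xy, of s] by (simp add: mult.assoc)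
  ultimately show "y \<in> K" using s(3) locI by blast
qed

lemmas K_subr = loc_subr[OF prime_Z]
lemmas A_subset_K = A_subset_loc[OF prime_Z]

lemma K_inverse: "x \<in> K \<Longrightarrow> x * y \<asymp> 1 \<Longrightarrow> y \<in> K"
  using K_subfld unfolding subfld_def by blast

lemma common_denominator:
  assumes q: "prime_in_A q" and "\<And>k. k < n \<Longrightarrow> x k \<in> loc q"
  shows "\<exists>s\<in>A. s \<notin> q \<and> (\<forall>k<n::nat. s * x k \<in> A)"
  using assms(2)
proof (induction n)
  case 0
  then show ?case using q subrD(2)[OF A_subr] by (auto simp: prime_in_A_def)
next
  case (Suc n)
  then obtain s where s: "s \<in> A" "s \<notin> q" "\<And>k. k < n \<Longrightarrow> s * x k \<in> A" by (metis less_SucI)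
  obtain t where t: "t \<in> A" "t \<notin> q" "t * x n \<in> A" using Suc.prems[of n] by (auto simp: loc_def)
  have "s * t * x k \<in> A" if "k < Suc n" for k
  proof (cases "k = n")
    case True
    then show ?thesis using subrD(5)[OF A_subr s(1) t(3)] by (simp add: ac_simps)
  next
    case False
    then show ?thesis using subrD(5)[OF A_subr t(1) s(3)[of k]] that by (simp add: ac_simps)
  qed
  moreover have "s * t \<in> A" "s * t \<notin> q"
    using s t prime_mult_notin[OF q] subrD(5)[OF A_subr] by auto
  ultimately show ?case by blast
qed

definition ann :: "'a \<Rightarrow> 'a set" where
  "ann t = {x \<in> A. x * t \<in> A}"

lemma ann_ideal: "ideal_in_A (ann t)"
  using subrD[OF A_subr] subrD(3)[OF A_subr Z_mult_right]
  by (auto simp: ideal_in_A_def ann_def distrib_right mult.assoc)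

definition essential_primes :: "'a set set" where
  "essential_primes = {q. prime_in_A q \<and> (\<exists>t\<in>K. q = ann t)}"

text \<open>As in the construction of associated primes, a maximal one among the ideals \<open>ann (r * t)\<close>
  with \<open>r * t\<close> outside \<open>A\<close> is prime.\<close>

lemma essential_prime_exists:
  assumes "t \<in> K" "t \<notin> A"
  shows "\<exists>r\<in>A. ann (r * t) \<in> essential_primes"
proof -
  let ?\<F> = "{ann (r * t) | r. r \<in> A \<and> r * t \<notin> A}"
  have "?\<F> \<noteq> {}"
    using assms subrD(2)[OF A_subr] by force
  moreover have "\<And>J. J \<in> ?\<F> \<Longrightarrow> ideal_in_A J" using ann_ideal by auto
  ultimately obtain M where M: "M \<in> ?\<F>" and mx: "\<forall>J\<in>?\<F>. M \<subseteq> J \<longrightarrow> J = M"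
    using maximal_in_family[of ?\<F>] by auto
  then obtain r where r: "r \<in> A" "r * t \<notin> A" and Mr: "M = ann (r * t)"
    by auto
  have max: "ann (r' * t) = ann (r * t)" if "r' \<in> A" "r' * t \<notin> A" "ann (r * t) \<subseteq> ann (r' * t)" for r'
    using bspec[OF mx, of "ann (r' * t)"] that unfolding Mr by auto
  have "prime_in_A (ann (r * t))"
    unfolding prime_in_A_def
  proof (intro conjI ballI impI disjCI)
    show "ideal_in_A (ann (r * t))" by (rule ann_ideal)
    show "1 \<notin> ann (r * t)" using r by (simp add: ann_def)
    fix x y assume x: "x \<in> A" and y: "y \<in> A" and xy: "x * y \<in> ann (r * t)" "y \<notin> ann (r * t)"
    have "y * r * t \<notin> A" using xy(2) y by (simp add: ann_def mult.assoc)
    moreover have "ann (r * t) \<subseteq> ann (y * r * t)"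
    proof
      fix u assume "u \<in> ann (r * t)"
      then have u: "u \<in> A" "u * (r * t) \<in> A" by (simp_all add: ann_def)
      have "u * (y * r * t) = y * (u * (r * t))" by (simp add: ac_simps)
      also have "\<dots> \<in> A" by (rule subrD(5)[OF A_subr y u(2)])
      finally show "u \<in> ann (y * r * t)"
        using u(1) by (simp add: ann_def)
    qed
    ultimately have "ann (y * r * t) = ann (r * t)"
      using max[of "y * r"] subrD(5)[OF A_subr y r(1)] by simp
    moreover have "x \<in> ann (y * r * t)"
      using xy(1) x by (simp add: ann_def mult.assoc)
    ultimately show "x \<in> ann (r * t)" by simp
  qed
  moreover have "r * t \<in> K"
    using subrD(5)[OF K_subr] r(1) A_subset_K assms(1) by blast
  ultimately show ?thesis using r(1) unfolding essential_primes_def by blast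
qed

lemma essential_primeD:
  assumes "q \<in> essential_primes"
  shows "prime_in_A q" "\<exists>t\<in>K. t \<notin> A \<and> q = ann t"
  using assms subrD(2)[OF A_subr] unfolding essential_primes_def prime_in_A_def ann_def by auto

text \<open>Every denominator of \<open>x\<close> belongs to the ideals \<open>ann (r * x)\<close>, and one of them is an
  essential prime if \<open>x\<close> is not in \<open>A\<close>.\<close>

lemma A_eq_Inter_loc:
  assumes "x \<in> K" "\<And>q. q \<in> essential_primes \<Longrightarrow> x \<in> loc q"
  shows "x \<in> A"
proof (rule ccontr)
  assume "x \<notin> A"
  then obtain r where r: "r \<in> A" "ann (r * x) \<in> essential_primes"
    using essential_prime_exists[OF assms(1)] by blast
  obtain s where s: "s \<in> A" "s \<notin> ann (r * x)" "s * x \<in> A"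
    using assms(2)[OF r(2)] by (auto simp: loc_def)
  have "s * (r * x) \<in> A"
    using subrD(5)[OF A_subr r(1) s(3)] by (simp add: ac_simps)
  then show False using s by (simp add: ann_def)
qed

text \<open>Write the given element of \<open>K\<close> as \<open>x = (a x) / a\<close> and let \<open>H\<close> be the inverse of the
  fractional ideal generated by \<open>a\<close> and \<open>a x\<close>. If a member of \<open>H\<close> multiplies one of the two
  generators to an element outside \<open>q = ann t\<close>, then \<open>x\<close> or its inverse has a denominator
  outside \<open>q\<close>. Otherwise \<open>H\<close> times the ideal lies in \<open>q\<close>, so \<open>H\<close> is stable under \<open>t\<close>; then
  all \<open>a t\<^sup>k\<close> lie in \<open>A\<close> and complete integral closedness contradicts \<open>t \<notin> A\<close>.\<close>

lemma essential_loc_valuation: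
  assumes cic: "\<And>x t. x \<in> A \<Longrightarrow> x \<notin> Z \<Longrightarrow> t \<in> K \<Longrightarrow> (\<And>k. x * t ^ k \<in> A) \<Longrightarrow> t \<in> A"
    and q: "q \<in> essential_primes"
  shows "valuation_ring K (loc q)"
  unfolding valuation_ring_def
proof (intro conjI ballI)
  have pq: "prime_in_A q" and iq: "ideal_in_A q" using essential_primeD(1)[OF q] by (auto simp: prime_in_A_def)
  show "subr (loc q)" "loc q \<subseteq> K" using loc_subr[OF pq] loc_subset_K[OF pq] by auto
  obtain t where t: "t \<in> K" "t \<notin> A" "q = ann t" using essential_primeD(2)[OF q] by blast
  fix x assume "x \<in> K"
  then obtain a where a: "a \<in> A" "a \<notin> Z" "a * x \<in> A" by (auto simp: loc_def)
  define H where "H = {h. h * a \<in> A \<and> h * (a * x) \<in> A}"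
  consider h where "h \<in> H" "h * a \<notin> q" | h where "h \<in> H" "h * (a * x) \<notin> q"
    | "\<And>h. h \<in> H \<Longrightarrow> h * a \<in> q \<and> h * (a * x) \<in> q" by blast
  then show "x \<in> loc q \<or> (\<exists>y\<in>loc q. x * y \<asymp> 1)"
  proof cases
    case 1
    then have "x \<in> loc q" by (intro locI[of "h * a"]) (auto simp: H_def mult.assoc)
    then show ?thesis ..
  next
    case 2
    have "x \<notin> Z" using 2(2) Z_mult prime_Z_subset[OF pq] by blast
    then obtain y where y: "x * y \<asymp> 1" using inverse_exists by blast
    have "h * (a * x) * y \<asymp> h * a"
      using eqv_mult_left[OF y, of "h * a"] by (simp add: mult.assoc)
    then have "y \<in> loc q"
      using 2 subr_cong[OF A_subr] by (intro locI[of "h * (a * x)"]) (auto simp: H_def)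
    then show ?thesis using y by blast
  next
    case 3
    have "t ^ k \<in> H" for k
    proof (induction k)
      case 0 then show ?case using a by (simp add: H_def)
    next
      case (Suc k)
      then show ?case using 3[OF Suc] by (auto simp: H_def t(3) ann_def ac_simps)
    qed
    then have "a * t ^ k \<in> A" for k by (simp add: H_def mult.commute)
    then have "t \<in> A" using cic a t by blast
    then show ?thesis using t by blast
  qed
qed

end

section \<open>Generators, relations and localization of modules\<close>

definition cat :: "nat \<Rightarrow> (nat \<Rightarrow> 'x) \<Rightarrow> (nat \<Rightarrow> 'x) \<Rightarrow> nat \<Rightarrow> 'x" where
  "cat m y z = (\<lambda>i. if i < m then y i else z (i - m))"

lemma lin_comb_cat: "lin_comb (m + n) (cat m a b) (cat m y z) i = lin_comb m a y i + lin_comb n b z i"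
  by (induction n) (auto simp: lin_comb_def cat_def add.assoc intro!: sum.cong)

lemma lin_comb_transpose: "lin_comb b (lin_comb n a M) g = lin_comb n a (\<lambda>k. lin_comb b (M k) g)"
  by (simp add: lin_comb_lin_comb) (simp add: lin_comb_def)

definition uvec :: "nat \<Rightarrow> nat \<Rightarrow> 'u::comm_ring_1" where
  "uvec j = (\<lambda>k. if k = j then 1 else 0)"

context noetherian_subdomain
begin

text \<open>The free module of rank \<open>b\<close> over \<open>W\<close>, as families on all natural numbers that vanish from
  \<open>b\<close> on.\<close>

definition coords :: "'a set \<Rightarrow> nat \<Rightarrow> (nat \<Rightarrow> 'a) set" where
  "coords W b = {v. (\<forall>k<b. v k \<in> W) \<and> (\<forall>k\<ge>b. v k \<in> Z)}"

lemma coords_submod: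
  assumes "subr W"
  shows "submod W (coords W b)"
  unfolding submod_def coords_def using Z_add Z_mult by (auto simp: subrD(3-5)[OF assms])

lemma coords_mono: "W \<subseteq> W' \<Longrightarrow> coords W b \<subseteq> coords W' b"
  unfolding coords_def by blast

lemma uvec_coords: "subr W \<Longrightarrow> j < b \<Longrightarrow> uvec j \<in> coords W b"
  unfolding coords_def uvec_def by (auto simp: subrD(1,2) Z_zero)

lemma lin_comb_uvec: "lin_comb b v uvec i = (if i < b then v i else 0)"
  unfolding lin_comb_def uvec_def by (simp add: if_distrib[of "(*) _"] cong: if_cong)

lemma coords_span: "v \<in> coords W b \<Longrightarrow> v \<in> span W b uvec"
  by (rule spanI[of b v]) (auto simp: coords_def lin_comb_uvec Z_iff)

lemma uvec_indep: "indep W b uvec"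
  unfolding indep_def
proof (intro allI impI)
  fix a k assume "(\<forall>k<b. a k \<in> W) \<and> (\<forall>i. lin_comb b a uvec i \<in> Z)" "k < b"
  then show "a k \<in> Z" using lin_comb_uvec[of b a k] by metis
qed

text \<open>Induction on the rank: the last coordinates of the elements of \<open>Y\<close> form an ideal, and the
  elements with last coordinate zero a submodule of a free module of smaller rank. Lifts of
  generators of the former and generators of the latter together generate \<open>Y\<close>.\<close>

lemma submodule_fg:
  assumes "submod A Y" "Y \<subseteq> coords A b"
  shows "\<exists>n y. Y = span A n y"
  using assms
proof (induction b arbitrary: Y)
  case 0
  have "v \<in> Y \<longleftrightarrow> (\<forall>i. v i \<in> Z)" for v
    using 0(2) submodD(1)[OF 0(1), of v] by (auto simp: coords_def)
  then have "Y = span A 0 (\<lambda>_ _. 0)"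
    by (simp add: set_eq_iff span_def lin_comb_def Z_iff)
  then show ?case by blast
next
  case (Suc b)
  note Y = Suc.prems(1)
  define J where "J = (\<lambda>v. v b) ` Y"
  have "\<exists>n y. (\<forall>k<n::nat. y k \<in> J) \<and> (\<forall>x\<in>J. \<exists>a. (\<forall>k<n. a k \<in> A) \<and> x \<asymp> (\<Sum>k<n. a k * y k))"
  proof (rule A_noetherian)
    show "J \<subseteq> A" using Suc.prems(2) by (auto simp: J_def coords_def)
    show "Z \<subseteq> J"
    proof
      fix z assume "z \<in> Z"
      then have "(\<lambda>_. z) \<in> Y" by (rule submodD(1)[OF Y])
      then show "z \<in> J" unfolding J_def by (rule rev_image_eqI) simp
    qed
    show "x + y \<in> J" if xy: "x \<in> J" "y \<in> J" for x y
    proof -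
      obtain u v where "u \<in> Y" "v \<in> Y" "x = u b" "y = v b" using xy by (auto simp: J_def)
      then show ?thesis
        unfolding J_def by (intro rev_image_eqI[OF submodD(2)[OF Y, of u v]]) auto
    qed
    show "a * x \<in> J" if ax: "a \<in> A" "x \<in> J" for a x
    proof -
      obtain u where "u \<in> Y" "x = u b" using ax by (auto simp: J_def)
      then show ?thesis
        unfolding J_def by (intro rev_image_eqI[OF submodD(3)[OF Y ax(1), of u]]) auto
    qed
  qed
  then obtain n y where y: "\<forall>k<n::nat. y k \<in> J"
    "\<forall>x\<in>J. \<exists>a. (\<forall>k<n. a k \<in> A) \<and> x \<asymp> (\<Sum>k<n. a k * y k)" by (elim exE conjE) (rule that)
  have "\<forall>k. \<exists>v. k < n \<longrightarrow> v \<in> Y \<and> v b = y k"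
  proof
    fix k
    show "\<exists>v. k < n \<longrightarrow> v \<in> Y \<and> v b = y k"
      using y(1) by (cases "k < n") (auto simp: J_def image_iff Bex_def eq_commute)
  qed
  then obtain L where "\<forall>k. k < n \<longrightarrow> L k \<in> Y \<and> L k b = y k"
    by (rule choice[THEN exE]) blast
  then have L: "\<And>k. k < n \<Longrightarrow> L k \<in> Y" "\<And>k. k < n \<Longrightarrow> L k b = y k" by auto
  define Y' where "Y' = {v \<in> Y. v b \<in> Z}"
  have "submod A Y'"
    unfolding submod_def Y'_def
    using submodD[OF Y] Z_add Z_mult by blast
  moreover have "Y' \<subseteq> coords A b"
  proof
    fix v assume "v \<in> Y'"
    then have v: "v b \<in> Z" "v \<in> coords A (Suc b)" using Suc.prems(2) by (auto simp: Y'_def)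
    have "v k \<in> Z" if "b \<le> k" for k
      using v that by (cases "k = b") (auto simp: coords_def)
    then show "v \<in> coords A b" using v by (auto simp: coords_def)
  qed
  ultimately obtain m z where z: "Y' = span A m z" using Suc.IH by blast
  have "z k \<in> Y'" if "k < m" for k
    unfolding z by (rule span_generator[OF A_subr that])
  then have zY: "z k \<in> Y" if "k < m" for k
    using that by (simp add: Y'_def)
  let ?g = "cat n L z"
  have g: "?g k \<in> Y" if "k < n + m" for k
    using that L(1) zY[of "k - n"] by (auto simp: cat_def)
  have "v \<in> span A (n + m) ?g" if v: "v \<in> Y" for v
  proof -
    obtain a where a: "\<And>k. k < n \<Longrightarrow> a k \<in> A" "v b \<asymp> (\<Sum>k<n. a k * y k)"
      using bspec[OF y(2), of "v b"] v by (auto simp: J_def)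
    have lcY: "lin_comb n a L \<in> Y" by (rule submod_lin_comb[OF Y a(1) L(1)])
    have "(\<Sum>k<n. a k * y k) = lin_comb n a L b"
      unfolding lin_comb_def by (intro sum.cong) (auto simp: L(2))
    then have "(\<lambda>i. v i - lin_comb n a L i) \<in> Y'"
      using a(2) submod_diff[OF Y A_subr v lcY] by (simp add: Y'_def eqv_def)
    then obtain c where c: "\<And>k. k < m \<Longrightarrow> c k \<in> A" "\<And>i. v i - lin_comb n a L i \<asymp> lin_comb m c z i"
      unfolding z span_def by auto
    show ?thesis
    proof (rule spanI[of _ "cat n a c"])
      show "cat n a c k \<in> A" if "k < n + m" for k using a c that by (auto simp: cat_def)
      show "v i \<asymp> lin_comb (n + m) (cat n a c) ?g i" for i
        using eqv_add[OF eqv_refl c(2)[of i], of "lin_comb n a L i"] by (simp add: lin_comb_cat)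
    qed
  qed
  then have "Y = span A (n + m) ?g"
    using span_least[OF Y, of "n + m" ?g] g by blast
  then show ?case by blast
qed

text \<open>The localization of \<open>N\<close> at \<open>q\<close>, inside the vector space over the field.\<close>

definition locm :: "'a set \<Rightarrow> ('i \<Rightarrow> 'a) set \<Rightarrow> ('i \<Rightarrow> 'a) set" where
  "locm q N = {v. \<exists>s\<in>A. s \<notin> q \<and> (\<lambda>i. s * v i) \<in> N}"

lemma loc_inverse:
  assumes "prime_in_A q" "s \<in> A" "s \<notin> q"
  shows "\<exists>u\<in>loc q. s * u \<asymp> 1"
proof -
  have "s \<notin> Z" using assms prime_Z_subset by blast
  then obtain u where u: "s * u \<asymp> 1" using inverse_exists by blast
  then have "s * u \<in> A" using subr_cong[OF A_subr subrD(2)[OF A_subr]] by blast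
  then show ?thesis using u locI[OF assms(2,3)] by blast
qed

lemma locm_span:
  assumes q: "prime_in_A q"
  shows "locm q (span A n y) = span (loc q) n y"
proof (intro subset_antisym subsetI)
  fix v assume "v \<in> locm q (span A n y)"
  then obtain s a where s: "s \<in> A" "s \<notin> q" and a: "\<And>k. k < n \<Longrightarrow> a k \<in> A" "\<And>i. s * v i \<asymp> lin_comb n a y i"
    unfolding locm_def by (auto elim!: spanE)
  obtain u where u: "u \<in> loc q" "s * u \<asymp> 1" using loc_inverse[OF q s] by blast
  show "v \<in> span (loc q) n y"
  proof (rule spanI[of _ "\<lambda>k. u * a k"])
    show "u * a k \<in> loc q" if "k < n" for k
      using subrD(5)[OF loc_subr[OF q] u(1)] a(1)[OF that] A_subset_loc[OF q] by blast
    fix i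
    have "v i = 1 * v i" by simp
    also have "\<dots> \<asymp> s * u * v i" by (rule eqv_mult_right[OF eqv_sym[OF u(2)]])
    also have "\<dots> = u * (s * v i)" by (simp add: ac_simps)
    also have "\<dots> \<asymp> u * lin_comb n a y i" by (rule eqv_mult_left[OF a(2)])
    also have "\<dots> = lin_comb n (\<lambda>k. u * a k) y i" by (simp add: lin_comb_def sum_distrib_left mult.assoc)
    finally show "v i \<asymp> lin_comb n (\<lambda>k. u * a k) y i" .
  qed
next
  fix v assume "v \<in> span (loc q) n y"
  then obtain a where a: "\<And>k. k < n \<Longrightarrow> a k \<in> loc q" "\<And>i. v i \<asymp> lin_comb n a y i" by (metis spanE)
  obtain s where s: "s \<in> A" "s \<notin> q" "\<And>k. k < n \<Longrightarrow> s * a k \<in> A"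
    using common_denominator[OF q, of n a] a(1) by blast
  have "(\<lambda>i. s * v i) \<in> span A n y"
  proof (rule spanI[of _ "\<lambda>k. s * a k"])
    show "s * v i \<asymp> lin_comb n (\<lambda>k. s * a k) y i" for i
      using eqv_mult_left[OF a(2)[of i], of s] by (simp add: lin_comb_def sum_distrib_left mult.assoc)
  qed (use s in auto)
  then show "v \<in> locm q (span A n y)" using s unfolding locm_def by blast
qed

definition relations :: "nat \<Rightarrow> (nat \<Rightarrow> 'i \<Rightarrow> 'a) \<Rightarrow> (nat \<Rightarrow> 'a) set" where
  "relations b g = {w \<in> coords A b. \<forall>i. lin_comb b w g i \<in> Z}"

lemma lin_comb_smult: "lin_comb b (\<lambda>k. s * w k) g i = s * lin_comb b w g i"
  by (simp add: lin_comb_def sum_distrib_left mult.assoc)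

lemma lin_comb_diff: "lin_comb b (\<lambda>k. v k - w k) g i = lin_comb b v g i - lin_comb b w g i"
  by (simp add: lin_comb_def left_diff_distrib sum_subtractf)

lemma lin_comb_plus: "lin_comb b (\<lambda>k. v k + w k) g i = lin_comb b v g i + lin_comb b w g i"
  by (simp add: lin_comb_def distrib_right sum.distrib)

lemma relations_submod: "submod A (relations b g)"
proof -
  have "lin_comb b v g i \<in> Z" if "\<forall>i. v i \<in> Z" for v i
    unfolding lin_comb_def using that by (intro Z_sum Z_mult_right) auto
  then show ?thesis
    using coords_submod[OF A_subr, of b] Z_add Z_mult
    unfolding submod_def relations_def by (auto simp: lin_comb_smult lin_comb_plus)
qed

lemma locm_relations:
  assumes q: "prime_in_A q"
  shows "locm q (relations b g) = {w \<in> coords (loc q) b. \<forall>i. lin_comb b w g i \<in> Z}"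
proof (intro subset_antisym subsetI)
  fix w assume "w \<in> locm q (relations b g)"
  then obtain s where s: "s \<in> A" "s \<notin> q" "(\<lambda>i. s * w i) \<in> relations b g" by (auto simp: locm_def)
  have "s \<notin> Z" using s prime_Z_subset[OF q] by blast
  then show "w \<in> {w \<in> coords (loc q) b. \<forall>i. lin_comb b w g i \<in> Z}"
    using s by (auto simp: relations_def coords_def lin_comb_smult dest: Z_prime intro!: locI[OF s(1,2)])
next
  fix w assume "w \<in> {w \<in> coords (loc q) b. \<forall>i. lin_comb b w g i \<in> Z}"
  then have w: "w \<in> coords (loc q) b" "\<And>i. lin_comb b w g i \<in> Z" by auto
  then obtain s where s: "s \<in> A" "s \<notin> q" "\<And>k. k < b \<Longrightarrow> s * w k \<in> A"
    using common_denominator[OF q, of b w] by (auto simp: coords_def)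
  then have "(\<lambda>i. s * w i) \<in> relations b g"
    using w Z_mult by (auto simp: relations_def coords_def lin_comb_smult)
  then show "w \<in> locm q (relations b g)" using s by (auto simp: locm_def)
qed

lemma span_lift:
  assumes "z \<in> span W b g" "subr W"
  obtains w where "w \<in> coords W b" "\<And>i. z i \<asymp> lin_comb b w g i"
proof -
  obtain a where a: "\<And>k. k < b \<Longrightarrow> a k \<in> W" "\<And>i. z i \<asymp> lin_comb b a g i" using assms(1) by (metis spanE)
  define w where "w = (\<lambda>k. if k < b then a k else 0)"
  have "lin_comb b w g = lin_comb b a g" by (auto simp: lin_comb_def w_def)
  then show thesis using that[of w] a Z_zero by (auto simp: coords_def w_def)
qed

text \<open>The vectors \<open>z\<close> are a basis of the module generated by \<open>g\<close>, which is free over a valuation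
  ring, and the \<open>w\<close> are preimages of them in the free module on these generators.\<close>

lemma free_basis:
  assumes V: "valuation_ring K V"
  obtains c z w where "indep K c z" "\<And>k. k < c \<Longrightarrow> w k \<in> coords V b"
    "\<And>k i. k < c \<Longrightarrow> z k i \<asymp> lin_comb b (w k) g i" "span V b g = span V c z"
proof -
  have sV: "subr V" using V by (simp add: valuation_ring_def)
  obtain c z where cz: "minimal_generators V (span V b g) c z"
    using minimal_generators_exist[OF refl] by blast
  then have sp: "span V b g = span V c z" by (simp add: minimal_generators_def)
  have "\<forall>k. \<exists>w. k < c \<longrightarrow> w \<in> coords V b \<and> (\<forall>i. z k i \<asymp> lin_comb b w g i)"
  proof (intro allI)
    fix k
    show "\<exists>w. k < c \<longrightarrow> w \<in> coords V b \<and> (\<forall>i. z k i \<asymp> lin_comb b w g i)"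
    proof (cases "k < c")
      case True
      then have "z k \<in> span V b g" using span_generator[OF sV, of k c z] sp by simp
      then obtain w where "w \<in> coords V b" "\<And>i. z k i \<asymp> lin_comb b w g i"
        using span_lift[OF _ sV] by metis
      then show ?thesis by blast
    qed simp
  qed
  then obtain w where "\<And>k. k < c \<Longrightarrow> w k \<in> coords V b \<and> (\<forall>i. z k i \<asymp> lin_comb b (w k) g i)" by metis
  then show thesis using that[of c z w] valuation_minimal_indep[OF K_subfld V cz] sp by blast
qed

text \<open>The exact sequence of relations, free module and quotient splits at \<open>q\<close>: a basis \<open>y\<close> of the
  relations and preimages \<open>w\<close> of a basis \<open>z\<close> of the quotient form a basis of the free
  module. Their independence is \<open>complement_indep\<close>.\<close>

lemma complement_spans:
  assumes q: "prime_in_A q" and y: "locm q (relations b g) \<subseteq> span (loc q) c' y"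
    and w: "\<And>k. k < c \<Longrightarrow> w k \<in> coords (loc q) b" "\<And>k i. k < c \<Longrightarrow> z k i \<asymp> lin_comb b (w k) g i"
    and sp: "span (loc q) b g = span (loc q) c z" and v: "v \<in> coords (loc q) b"
  shows "v \<in> span (loc q) (c' + c) (cat c' y w)"
proof -
  note S = loc_subr[OF q]
  have "lin_comb b v g \<in> span (loc q) b g"
    using v by (intro spanI[of b v]) (auto simp: coords_def)
  then obtain a where a: "\<And>k. k < c \<Longrightarrow> a k \<in> loc q" "\<And>i. lin_comb b v g i \<asymp> lin_comb c a z i"
    unfolding sp by (metis spanE)
  let ?u = "\<lambda>i. v i - lin_comb c a w i"
  have "lin_comb b (lin_comb c a w) g i \<asymp> lin_comb b v g i" for i
  proof -
    have "lin_comb b (lin_comb c a w) g i = lin_comb c a (\<lambda>k. lin_comb b (w k) g) i" by (simp add: lin_comb_transpose)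
    also have "\<dots> \<asymp> lin_comb c a z i" using w(2) by (intro lin_comb_eqv) (auto intro: eqv_sym)
    also have "\<dots> \<asymp> lin_comb b v g i" by (rule eqv_sym[OF a(2)])
    finally show ?thesis .
  qed
  then have "lin_comb b ?u g i \<in> Z" for i
    using eqv_sym unfolding lin_comb_diff eqv_def by blast
  moreover have "lin_comb c a w \<in> coords (loc q) b"
    by (rule submod_lin_comb[OF coords_submod[OF S] a(1) w(1)])
  then have "?u \<in> coords (loc q) b"
    by (rule submod_diff[OF coords_submod[OF S] S v])
  ultimately have "?u \<in> span (loc q) c' y"
    using y locm_relations[OF q] by blast
  then obtain d where d: "\<And>k. k < c' \<Longrightarrow> d k \<in> loc q" "\<And>i. v i - lin_comb c a w i \<asymp> lin_comb c' d y i"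
    by (auto elim!: spanE)
  show ?thesis
  proof (rule spanI[of _ "cat c' d a"])
    show "cat c' d a k \<in> loc q" if "k < c' + c" for k using a d that by (auto simp: cat_def)
    show "v i \<asymp> lin_comb (c' + c) (cat c' d a) (cat c' y w) i" for i
      using eqv_add[OF d(2)[of i] eqv_refl, of "lin_comb c a w i"] by (simp add: lin_comb_cat)
  qed
qed

lemma cat_split: "a = cat m a (\<lambda>k. a (m + k))"
  by (auto simp: cat_def)

lemma complement_indep:
  assumes W: "indep W c' y" "indep W c z"
    and y: "\<And>k i. k < c' \<Longrightarrow> lin_comb b (y k) g i \<in> Z"
    and w: "\<And>k i. k < c \<Longrightarrow> z k i \<asymp> lin_comb b (w k) g i"
  shows "indep W (c' + c) (cat c' y w)"
  unfolding indep_def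
proof (intro allI impI, elim conjE)
  fix a k assume a: "\<forall>k<c' + c. a k \<in> W" and k: "k < c' + c"
    and rel: "\<forall>i. lin_comb (c' + c) a (cat c' y w) i \<in> Z"
  let ?a2 = "\<lambda>k. a (c' + k)"
  have sp: "lin_comb (c' + c) a (cat c' y w) i = lin_comb c' a y i + lin_comb c ?a2 w i" for i
    by (subst cat_split[of a c']) (rule lin_comb_cat)
  have "lin_comb c ?a2 z i \<in> Z" for i
  proof -
    have "lin_comb c ?a2 z i \<asymp> lin_comb c ?a2 (\<lambda>k. lin_comb b (w k) g) i"
      using w by (intro lin_comb_eqv) auto
    also have "\<dots> = lin_comb b (lin_comb c ?a2 w) g i" by (simp add: lin_comb_transpose)
    also have "\<dots> \<asymp> lin_comb b (lin_comb c ?a2 w) g i + lin_comb b (lin_comb c' a y) g i"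
    proof -
      have "lin_comb b (lin_comb c' a y) g i = lin_comb c' a (\<lambda>k. lin_comb b (y k) g) i" by (simp add: lin_comb_transpose)
      also have "\<dots> \<in> Z" unfolding lin_comb_def[of c'] using y by (intro Z_sum Z_mult) auto
      finally show ?thesis by (simp add: eqv_def Z_minus)
    qed
    also have "\<dots> = lin_comb b (lin_comb (c' + c) a (cat c' y w)) g i"
      by (simp add: sp lin_comb_def[of b] distrib_right sum.distrib)
    also have "\<dots> \<asymp> 0"
      unfolding Z_iff[symmetric] lin_comb_def[of b] using rel by (intro Z_sum Z_mult_right) auto
    finally show ?thesis by (simp add: Z_iff)
  qed
  then have a2: "a (c' + k) \<in> Z" if "k < c" for k
    using indepD[OF W(2), of ?a2] a that by simp
  then have "lin_comb c ?a2 w i \<in> Z" for i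
    unfolding lin_comb_def by (intro Z_sum Z_mult_right) auto
  then have "lin_comb c' a y i \<in> Z" for i
    using rel sp Z_diff by (metis add_diff_cancel_right')
  then have "a k \<in> Z" if "k < c'" for k
    using indepD[OF W(1), of a] a that by simp
  then show "a k \<in> Z"
    using a2[of "k - c'"] k by (cases "k < c'") auto
qed

lemma det_of_spanning_rows:
  assumes W: "subr W" and M: "\<And>j. j < b \<Longrightarrow> uvec j \<in> span W b M"
  shows "\<exists>D\<in>W. D * leading_minor b M \<asymp> 1"
proof -
  obtain Q where Q: "\<And>i k. i < b \<Longrightarrow> k < b \<Longrightarrow> Q i k \<in> W" "\<And>i j. i < b \<Longrightarrow> uvec i j \<asymp> lin_comb b (Q i) M j"
    by (rule span_matrix[of b uvec W b M]) (use M in auto)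
  have "leading_minor b Q * leading_minor b M = leading_minor b (\<lambda>i j. \<Sum>k<b. Q i k * M k j)" by (simp add: leading_minor_mult)
  also have "\<dots> \<asymp> leading_minor b (\<lambda>i j. if i = j then 1 else 0)"
    using eqv_sym[OF Q(2)] by (intro leading_minor_eqv) (simp add: lin_comb_def uvec_def eq_commute)
  also have "\<dots> = 1" by (rule leading_minor_one)
  finally have "leading_minor b Q * leading_minor b M \<asymp> 1" .
  moreover have "leading_minor b Q \<in> W" by (rule leading_minor_in[OF W]) (rule Q(1))
  ultimately show ?thesis by blast
qed

text \<open>Fractional ideals without the condition of a common denominator.\<close>

definition ideal_like :: "'a set \<Rightarrow> bool" where
  "ideal_like I \<longleftrightarrow> Z \<subseteq> I \<and> (\<forall>x\<in>I. \<forall>y\<in>I. x + y \<in> I) \<and> (\<forall>a\<in>A. \<forall>x\<in>I. a * x \<in> I)"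

lemma ideal_like_cong: "ideal_like I \<Longrightarrow> x \<in> I \<Longrightarrow> y \<asymp> x \<Longrightarrow> y \<in> I"
  unfolding ideal_like_def eqv_def by (metis add_diff_cancel_left' add_diff_eq subsetD)

end

section \<open>Modules with trivial determinant\<close>

locale normal_subdomain = noetherian_subdomain Z A for Z A :: "'a::comm_ring_1 set" +
  assumes completely_integrally_closed:
    "x \<in> A \<Longrightarrow> x \<notin> Z \<Longrightarrow> t \<in> K \<Longrightarrow> (\<And>k. x * t ^ k \<in> A) \<Longrightarrow> t \<in> A"
begin

lemma loc_valuation:
  assumes "q \<in> essential_primes"
  shows "valuation_ring K (loc q)"
  by (rule essential_loc_valuation[OF _ assms]) (rule completely_integrally_closed)

definition unit_multiple :: "'a set \<Rightarrow> 'a \<Rightarrow> 'a \<Rightarrow> bool" where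
  "unit_multiple W x y \<longleftrightarrow> (\<exists>u\<in>W. \<exists>v\<in>W. u * v \<asymp> 1 \<and> x \<asymp> u * y)"

text \<open>The determinant of \<open>N\<close> is trivial: \<open>e\<close> is a basis of \<open>N\<close> over \<open>K\<close>, and at each essential
  prime there is a basis \<open>y\<close> whose transition matrix \<open>h\<close> to \<open>e\<close> has determinant \<open>\<delta>\<close> up to a
  local unit. The choice of \<open>y\<close> does not affect this, and \<open>\<delta>\<close> times the exterior product of
  the \<open>e k\<close> generates the reflexive hull of the highest exterior power of \<open>N\<close>.\<close>

definition oriented :: "(nat \<Rightarrow> 'a) set \<Rightarrow> bool" where
  "oriented N \<longleftrightarrow> (\<exists>c e \<delta>. indep K c e \<and> (\<forall>k<c. e k \<in> locm Z N) \<and> locm Z N \<subseteq> span K c e \<and>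
     \<delta> \<in> K \<and> \<delta> \<notin> Z \<and>
     (\<forall>q\<in>essential_primes. \<exists>y h. (\<forall>k<c. y k \<in> locm q N) \<and> locm q N \<subseteq> span (loc q) c y \<and>
        (\<forall>k<c. \<forall>l<c. h k l \<in> K) \<and> (\<forall>k<c. \<forall>i. y k i \<asymp> lin_comb c (h k) e i) \<and>
        unit_multiple (loc q) (leading_minor c h) \<delta>))"

lemma oriented_zero:
  assumes "\<And>v. v \<in> N \<longleftrightarrow> (\<forall>i. v i \<in> Z)"
  shows "oriented N"
  unfolding oriented_def
proof (intro exI conjI)
  have sub: "locm q N \<subseteq> span (loc q) 0 (\<lambda>_ _. 0)" if q: "prime_in_A q" for q
  proof
    fix v assume "v \<in> locm q N"
    then obtain s where s: "s \<notin> q" "\<And>i. s * v i \<in> Z" using assms by (auto simp: locm_def)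
    then have "s \<notin> Z" using prime_Z_subset[OF q] by blast
    then have "v i \<in> Z" for i using s(2) Z_prime by blast
    then show "v \<in> span (loc q) 0 (\<lambda>_ _. 0)" by (intro spanI) (auto simp: lin_comb_def Z_iff)
  qed
  show "locm Z N \<subseteq> span K 0 (\<lambda>_ _. 0)" by (rule sub[OF prime_Z])
  show "indep K 0 (\<lambda>_ _. 0)" by (simp add: indep_def)
  show "1 \<in> K" "1 \<notin> Z" using subrD(2)[OF K_subr] Z_proper by auto
  show "\<forall>q\<in>essential_primes. \<exists>y h. (\<forall>k<0. y k \<in> locm q N) \<and> locm q N \<subseteq> span (loc q) 0 y \<and>
        (\<forall>k<0. \<forall>l<0. h k l \<in> K) \<and> (\<forall>k<0. \<forall>i. y k i \<asymp> lin_comb 0 (h k) (\<lambda>_ _. 0) i) \<and>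
        unit_multiple (loc q) (leading_minor 0 h) 1"
  proof
    fix q assume "q \<in> essential_primes"
    then have q: "prime_in_A q" by (rule essential_primeD)
    have "unit_multiple (loc q) (leading_minor 0 h) 1" for h
      using subrD(2)[OF loc_subr[OF q]] unfolding unit_multiple_def
      by (intro bexI[of _ 1]) (auto simp: leading_minor_leibniz)
    then show "\<exists>y h. (\<forall>k<0. y k \<in> locm q N) \<and> locm q N \<subseteq> span (loc q) 0 y \<and>
        (\<forall>k<0. \<forall>l<0. h k l \<in> K) \<and> (\<forall>k<0. \<forall>i. y k i \<asymp> lin_comb 0 (h k) (\<lambda>_ _. 0) i) \<and>
        unit_multiple (loc q) (leading_minor 0 h) 1"
      using sub[OF q] by (intro exI[of _ "\<lambda>_ _. 0"]) auto
  qed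
qed auto

text \<open>Solving an equation of determinants \<open>dM = dh' dh d0\<close> with a unit \<open>dM\<close> for \<open>dh\<close>.\<close>

lemma unit_multiple_cancel:
  assumes D: "D * dM \<asymp> 1" "D \<in> W" "dM \<in> W" and W: "subr W"
    and dM: "dM \<asymp> dh' * dh * d0" and h': "unit_multiple W dh' \<delta>'" and \<delta>: "\<delta> * (\<delta>' * d0) \<asymp> 1"
  shows "unit_multiple W dh \<delta>"
proof -
  obtain u v where uv: "u \<in> W" "v \<in> W" "u * v \<asymp> 1" "dh' \<asymp> u * \<delta>'"
    using h' by (auto simp: unit_multiple_def)
  have "dM * v * \<delta> \<asymp> (dh' * dh * d0) * v * \<delta>"
    by (intro eqv_mult_right dM)
  also have "\<dots> = dh' * (dh * d0 * v * \<delta>)" by (simp add: ac_simps)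
  also have "\<dots> \<asymp> (u * \<delta>') * (dh * d0 * v * \<delta>)" by (intro eqv_mult_right uv(4))
  also have "\<dots> = (u * v) * ((\<delta> * (\<delta>' * d0)) * dh)" by (simp add: ac_simps)
  also have "\<dots> \<asymp> 1 * (1 * dh)" by (intro eqv_mult uv(3) \<delta>) simp
  finally have "dh \<asymp> dM * v * \<delta>" using eqv_sym by simp
  moreover have "(dM * v) * (D * u) \<asymp> 1"
  proof -
    have "(dM * v) * (D * u) = (D * dM) * (u * v)" by (simp add: ac_simps)
    also have "\<dots> \<asymp> 1 * 1" by (rule eqv_mult[OF D(1) uv(3)])
    finally show ?thesis by simp
  qed
  moreover have "dM * v \<in> W" "D * u \<in> W" using D uv subrD(5)[OF W] by auto
  ultimately show ?thesis unfolding unit_multiple_def by blast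
qed

text \<open>The free module on \<open>b\<close> generators has, over \<open>K\<close>, the basis formed by \<open>e'\<close> of the relations
  and preimages \<open>w0\<close> of a basis \<open>z0\<close> of the quotient, and similarly a basis of \<open>y'\<close> and \<open>w\<close>
  at each essential prime. The standard basis shows that the matrix of the latter has an
  invertible determinant over the local ring. On the other hand it is the matrix of the
  former multiplied by a block triangular matrix with diagonal blocks \<open>h'\<close> and \<open>h\<close>, the
  transition matrices for the relations and for the quotient. As the determinant of \<open>h'\<close> is
  \<open>\<delta>'\<close> up to a local unit, that of \<open>h\<close> is likewise \<open>\<delta>\<close>, the inverse of \<open>\<delta>'\<close> times the
  determinant of \<open>e'\<close> and \<open>w0\<close>.\<close>

lemma oriented_quotient:
  assumes "oriented (relations b g)"
  shows "oriented (span A b g)"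
proof -
  let ?Y = "relations b g"
  obtain c' e' \<delta>' where e': "indep K c' e'" "\<And>k. k < c' \<Longrightarrow> e' k \<in> locm Z ?Y" "locm Z ?Y \<subseteq> span K c' e'"
    and \<delta>': "\<delta>' \<in> K" "\<delta>' \<notin> Z"
    and or: "\<forall>q\<in>essential_primes. \<exists>y h. (\<forall>k<c'. y k \<in> locm q ?Y) \<and> locm q ?Y \<subseteq> span (loc q) c' y \<and>
        (\<forall>k<c'. \<forall>l<c'. h k l \<in> K) \<and> (\<forall>k<c'. \<forall>i. y k i \<asymp> lin_comb c' (h k) e' i) \<and>
        unit_multiple (loc q) (leading_minor c' h) \<delta>'"
    using assms unfolding oriented_def by (elim exE conjE) (rule that; blast)
  obtain c z0 w0 where z0: "indep K c z0" and w0: "\<And>k. k < c \<Longrightarrow> w0 k \<in> coords K b"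
    "\<And>k i. k < c \<Longrightarrow> z0 k i \<asymp> lin_comb b (w0 k) g i" and sp0: "span K b g = span K c z0"
    using free_basis[OF subfld_valuation[OF K_subfld], of b g] by metis
  let ?B = "cat c' e' w0"
  have e'Z: "e' k \<in> coords K b" "lin_comb b (e' k) g i \<in> Z" if "k < c'" for k i
    using e'(2)[OF that] by (auto simp: locm_relations[OF prime_Z])
  have M0_coords: "?B k \<in> coords K b" if "k < c' + c" for k
    using that e'Z w0 by (auto simp: cat_def)
  have M0_span: "v \<in> span K (c' + c) ?B" if "v \<in> coords K b" for v
    by (rule complement_spans[OF prime_Z e'(3) w0 sp0 that])
  have M0_indep: "indep K (c' + c) ?B"
    by (rule complement_indep[OF e'(1) z0 e'Z(2) w0(2)])
  \<comment> \<open>Both the standard basis and \<open>?B\<close> are bases over \<open>K\<close>, so their sizes agree.\<close>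
  have b: "b = c' + c"
    using basis_size_eq[OF uvec_indep M0_indep K_subr] M0_span uvec_coords[OF K_subr]
      coords_span[OF M0_coords] by blast
  obtain D0 where D0: "D0 * leading_minor b ?B \<asymp> 1"
    using det_of_spanning_rows[OF K_subr, of b ?B] M0_span uvec_coords[OF K_subr] b by blast
  have d0: "leading_minor b ?B \<in> K"
    using M0_coords by (intro leading_minor_in[OF K_subr]) (auto simp: coords_def b)
  have "\<delta>' * leading_minor b ?B \<notin> Z"
    using Z_prime \<delta>'(2) inverse_notin(2)[OF D0] by blast
  then obtain \<delta> where \<delta>: "\<delta>' * leading_minor b ?B * \<delta> \<asymp> 1" using inverse_exists by blast
  have \<delta>K: "\<delta> \<in> K" by (rule K_inverse[OF subrD(5)[OF K_subr \<delta>'(1) d0] \<delta>])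
  have locZ: "locm Z (span A b g) = span K c z0"
    by (simp add: locm_span[OF prime_Z] sp0)
  show ?thesis
    unfolding oriented_def
  proof (rule exI[of _ c], rule exI[of _ z0], rule exI[of _ \<delta>], intro conjI ballI)
    show "indep K c z0" by fact
    show "\<forall>k<c. z0 k \<in> locm Z (span A b g)"
      unfolding locZ using span_generator[OF K_subr] by blast
    show "locm Z (span A b g) \<subseteq> span K c z0" using locZ by simp
    show "\<delta> \<in> K" "\<delta> \<notin> Z" using \<delta>K inverse_notin(2)[OF \<delta>] by auto
    fix q assume qe: "q \<in> essential_primes"
    then have q: "prime_in_A q" by (rule essential_primeD)
    note V = loc_valuation[OF qe] and S = loc_subr[OF q] and SK = loc_subset_K[OF q]
    obtain y' h' where y': "\<And>k. k < c' \<Longrightarrow> y' k \<in> locm q ?Y" "locm q ?Y \<subseteq> span (loc q) c' y'"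
      and h': "\<And>k l. k < c' \<Longrightarrow> l < c' \<Longrightarrow> h' k l \<in> K" "\<And>k i. k < c' \<Longrightarrow> y' k i \<asymp> lin_comb c' (h' k) e' i"
        "unit_multiple (loc q) (leading_minor c' h') \<delta>'"
      using bspec[OF or qe] by (elim exE conjE) (rule that; blast)
    obtain cq z w where z: "indep K cq z" and w: "\<And>k. k < cq \<Longrightarrow> w k \<in> coords (loc q) b"
      "\<And>k i. k < cq \<Longrightarrow> z k i \<asymp> lin_comb b (w k) g i" and sp: "span (loc q) b g = span (loc q) cq z"
      using free_basis[OF V, of b g] by metis
    have gz0: "g k \<in> span K c z0" "g k \<in> span K cq z" if "k < b" for k
      using span_generator[OF K_subr that, of g] sp0 span_generator[OF S that, of g] sp span_mono[OF SK]
      by auto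
    have zz0: "z k \<in> span K c z0" if "k < cq" for k
    proof -
      have "z k \<in> span (loc q) b g" using span_generator[OF S that, of z] sp by simp
      then show ?thesis using span_mono[OF SK] sp0 by blast
    qed
    have z0z: "z0 k \<in> span K cq z" if "k < c" for k
    proof -
      have "span K b g \<subseteq> span K cq z" by (rule span_least[OF span_submod[OF K_subr] gz0(2)])
      then show ?thesis using span_generator[OF K_subr that, of z0] sp0 by blast
    qed
    have cq: "cq = c"
      using basis_size_eq[OF z z0 K_subr] zz0 z0z by blast
    let ?M = "cat c' y' w"
    have y'S: "y' k \<in> coords (loc q) b" if "k < c'" for k
      using y'(1)[OF that] by (auto simp: locm_relations[OF q])
    have "uvec j \<in> span (loc q) b ?M" if "j < b" for j
      using complement_spans[OF q y'(2) w sp uvec_coords[OF S that]] cq b by simp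
    then obtain D where D: "D \<in> loc q" "D * leading_minor b ?M \<asymp> 1"
      using det_of_spanning_rows[OF S] by blast
    have dM: "leading_minor b ?M \<in> loc q"
      using y'S w(1) cq by (intro leading_minor_in[OF S]) (auto simp: coords_def b cat_def)
    obtain h where h: "\<And>k l. k < c \<Longrightarrow> l < c \<Longrightarrow> h k l \<in> K" "\<And>k i. k < c \<Longrightarrow> z k i \<asymp> lin_comb c (h k) z0 i"
      using span_matrix[of c z K c z0] zz0 cq by metis
    have "(\<lambda>i. w k i - lin_comb c (h k) w0 i) \<in> span K c' e'" if k: "k < c" for k
    proof -
      have "lin_comb c (h k) w0 \<in> coords K b"
        by (rule submod_lin_comb[OF coords_submod[OF K_subr] h(1)[OF k] w0(1)])
      moreover have "w k \<in> coords K b" using w(1)[of k] k cq coords_mono[OF SK] by blast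
      ultimately have "(\<lambda>i. w k i - lin_comb c (h k) w0 i) \<in> coords K b"
        by (intro submod_diff[OF coords_submod[OF K_subr] K_subr])
      moreover have "lin_comb b (\<lambda>i. w k i - lin_comb c (h k) w0 i) g i \<in> Z" for i
      proof -
        have "lin_comb b (lin_comb c (h k) w0) g i = lin_comb c (h k) (\<lambda>l. lin_comb b (w0 l) g) i" by (simp add: lin_comb_transpose)
        also have "\<dots> \<asymp> lin_comb c (h k) z0 i" using w0(2) by (intro lin_comb_eqv) (auto intro: eqv_sym)
        also have "\<dots> \<asymp> z k i" by (rule eqv_sym[OF h(2)[OF k]])
        also have "\<dots> \<asymp> lin_comb b (w k) g i" using w(2) k cq by simp
        finally show ?thesis unfolding lin_comb_diff using eqv_sym eqv_def by blast
      qed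
      ultimately show ?thesis using e'(3) by (auto simp: locm_relations[OF prime_Z])
    qed
    then obtain x where x: "\<And>k i. k < c \<Longrightarrow> w k i - lin_comb c (h k) w0 i \<asymp> lin_comb c' (x k) e' i"
      using span_matrix[of c "\<lambda>k i. w k i - lin_comb c (h k) w0 i" K c' e'] by metis
    \<comment> \<open>The block triangular transition matrix; \<open>x\<close> measures how far the local preimages
      \<open>w\<close> differ from combinations of \<open>w0\<close>.\<close>
    define H where "H = (\<lambda>i. if i < c' then cat c' (h' i) (\<lambda>_. 0) else cat c' (x (i - c')) (h (i - c')))"
    have "?M i j \<asymp> (\<Sum>k<b. H i k * ?B k j)" if "i < b" "j < b" for i j
    proof (cases "i < c'")
      case True
      have "(\<Sum>k<b. H i k * ?B k j) = lin_comb (c' + c) (H i) ?B j" by (simp add: lin_comb_def b)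
      also have "\<dots> = lin_comb c' (h' i) e' j + lin_comb c (\<lambda>_. 0) w0 j" using True by (simp add: H_def lin_comb_cat)
      also have "\<dots> = lin_comb c' (h' i) e' j" by (simp add: lin_comb_def)
      finally show ?thesis using h'(2)[OF True, of j] True by (simp add: cat_def)
    next
      case False
      then have ic: "i - c' < c" using that b by simp
      have "(\<Sum>k<b. H i k * ?B k j) = lin_comb (c' + c) (H i) ?B j" by (simp add: lin_comb_def b)
      also have "\<dots> = lin_comb c' (x (i - c')) e' j + lin_comb c (h (i - c')) w0 j" using False by (simp add: H_def lin_comb_cat)
      finally show ?thesis
        using eqv_add[OF x[OF ic, of j] eqv_refl, of "lin_comb c (h (i - c')) w0 j"] False by (simp add: cat_def)
    qed
    then have "leading_minor b ?M \<asymp> leading_minor b (\<lambda>i j. \<Sum>k<b. H i k * ?B k j)" by (intro leading_minor_eqv) auto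
    also have "\<dots> = leading_minor b H * leading_minor b ?B" by (rule leading_minor_mult)
    also have "leading_minor b H = leading_minor c' h' * leading_minor c h"
      unfolding b by (rule leading_minor_block_triangular[of _ _ _ _ "\<lambda>i. x (i - c')"]) (auto simp: H_def cat_def)
    finally have "leading_minor b ?M \<asymp> leading_minor c' h' * leading_minor c h * leading_minor b ?B" .
    then have "unit_multiple (loc q) (leading_minor c h) \<delta>"
      using unit_multiple_cancel[OF D(2,1) dM S _ h'(3)] \<delta> by (simp add: mult.commute)
    moreover have "locm q (span A b g) = span (loc q) c z"
      by (simp add: locm_span[OF q] sp cq)
    ultimately show "\<exists>y h. (\<forall>k<c. y k \<in> locm q (span A b g)) \<and> locm q (span A b g) \<subseteq> span (loc q) c y \<and>
        (\<forall>k<c. \<forall>l<c. h k l \<in> K) \<and> (\<forall>k<c. \<forall>i. y k i \<asymp> lin_comb c (h k) z0 i) \<and>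
        unit_multiple (loc q) (leading_minor c h) \<delta>"
      using h span_generator[OF S] by (intro exI[of _ z] exI[of _ h]) auto
  qed
qed

text \<open>A fractional ideal as a module of families, at index 0.\<close>

definition rank_one :: "'a set \<Rightarrow> (nat \<Rightarrow> 'a) set" where
  "rank_one I = {v. v 0 \<in> I \<and> (\<forall>k>0. v k \<in> Z)}"

text \<open>In rank one the determinant \<open>h\<close> is a factor that takes the basis \<open>e\<close> to a local generator.
  Hence \<open>f = \<delta> e\<close> generates \<open>I\<close> at every essential prime, and \<open>x / f\<close> lies in all the
  localizations, that is, in \<open>A\<close>.\<close>

lemma oriented_rank_one:
  assumes or: "oriented (rank_one I)" and IK: "I \<subseteq> K" and I: "ideal_like I" and x0: "x0 \<in> I" "x0 \<notin> Z"
  shows "\<exists>f\<in>K. f \<notin> Z \<and> (\<forall>q\<in>essential_primes. \<exists>s\<in>A. s \<notin> q \<and> s * f \<in> I) \<and> (\<forall>x\<in>I. \<exists>a\<in>A. x \<asymp> a * f)"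
proof -
  let ?N = "rank_one I"
  obtain c e \<delta> where e: "indep K c e" "\<And>k. k < c \<Longrightarrow> e k \<in> locm Z ?N" "locm Z ?N \<subseteq> span K c e"
    and \<delta>: "\<delta> \<in> K" "\<delta> \<notin> Z"
    and orq: "\<forall>q\<in>essential_primes. \<exists>y h. (\<forall>k<c. y k \<in> locm q ?N) \<and> locm q ?N \<subseteq> span (loc q) c y \<and>
        (\<forall>k<c. \<forall>l<c. h k l \<in> K) \<and> (\<forall>k<c. \<forall>i. y k i \<asymp> lin_comb c (h k) e i) \<and>
        unit_multiple (loc q) (leading_minor c h) \<delta>"
    using or unfolding oriented_def by (elim exE conjE) (rule that; blast)
  have emb: "(\<lambda>i. if i = 0 then x else 0) \<in> locm q ?N" if "x \<in> I" "prime_in_A q" for x q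
    using that subrD(2)[OF A_subr] Z_zero
    by (auto simp: locm_def rank_one_def prime_in_A_def intro!: bexI[of _ 1])
  have eK: "e k 0 \<in> K" "\<And>i. i > 0 \<Longrightarrow> e k i \<in> Z" if k: "k < c" for k
  proof -
    obtain s where s: "s \<in> A" "s \<notin> Z" "s * e k 0 \<in> I" "\<And>i. i > 0 \<Longrightarrow> s * e k i \<in> Z"
      using e(2)[OF k] by (auto simp: locm_def rank_one_def)
    then show "\<And>i. i > 0 \<Longrightarrow> e k i \<in> Z" using Z_prime by blast
    obtain u where u: "u \<in> K" "s * u \<asymp> 1" using loc_inverse[OF prime_Z s(1,2)] by blast
    have "u * (s * e k 0) = s * u * e k 0" by (simp add: ac_simps)
    also have "\<dots> \<asymp> 1 * e k 0" by (rule eqv_mult_right[OF u(2)])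
    finally show "e k 0 \<in> K"
      using subr_cong[OF K_subr subrD(5)[OF K_subr u(1)], of "s * e k 0"] s(3) IK eqv_sym by auto
  qed
  have "c \<noteq> 0"
  proof
    assume "c = 0"
    then have "(\<lambda>i::nat. if i = 0 then x0 else 0) \<in> span K 0 e" using e(3) emb[OF x0(1) prime_Z] by blast
    then obtain a where "\<And>i. (\<lambda>i::nat. if i = 0 then x0 else 0) i \<asymp> lin_comb 0 a e i"
      by (metis spanE)
    from this[of 0] show False using x0(2) by (simp add: Z_iff lin_comb_def)
  qed
  have e0: "e 0 0 \<notin> Z"
  proof
    assume z: "e 0 0 \<in> Z"
    have "lin_comb c (\<lambda>k. if k = 0 then 1 else 0) e i \<in> Z" for i
      using \<open>c \<noteq> 0\<close> z eK(2)[of 0 i] by (cases "i = 0") (auto simp: lin_comb_unit)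
    then have "(if (0::nat) = 0 then 1 else 0) \<in> Z"
      using subrD(1,2)[OF K_subr] \<open>c \<noteq> 0\<close> by (intro indepD[OF e(1), of "\<lambda>k. if k = 0 then 1 else 0"]) auto
    then show False using Z_proper by simp
  qed
  have c: "c = 1"
  proof (rule ccontr)
    assume "c \<noteq> 1"
    then have c2: "1 < c" using \<open>c \<noteq> 0\<close> by simp
    \<comment> \<open>Two vectors concentrated at index 0 satisfy this linear relation.\<close>
    let ?a = "\<lambda>k::nat. if k = 0 then e 1 0 else if k = 1 then - e 0 0 else 0"
    have "lin_comb c ?a e i = e 1 0 * e 0 i - e 0 0 * e 1 i" for i
    proof -
      have "lin_comb c ?a e i = (\<Sum>k\<in>{0, 1}. ?a k * e k i)"
        unfolding lin_comb_def using c2 by (intro sum.mono_neutral_right) auto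
      then show ?thesis by simp
    qed
    moreover have "e 1 0 * e 0 i - e 0 0 * e 1 i \<in> Z" for i
    proof (cases "i = 0")
      case True
      then show ?thesis by (simp add: mult.commute Z_zero)
    next
      case False
      then show ?thesis using eK(2)[of 0 i] eK(2)[of 1 i] c2 Z_diff[OF Z_mult Z_mult] by simp
    qed
    ultimately have "lin_comb c ?a e i \<in> Z" for i by simp
    moreover have "?a k \<in> K" for k
      using eK(1)[of 0] eK(1)[of 1] c2 subrD(1,6)[OF K_subr] by auto
    ultimately have "?a 1 \<in> Z"
      using indepD[OF e(1), of ?a 1] c2 by blast
    then have "- (- e 0 0) \<in> Z" using Z_minus[of "- e 0 0"] by simp
    then show False using e0 by simp
  qed
  define f where "f = \<delta> * e 0 0"
  have fK: "f \<in> K" unfolding f_def using \<delta>(1) eK(1)[of 0] c subrD(5)[OF K_subr] by simp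
  have fZ: "f \<notin> Z" unfolding f_def using Z_prime \<delta>(2) e0 by blast
  obtain f' where f': "f * f' \<asymp> 1" using inverse_exists[OF fZ] by blast
  have f'K: "f' \<in> K" by (rule K_inverse[OF fK f'])
  have local: "\<exists>y\<in>loc q. \<exists>y'\<in>loc q. \<exists>v \<in> locm q ?N. y * y' \<asymp> 1 \<and> v 0 \<asymp> y * f \<and> locm q ?N \<subseteq> span (loc q) 1 (\<lambda>_. v)"
    if qe: "q \<in> essential_primes" for q
  proof -
    obtain y h where y: "y 0 \<in> locm q ?N" "locm q ?N \<subseteq> span (loc q) c y" "\<And>i. y 0 i \<asymp> lin_comb c (h 0) e i"
      "unit_multiple (loc q) (leading_minor c h) \<delta>"
      using bspec[OF orq qe] c by auto
    have "leading_minor (Suc 0) h = h 0 0"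
      using leading_minor_first_row[of 0 h] by (simp add: leading_minor_leibniz[of 0])
    then obtain u v where uv: "u \<in> loc q" "v \<in> loc q" "u * v \<asymp> 1" "h 0 0 \<asymp> u * \<delta>"
      using y(4) c by (auto simp: unit_multiple_def)
    have "y 0 0 \<asymp> h 0 0 * e 0 0" using y(3)[of 0] c by (simp add: lin_comb_def)
    also have "\<dots> \<asymp> u * \<delta> * e 0 0" by (rule eqv_mult_right[OF uv(4)])
    finally have "y 0 0 \<asymp> u * f" by (simp add: f_def mult.assoc)
    moreover have "span (loc q) c y = span (loc q) 1 (\<lambda>_. y 0)" using c by (simp add: span_def lin_comb_def)
    ultimately show ?thesis using uv y(1,2) by auto
  qed
  show ?thesis
  proof (rule bexI[of _ f], intro conjI ballI)
    fix q assume qe: "q \<in> essential_primes"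
    then have q: "prime_in_A q" by (rule essential_primeD)
    obtain u u' v where u: "u \<in> loc q" "u' \<in> loc q" "v \<in> locm q ?N" "u * u' \<asymp> 1" "v 0 \<asymp> u * f"
      using local[OF qe] by blast
    obtain s where s: "s \<in> A" "s \<notin> q" "s * v 0 \<in> I" using u(3) by (auto simp: locm_def rank_one_def)
    obtain t where t: "t \<in> A" "t \<notin> q" "t * u' \<in> A" using u(2) by (auto simp: loc_def)
    have "s * t * f \<asymp> (t * u') * (s * v 0)"
    proof -
      have "(t * u') * (s * v 0) \<asymp> (t * u') * (s * (u * f))" by (intro eqv_mult_left u(5))
      also have "\<dots> = (u * u') * (s * t * f)" by (simp add: ac_simps)
      also have "\<dots> \<asymp> 1 * (s * t * f)" by (rule eqv_mult_right[OF u(4)])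
      finally show ?thesis using eqv_sym by simp
    qed
    moreover have "(t * u') * (s * v 0) \<in> I" using I t(3) s(3) unfolding ideal_like_def by blast
    ultimately have "s * t * f \<in> I" using ideal_like_cong[OF I] by blast
    then show "\<exists>s\<in>A. s \<notin> q \<and> s * f \<in> I"
      using s t prime_mult_notin[OF q] subrD(5)[OF A_subr] by (intro bexI[of _ "s * t"]) auto
  next
    fix x assume x: "x \<in> I"
    have "x * f' \<in> A"
    proof (rule A_eq_Inter_loc)
      show "x * f' \<in> K" using subrD(5)[OF K_subr] x IK f'K by blast
      fix q assume qe: "q \<in> essential_primes"
      then have q: "prime_in_A q" by (rule essential_primeD)
      obtain u v where u: "u \<in> loc q" "v 0 \<asymp> u * f" and sp: "locm q ?N \<subseteq> span (loc q) 1 (\<lambda>_. v)"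
        using local[OF qe] by blast
      obtain a where "\<And>k. k < 1 \<Longrightarrow> a k \<in> loc q"
        "\<And>i. (\<lambda>i::nat. if i = 0 then x else 0) i \<asymp> lin_comb 1 a (\<lambda>_. v) i"
        using subsetD[OF sp emb[OF x q]] by (metis spanE)
      from this(1)[of 0] this(2)[of 0]
      have a: "a 0 \<in> loc q" "x \<asymp> lin_comb 1 a (\<lambda>_. v) 0" by auto
      have "x * f' \<asymp> a 0 * v 0 * f'" using a(2) by (intro eqv_mult_right) (simp add: lin_comb_def)
      also have "\<dots> \<asymp> a 0 * (u * f) * f'" by (intro eqv_mult_right eqv_mult_left u(2))
      also have "\<dots> = (a 0 * u) * (f * f')" by (simp add: ac_simps)
      also have "\<dots> \<asymp> (a 0 * u) * 1" by (rule eqv_mult_left[OF f'])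
      finally show "x * f' \<in> loc q"
        using subr_cong[OF loc_subr[OF q]] subrD(5)[OF loc_subr[OF q] a(1) u(1)] by simp
    qed
    moreover have "x \<asymp> x * f' * f"
      using eqv_sym[OF eqv_mult_left[OF f', of x]] by (simp add: ac_simps)
    ultimately show "\<exists>a\<in>A. x \<asymp> a * f" by blast
  qed (use fK fZ in auto)
qed

end

section \<open>Complexes of matrices\<close>

text \<open>The differential of a complex of free modules is given by a matrix \<open>M\<close>, where \<open>M b c\<close> is the
  coefficient of the basis element \<open>c\<close> in the image of \<open>b\<close>. Chains are families on the basis
  with finite support; outside the support they are equal to 0, not just congruent to it, so
  that the sums are finite. The coefficients of a chain may be ring elements (for
  \<open>scalar_boundary\<close>) or vectors (for \<open>boundary\<close>).\<close>

definition scalar_boundary :: "('p \<Rightarrow> 'p \<Rightarrow> 'u::comm_ring_1) \<Rightarrow> ('p \<Rightarrow> 'u) \<Rightarrow> 'p \<Rightarrow> 'u" where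
  "scalar_boundary M n c = (\<Sum>b | n b \<noteq> 0. M b c * n b)"

definition boundary :: "('p \<Rightarrow> 'p \<Rightarrow> 'u::comm_ring_1) \<Rightarrow> ('p \<Rightarrow> 'i \<Rightarrow> 'u) \<Rightarrow> 'p \<Rightarrow> 'i \<Rightarrow> 'u" where
  "boundary M n c i = scalar_boundary M (\<lambda>b. n b i) c"

definition supp :: "('p \<Rightarrow> 'i \<Rightarrow> 'u::zero) \<Rightarrow> 'p set" where
  "supp n = {b. n b \<noteq> (\<lambda>_. 0)}"

definition fchains :: "'p set \<Rightarrow> ('i \<Rightarrow> 'u::zero) set \<Rightarrow> ('p \<Rightarrow> 'i \<Rightarrow> 'u) set" where
  "fchains S N = {n. finite (supp n) \<and> supp n \<subseteq> S \<and> (\<forall>b. n b \<in> N)}"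

lemma scalar_boundary_superset: "finite T \<Longrightarrow> (\<And>b. b \<notin> T \<Longrightarrow> n b = 0) \<Longrightarrow> scalar_boundary M n c = (\<Sum>b\<in>T. M b c * n b)"
  unfolding scalar_boundary_def by (intro sum.mono_neutral_left) auto

lemma boundary_superset: "finite T \<Longrightarrow> supp n \<subseteq> T \<Longrightarrow> boundary M n c i = (\<Sum>b\<in>T. M b c * n b i)"
  unfolding boundary_def supp_def by (intro scalar_boundary_superset) (auto simp: subset_iff, metis)

lemma chainsD:
  assumes "n \<in> fchains S N"
  shows "finite (supp n)" "supp n \<subseteq> S" "n b \<in> N"
  using assms by (auto simp: fchains_def)

lemma chains_mono: "N \<subseteq> N' \<Longrightarrow> fchains S N \<subseteq> fchains S N'"
  by (auto simp: fchains_def)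

lemma supp_outside: "b \<notin> supp n \<Longrightarrow> n b i = 0"
  by (simp add: supp_def)

lemma boundary_diff:
  assumes "finite (supp n)" "finite (supp n')"
  shows "boundary M (\<lambda>b i. n b i - n' b i) c i = boundary M n c i - boundary M n' c i"
proof -
  let ?T = "supp n \<union> supp n'"
  have "boundary M (\<lambda>b i. n b i - n' b i) c i = (\<Sum>b\<in>?T. M b c * (n b i - n' b i))"
    using assms by (intro boundary_superset) (auto simp: supp_def)
  then show ?thesis
    using assms by (simp add: boundary_superset[of ?T] right_diff_distrib sum_subtractf)
qed

section \<open>Free resolutions of the residue field\<close>

text \<open>A free resolution of the residue field \<open>A / m\<close> in terms of bases \<open>B j\<close>: the matrix \<open>D j\<close> is
  the differential from degree \<open>j + 1\<close> to degree \<open>j\<close>. Representatives in \<open>A\<close> of the values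
  of the augmentation on the basis \<open>B 0\<close> are given by \<open>e0\<close>, and \<open>c0\<close> is a chain of
  augmentation 1; exactness in degree 0 enters as the fact that \<open>m\<close> times \<open>c0\<close> consists of
  boundaries.\<close>

locale residue_field_resolution = normal_subdomain Z A for Z A :: "'a::comm_ring_1 set" +
  fixes m :: "'a set" and B :: "nat \<Rightarrow> 'p set" and D :: "nat \<Rightarrow> 'p \<Rightarrow> 'p \<Rightarrow> 'a"
    and e0 c0 :: "'p \<Rightarrow> 'a"
  assumes m_ideal: "ideal_in_A m" and m_proper: "1 \<notin> m"
    and m_local: "x \<in> A \<Longrightarrow> x \<notin> m \<Longrightarrow> \<exists>y\<in>A. x * y \<asymp> 1"
    and D_in: "D j b c \<in> A"
    and D_finite: "finite {c. D j b c \<noteq> 0}"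
    and D_supp: "b \<in> B (Suc j) \<Longrightarrow> D j b c \<noteq> 0 \<Longrightarrow> c \<in> B j"
    and D_D: "b \<in> B (Suc (Suc j)) \<Longrightarrow> (\<Sum>c' | D (Suc j) b c' \<noteq> 0. D (Suc j) b c' * D j c' c) \<in> Z"
    and D_exact: "finite {b. n b \<noteq> 0} \<Longrightarrow> {b. n b \<noteq> 0} \<subseteq> B (Suc j) \<Longrightarrow> (\<And>b. n b \<in> A) \<Longrightarrow>
      (\<And>c. scalar_boundary (D j) n c \<in> Z) \<Longrightarrow>
      \<exists>n'. finite {b. n' b \<noteq> 0} \<and> {b. n' b \<noteq> 0} \<subseteq> B (Suc (Suc j)) \<and> (\<forall>b. n' b \<in> A) \<and>
        (\<forall>c. n c \<asymp> scalar_boundary (D (Suc j)) n' c)"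
    and c0: "finite {b. c0 b \<noteq> 0}" "{b. c0 b \<noteq> 0} \<subseteq> B 0" "c0 b \<in> A" and e0: "e0 b \<in> A"
    and c0_e0: "(\<Sum>b | c0 b \<noteq> 0. e0 b * c0 b) - 1 \<in> m"
    and D_e0: "b \<in> B (Suc 0) \<Longrightarrow> (\<Sum>c | D 0 b c \<noteq> 0. D 0 b c * e0 c) \<in> m"
    and m_c0: "\<mu> \<in> m \<Longrightarrow> \<exists>n'. finite {b. n' b \<noteq> 0} \<and> {b. n' b \<noteq> 0} \<subseteq> B (Suc 0) \<and> (\<forall>b. n' b \<in> A) \<and>
        (\<forall>c. \<mu> * c0 c \<asymp> scalar_boundary (D 0) n' c)"
begin

text \<open>The chains with coefficients in \<open>N\<close> are the tensor product of the resolution with \<open>N\<close>. As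
  the resolution starts in degree 0, exactness in degree \<open>j + 1\<close> is the vanishing of Tor of
  index \<open>j + 1\<close> of the residue field and \<open>N\<close>.\<close>

definition exact_at :: "nat \<Rightarrow> ('i \<Rightarrow> 'a) set \<Rightarrow> bool" where
  "exact_at j N \<longleftrightarrow> (\<forall>n\<in>fchains (B (Suc j)) N. (\<forall>c i. boundary (D j) n c i \<in> Z) \<longrightarrow>
     (\<exists>n'\<in>fchains (B (Suc (Suc j))) N. \<forall>c i. n c i \<asymp> boundary (D (Suc j)) n' c i))"

lemma exact_atD:
  assumes "exact_at j N" "n \<in> fchains (B (Suc j)) N" "\<And>c i. boundary (D j) n c i \<in> Z"
  obtains n' where "n' \<in> fchains (B (Suc (Suc j))) N" "\<And>c i. n c i \<asymp> boundary (D (Suc j)) n' c i"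
  using assms unfolding exact_at_def by blast

lemma boundary_chains:
  assumes n: "n \<in> fchains (B (Suc j)) N" and N: "submod A N"
  shows "boundary (D j) n \<in> fchains (B j) N"
proof -
  have sub: "supp (boundary (D j) n) \<subseteq> (\<Union>b\<in>supp n. {c. D j b c \<noteq> 0})"
  proof (rule subsetI, rule ccontr)
    fix c assume c: "c \<in> supp (boundary (D j) n)" and nc: "c \<notin> (\<Union>b\<in>supp n. {c. D j b c \<noteq> 0})"
    have "boundary (D j) n c i = 0" for i
      using boundary_superset[OF chainsD(1)[OF n] order_refl, of "D j" c i] nc by simp
    then show False using c by (auto simp: supp_def fun_eq_iff)
  qed
  have "boundary (D j) n c \<in> N" for c
  proof -
    have "boundary (D j) n c = (\<lambda>i. \<Sum>b\<in>supp n. D j b c * n b i)"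
      by (rule ext) (rule boundary_superset[OF chainsD(1)[OF n] order_refl])
    also have "\<dots> \<in> N"
      by (rule submod_sum[OF N]) (rule submodD(3)[OF N D_in chainsD(3)[OF n]])
    finally show ?thesis .
  qed
  moreover have "finite (\<Union>b\<in>supp n. {c. D j b c \<noteq> 0})"
    using chainsD(1)[OF n] D_finite by blast
  moreover have "(\<Union>b\<in>supp n. {c. D j b c \<noteq> 0}) \<subseteq> B j"
    using subsetD[OF chainsD(2)[OF n]] by (auto intro: D_supp)
  ultimately show ?thesis
    using finite_subset[OF sub] subset_trans[OF sub] by (simp add: fchains_def)
qed

lemma boundary_boundary:
  assumes n: "n \<in> fchains (B (Suc (Suc j))) N"
  shows "boundary (D j) (boundary (D (Suc j)) n) c i \<in> Z"
proof -
  let ?T = "\<Union>b\<in>supp n. {c'. D (Suc j) b c' \<noteq> 0}"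
  have fT: "finite ?T" using chainsD(1)[OF n] D_finite by blast
  have bdn: "boundary (D (Suc j)) n c' i = (\<Sum>b\<in>supp n. D (Suc j) b c' * n b i)" for c'
    by (rule boundary_superset[OF chainsD(1)[OF n] order_refl])
  have "boundary (D j) (boundary (D (Suc j)) n) c i = (\<Sum>c'\<in>?T. D j c' c * boundary (D (Suc j)) n c' i)"
    unfolding boundary_def[of "D j"] by (rule scalar_boundary_superset[OF fT]) (simp add: bdn)
  also have "\<dots> = (\<Sum>c'\<in>?T. \<Sum>b\<in>supp n. D (Suc j) b c' * D j c' c * n b i)"
    by (simp add: bdn sum_distrib_left ac_simps)
  also have "\<dots> = (\<Sum>b\<in>supp n. (\<Sum>c'\<in>?T. D (Suc j) b c' * D j c' c) * n b i)"
    by (subst sum.swap) (simp add: sum_distrib_right)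
  also have "\<dots> \<in> Z"
  proof (rule Z_sum, rule Z_mult_right)
    fix b assume b: "b \<in> supp n"
    have "(\<Sum>c'\<in>?T. D (Suc j) b c' * D j c' c) = (\<Sum>c' | D (Suc j) b c' \<noteq> 0. D (Suc j) b c' * D j c' c)"
      using fT b by (intro sum.mono_neutral_right) auto
    then show "(\<Sum>c'\<in>?T. D (Suc j) b c' * D j c' c) \<in> Z"
      using D_D chainsD(2)[OF n] b by auto
  qed
  finally show ?thesis .
qed

lemma boundary_eqv:
  assumes "finite (supp n)" "finite (supp n')" "\<And>b i. n b i \<asymp> n' b i"
  shows "boundary M n c i \<asymp> boundary M n' c i"
proof -
  let ?T = "supp n \<union> supp n'"
  show ?thesis
    using assms by (simp add: boundary_superset[of ?T] eqv_sum eqv_mult_left)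
qed

lemma boundary_lin_comb:
  assumes "finite (supp w)"
  shows "boundary M (\<lambda>b'. lin_comb b (w b') g) c i = lin_comb b (boundary M w c) g i"
proof -
  have "boundary M (\<lambda>b'. lin_comb b (w b') g) c i = (\<Sum>b'\<in>supp w. M b' c * lin_comb b (w b') g i)"
    using assms by (intro boundary_superset) (auto simp: supp_def lin_comb_def)
  also have "\<dots> = (\<Sum>b'\<in>supp w. \<Sum>k<b. M b' c * w b' k * g k i)"
    by (simp add: lin_comb_def sum_distrib_left mult.assoc)
  also have "\<dots> = (\<Sum>k<b. (\<Sum>b'\<in>supp w. M b' c * w b' k) * g k i)"
    by (subst sum.swap) (simp add: sum_distrib_right)
  also have "\<dots> = lin_comb b (boundary M w c) g i"
    using assms by (simp add: lin_comb_def boundary_superset[OF _ order_refl])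
  finally show ?thesis .
qed

lemma supp_lin_comb: "supp (\<lambda>b'. lin_comb b (w b') g) \<subseteq> supp w"
  by (auto simp: supp_def lin_comb_def)

lemma coords_chain:
  assumes "\<And>k. k < b \<Longrightarrow> finite {x. n k x \<noteq> 0} \<and> {x. n k x \<noteq> 0} \<subseteq> S \<and> (\<forall>x. n k x \<in> A)"
  shows "(\<lambda>x k. if k < b then n k x else 0) \<in> fchains S (coords A b)"
proof -
  have "supp (\<lambda>x k. if k < b then n k x else 0) \<subseteq> (\<Union>k<b. {x. n k x \<noteq> 0})"
    by (auto simp: supp_def fun_eq_iff split: if_splits)
  moreover have "finite (\<Union>k<b. {x. n k x \<noteq> 0})" using assms by auto
  ultimately show ?thesis
    using assms Z_zero unfolding fchains_def coords_def by (auto intro: finite_subset)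
qed

lemma exact_coords: "exact_at j (coords A b)"
  unfolding exact_at_def
proof (intro ballI impI)
  fix n assume n: "n \<in> fchains (B (Suc j)) (coords A b)" and cyc: "\<forall>c i. boundary (D j) n c i \<in> Z"
  have "\<exists>n'. finite {x. n' x \<noteq> 0} \<and> {x. n' x \<noteq> 0} \<subseteq> B (Suc (Suc j)) \<and> (\<forall>x. n' x \<in> A) \<and>
        (\<forall>c. n c k \<asymp> scalar_boundary (D (Suc j)) n' c)" if "k < b" for k
  proof (rule D_exact)
    have "{x. n x k \<noteq> 0} \<subseteq> supp n" by (auto simp: supp_def)
    then show "finite {x. n x k \<noteq> 0}" "{x. n x k \<noteq> 0} \<subseteq> B (Suc j)"
      using chainsD(1,2)[OF n] finite_subset by auto
    show "n x k \<in> A" for x using chainsD(3)[OF n, of x] that by (simp add: coords_def)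
    show "scalar_boundary (D j) (\<lambda>x. n x k) c \<in> Z" for c using cyc by (simp add: boundary_def)
  qed
  then obtain n' where n': "\<And>k. k < b \<Longrightarrow> finite {x. n' k x \<noteq> 0} \<and> {x. n' k x \<noteq> 0} \<subseteq> B (Suc (Suc j)) \<and>
     (\<forall>x. n' k x \<in> A) \<and> (\<forall>c. n c k \<asymp> scalar_boundary (D (Suc j)) (n' k) c)"
    by metis
  let ?n = "\<lambda>x k. if k < b then n' k x else 0"
  have "?n \<in> fchains (B (Suc (Suc j))) (coords A b)"
    by (rule coords_chain) (use n' in blast)
  moreover have "n c k \<asymp> boundary (D (Suc j)) ?n c k" for c k
  proof (cases "k < b")
    case True
    then show ?thesis using n' by (simp add: boundary_def)
  next
    case False
    then show ?thesis using chainsD(3)[OF n, of c] by (simp add: boundary_def scalar_boundary_def coords_def Z_iff)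
  qed
  ultimately show "\<exists>n'\<in>fchains (B (Suc (Suc j))) (coords A b). \<forall>c i. n c i \<asymp> boundary (D (Suc j)) n' c i"
    by blast
qed

text \<open>The chase through the short exact sequence of relations, free module and quotient. A chain
  \<open>w\<close> in the free module with boundary \<open>z\<close> in the relations is a cycle in the quotient,
  where it bounds by assumption; lifting the bounding chain to \<open>V\<close>, the difference of \<open>w\<close>
  and the boundary of \<open>V\<close> has coefficients in the relations and the same boundary as \<open>w\<close>.\<close>

lemma boundary_in_relations:
  assumes ex: "exact_at j (span A b g)" and z: "z \<in> fchains (B j) (relations b g)"
    and w: "w \<in> fchains (B (Suc j)) (coords A b)" and zw: "\<And>c i. z c i \<asymp> boundary (D j) w c i"
  obtains w' where "w' \<in> fchains (B (Suc j)) (relations b g)" "\<And>c i. z c i \<asymp> boundary (D j) w' c i"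
proof -
  let ?n = "\<lambda>x. lin_comb b (w x) g"
  have fw: "finite (supp w)" by (rule chainsD(1)[OF w])
  have fn: "finite (supp ?n)" by (rule finite_subset[OF supp_lin_comb fw])
  have "?n \<in> fchains (B (Suc j)) (span A b g)"
  proof -
    have "?n x \<in> span A b g" for x
      using chainsD(3)[OF w, of x] by (intro spanI[of b "w x"]) (auto simp: coords_def)
    moreover have "supp ?n \<subseteq> B (Suc j)" by (rule subset_trans[OF supp_lin_comb chainsD(2)[OF w]])
    ultimately show ?thesis using fn by (simp add: fchains_def)
  qed
  moreover have "boundary (D j) ?n c i \<in> Z" for c i
  proof -
    have "boundary (D j) ?n c i = lin_comb b (boundary (D j) w c) g i" by (rule boundary_lin_comb[OF fw])
    also have "\<dots> \<asymp> lin_comb b (z c) g i" using zw by (intro lin_comb_eqv) (auto intro: eqv_sym)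
    finally have "boundary (D j) ?n c i \<asymp> lin_comb b (z c) g i" .
    moreover have "lin_comb b (z c) g i \<in> Z" using chainsD(3)[OF z, of c] by (simp add: relations_def)
    ultimately show ?thesis using Z_cong by blast
  qed
  ultimately obtain v where v: "v \<in> fchains (B (Suc (Suc j))) (span A b g)"
    "\<And>c i. lin_comb b (w c) g i \<asymp> boundary (D (Suc j)) v c i"
    using exact_atD[OF ex, of ?n] by metis
  have "\<exists>u. u \<in> coords A b \<and> (\<forall>i. v x i \<asymp> lin_comb b u g i) \<and> (x \<notin> supp v \<longrightarrow> u = (\<lambda>_. 0))" for x
  proof (cases "x \<in> supp v")
    case True
    then show ?thesis using span_lift[OF chainsD(3)[OF v(1), of x] A_subr] by metis
  next
    case False
    then show ?thesis
      using subrD(1)[OF A_subr] Z_zero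
      by (intro exI[of _ "\<lambda>_. 0"]) (auto simp: coords_def lin_comb_def supp_outside)
  qed
  then obtain V where V: "\<And>x. V x \<in> coords A b" "\<And>x i. v x i \<asymp> lin_comb b (V x) g i" "\<And>x. x \<notin> supp v \<Longrightarrow> V x = (\<lambda>_. 0)"
    by metis
  have sV: "supp V \<subseteq> supp v" using V(3) by (auto simp: supp_def)
  then have fV: "finite (supp V)" using chainsD(1)[OF v(1)] finite_subset by blast
  have Vc: "V \<in> fchains (B (Suc (Suc j))) (coords A b)"
    using sV fV V(1) chainsD(2)[OF v(1)] by (auto simp: fchains_def)
  let ?bV = "boundary (D (Suc j)) V"
  have bVc: "?bV \<in> fchains (B (Suc j)) (coords A b)"
    by (rule boundary_chains[OF Vc coords_submod[OF A_subr]])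
  define w' where "w' = (\<lambda>x i. w x i - ?bV x i)"
  have sw': "supp w' \<subseteq> supp w \<union> supp ?bV" by (auto simp: w'_def supp_def)
  have "w' x \<in> relations b g" for x
  proof -
    have "w' x \<in> coords A b"
      unfolding w'_def
      by (rule submod_diff[OF coords_submod[OF A_subr] A_subr chainsD(3)[OF w] chainsD(3)[OF bVc]])
    moreover have "lin_comb b (w' x) g i \<in> Z" for i
    proof -
      have "lin_comb b (?bV x) g i = boundary (D (Suc j)) (\<lambda>x. lin_comb b (V x) g) x i" by (rule boundary_lin_comb[OF fV, symmetric])
      also have "\<dots> \<asymp> boundary (D (Suc j)) v x i"
        using V(2) eqv_sym chainsD(1)[OF v(1)] finite_subset[OF supp_lin_comb fV] by (intro boundary_eqv) auto
      also have "\<dots> \<asymp> lin_comb b (w x) g i" by (rule eqv_sym[OF v(2)])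
      finally show ?thesis unfolding w'_def lin_comb_diff using eqv_sym eqv_def by blast
    qed
    ultimately show ?thesis by (simp add: relations_def)
  qed
  then have "w' \<in> fchains (B (Suc j)) (relations b g)"
    using sw' chainsD(1,2)[OF w] chainsD(1,2)[OF bVc] finite_subset[OF sw']
    by (auto simp: fchains_def)
  moreover have "z c i \<asymp> boundary (D j) w' c i" for c i
  proof -
    have "boundary (D j) w' c i = boundary (D j) w c i - boundary (D j) ?bV c i"
      unfolding w'_def by (rule boundary_diff[OF fw chainsD(1)[OF bVc]])
    moreover have "boundary (D j) w c i - boundary (D j) ?bV c i \<asymp> boundary (D j) w c i"
      using boundary_boundary[OF Vc, of c i] Z_minus by (simp add: eqv_def)
    ultimately show ?thesis using zw[of c i] eqv_trans eqv_sym by metis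
  qed
  ultimately show thesis by (rule that)
qed

text \<open>Nakayama's lemma in the disguise of Tor. If there were relations, let \<open>y\<close> be a minimal
  system of generators for them. The coordinates of \<open>y 0\<close> lie in \<open>m\<close>, as \<open>g\<close> is minimal, so
  \<open>c0\<close> with the coefficient \<open>y 0\<close> is a boundary in the free module, and by the preceding
  lemma a boundary of a chain \<open>w'\<close> of relations. The augmentation maps boundaries into
  multiples by \<open>m\<close>; therefore \<open>y 0\<close> is a combination of \<open>y\<close> with coefficients in \<open>m\<close>, and
  one of the generators can be dropped.\<close>

lemma relations_trivial:
  fixes g :: "nat \<Rightarrow> nat \<Rightarrow> 'a"
  assumes ex: "exact_at 0 (span A b g)" and g: "minimal_generators A (span A b g) b g"
    and v: "v \<in> relations b g"
  shows "v i \<in> Z"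
proof -
  let ?Y = "relations b g"
  have Ym: "w k \<in> m" if wY: "w \<in> ?Y" and kb: "k < b" for w k
  proof (rule ccontr)
    assume wm: "w k \<notin> m"
    have wA: "\<And>k. k < b \<Longrightarrow> w k \<in> A" using wY by (auto simp: relations_def coords_def)
    have rel: "lin_comb b w g i \<in> Z" for i using wY by (auto simp: relations_def)
    obtain u where "u \<in> A" "w k * u \<asymp> 1" using m_local[OF wA[OF kb] wm] by blast
    then show False
      using minimal_generators_nonunit[where a = w, OF A_subr g wA rel kb] by blast
  qed
  obtain n0 y0 where "?Y = span A n0 y0"
    using submodule_fg[OF relations_submod, of b g b] by (auto simp: relations_def)
  then obtain n y where y: "minimal_generators A ?Y n y" using minimal_generators_exist by blast
  then have Yspan: "?Y = span A n y" by (simp add: minimal_generators_def)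
  have "n = 0"
  proof (rule ccontr)
    assume "n \<noteq> 0"
    then have n: "0 < n" by simp
    have y0: "y 0 \<in> ?Y" unfolding Yspan by (rule span_generator[OF A_subr n])
    define z where "z = (\<lambda>x i. c0 x * y 0 i)"
    have sz: "supp z \<subseteq> {x. c0 x \<noteq> 0}" by (auto simp: z_def supp_def)
    have "z x \<in> ?Y" for x unfolding z_def by (rule submodD(3)[OF relations_submod c0(3) y0])
    then have z: "z \<in> fchains (B 0) ?Y"
      using finite_subset[OF sz c0(1)] subset_trans[OF sz c0(2)] by (simp add: fchains_def)
    have "\<exists>n'. finite {x. n' x \<noteq> 0} \<and> {x. n' x \<noteq> 0} \<subseteq> B (Suc 0) \<and> (\<forall>x. n' x \<in> A) \<and>
        (\<forall>c. y 0 k * c0 c \<asymp> scalar_boundary (D 0) n' c)" if "k < b" for k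
      by (rule m_c0[OF Ym[OF y0 that]])
    then obtain n' where n': "\<And>k. k < b \<Longrightarrow> finite {x. n' k x \<noteq> 0} \<and> {x. n' k x \<noteq> 0} \<subseteq> B (Suc 0) \<and>
       (\<forall>x. n' k x \<in> A) \<and> (\<forall>c. y 0 k * c0 c \<asymp> scalar_boundary (D 0) (n' k) c)"
      by metis
    let ?w = "\<lambda>x k. if k < b then n' k x else 0"
    have w: "?w \<in> fchains (B (Suc 0)) (coords A b)"
      by (rule coords_chain) (use n' in blast)
    have zw: "z c k \<asymp> boundary (D 0) ?w c k" for c k
    proof (cases "k < b")
      case True
      then show ?thesis using n' by (simp add: boundary_def z_def mult.commute)
    next
      case False
      then have "z c k \<in> Z" using y0 Z_mult by (simp add: z_def relations_def coords_def)
      then show ?thesis using False by (simp add: boundary_def scalar_boundary_def Z_iff)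
    qed
    obtain w' where w': "w' \<in> fchains (B (Suc 0)) ?Y" "\<And>c i. z c i \<asymp> boundary (D 0) w' c i"
      using boundary_in_relations[OF ex z w zw] by metis
    note fw = chainsD(1)[OF w'(1)]
    \<comment> \<open>The augmentations \<open>\<mu>\<close> of the boundaries of basis elements, and the augmentation
      \<open>\<nu>\<close> of \<open>c0\<close>, which is 1 modulo \<open>m\<close>.\<close>
    define \<mu> where "\<mu> = (\<lambda>x. \<Sum>c | D 0 x c \<noteq> 0. D 0 x c * e0 c)"
    have \<mu>: "\<mu> x \<in> m" if "x \<in> supp w'" for x
      unfolding \<mu>_def using D_e0 chainsD(2)[OF w'(1)] that by blast
    define \<nu> where "\<nu> = (\<Sum>x | c0 x \<noteq> 0. e0 x * c0 x)"
    have lift: "\<nu> * y 0 i \<asymp> (\<Sum>x\<in>supp w'. \<mu> x * w' x i)" for i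
    proof -
      let ?T = "{x. c0 x \<noteq> 0} \<union> (\<Union>x\<in>supp w'. {c. D 0 x c \<noteq> 0})"
      have fT: "finite ?T" using c0(1) fw D_finite by blast
      have "\<nu> = (\<Sum>x\<in>?T. e0 x * c0 x)"
        unfolding \<nu>_def using fT by (intro sum.mono_neutral_left) auto
      then have "\<nu> * y 0 i = (\<Sum>x\<in>?T. e0 x * z x i)"
        by (simp add: z_def sum_distrib_right mult.assoc)
      also have "\<dots> \<asymp> (\<Sum>x\<in>?T. e0 x * boundary (D 0) w' x i)"
        by (intro eqv_sum eqv_mult_left w'(2))
      also have "\<dots> = (\<Sum>x\<in>?T. \<Sum>c\<in>supp w'. D 0 c x * e0 x * w' c i)"
        by (simp add: boundary_superset[OF fw order_refl] sum_distrib_left ac_simps)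
      also have "\<dots> = (\<Sum>c\<in>supp w'. (\<Sum>x\<in>?T. D 0 c x * e0 x) * w' c i)"
        by (subst sum.swap) (simp add: sum_distrib_right)
      also have "\<dots> = (\<Sum>c\<in>supp w'. \<mu> c * w' c i)"
      proof (rule sum.cong[OF refl])
        fix c assume "c \<in> supp w'"
        then have "(\<Sum>x\<in>?T. D 0 c x * e0 x) = \<mu> c"
          unfolding \<mu>_def using fT by (intro sum.mono_neutral_right) auto
        then show "(\<Sum>x\<in>?T. D 0 c x * e0 x) * w' c i = \<mu> c * w' c i" by simp
      qed
      finally show ?thesis .
    qed
    have "w' x \<in> span A n y" for x using chainsD(3)[OF w'(1)] Yspan by blast
    then have "\<exists>a. (\<forall>l<n. a l \<in> A) \<and> (\<forall>i. w' x i \<asymp> lin_comb n a y i)" for x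
      unfolding span_def by blast
    then obtain \<beta> where \<beta>: "\<And>x l. l < n \<Longrightarrow> \<beta> x l \<in> A" "\<And>x i. w' x i \<asymp> lin_comb n (\<beta> x) y i" by metis
    define \<gamma> where "\<gamma> = (\<lambda>l. \<Sum>x\<in>supp w'. \<mu> x * \<beta> x l)"
    have \<gamma>m: "\<gamma> l \<in> m" if "l < n" for l
    proof -
      have "\<beta> x l * \<mu> x \<in> m" if "x \<in> supp w'" for x
        using m_ideal \<mu>[OF that] \<beta>(1)[OF \<open>l < n\<close>, of x] unfolding ideal_in_A_def by blast
      then show ?thesis
        unfolding \<gamma>_def by (intro ideal_sum[OF m_ideal]) (simp add: mult.commute)
    qed
    have mA: "m \<subseteq> A" using m_ideal by (simp add: ideal_in_A_def)
    have \<nu>1: "\<nu> - 1 \<in> m" unfolding \<nu>_def by (rule c0_e0)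
    then have \<nu>A: "\<nu> \<in> A" using mA subrD(4)[OF A_subr _ subrD(2)[OF A_subr], of "\<nu> - 1"] by auto
    \<comment> \<open>Applying the augmentation to the equation between \<open>z\<close> and the boundary of \<open>w'\<close>
      yields \<open>\<nu> y 0 = \<Sum> \<gamma> l y l\<close> with all \<open>\<gamma> l\<close> in \<open>m\<close>.\<close>
    define a where "a = (\<lambda>l. (if l = 0 then \<nu> else 0) - \<gamma> l)"
    have aA: "a l \<in> A" if "l < n" for l
      unfolding a_def using \<nu>A subrD(1)[OF A_subr] \<gamma>m[OF that] mA by (intro subrD(7)[OF A_subr]) auto
    have rel: "lin_comb n a y i \<in> Z" for i
    proof -
      have "lin_comb n (\<lambda>l. if l = 0 then \<nu> else 0) y i = \<nu> * y 0 i"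
        using n lin_comb_smult[of n \<nu> "\<lambda>l. if l = 0 then 1 else 0" y i] lin_comb_unit[OF n, of y]
        by (simp add: if_distrib[of "(*) \<nu>"] cong: if_cong)
      then have "lin_comb n a y i = \<nu> * y 0 i - lin_comb n \<gamma> y i"
        unfolding a_def lin_comb_diff by simp
      moreover have "lin_comb n \<gamma> y i = (\<Sum>x\<in>supp w'. \<mu> x * lin_comb n (\<beta> x) y i)"
        unfolding lin_comb_def \<gamma>_def sum_distrib_left sum_distrib_right
        by (subst sum.swap) (simp add: mult.assoc)
      moreover have "(\<Sum>x\<in>supp w'. \<mu> x * lin_comb n (\<beta> x) y i) \<asymp> (\<Sum>x\<in>supp w'. \<mu> x * w' x i)"
        by (intro eqv_sum eqv_mult_left eqv_sym[OF \<beta>(2)])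
      ultimately show ?thesis using lift[of i] eqv_trans eqv_sym unfolding eqv_def by metis
    qed
    have "a 0 \<notin> m"
    proof
      assume "a 0 \<in> m"
      then have "a 0 + \<gamma> 0 \<in> m" using m_ideal \<gamma>m[OF n] by (auto simp: ideal_in_A_def)
      then have "\<nu> \<in> m" by (simp add: a_def)
      moreover have "(-1) * (\<nu> - 1) \<in> m"
        using m_ideal \<nu>1 subrD(6)[OF A_subr subrD(2)[OF A_subr]] unfolding ideal_in_A_def by blast
      ultimately have "\<nu> + (-1) * (\<nu> - 1) \<in> m" using m_ideal unfolding ideal_in_A_def by blast
      then show False using m_proper by simp
    qed
    then obtain u where "u \<in> A" "a 0 * u \<asymp> 1" using m_local aA[OF n] by blast
    then show False using minimal_generators_nonunit[OF A_subr y aA rel n] by blast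
  qed
  then show "v i \<in> Z"
    using v Yspan by (auto simp: span_def lin_comb_def Z_iff)
qed

text \<open>Dimension shifting: Tor with the free module vanishes, so Tor of the relations is Tor of the
  quotient with the index raised by one.\<close>

lemma exact_at_relations:
  assumes "exact_at (Suc j) (span A b g)"
  shows "exact_at j (relations b g)"
  unfolding exact_at_def
proof (intro ballI impI)
  fix z assume z: "z \<in> fchains (B (Suc j)) (relations b g)" and cyc: "\<forall>c i. boundary (D j) z c i \<in> Z"
  have "z \<in> fchains (B (Suc j)) (coords A b)"
    using z chains_mono[of "relations b g" "coords A b"] by (auto simp: relations_def)
  then obtain w where w: "w \<in> fchains (B (Suc (Suc j))) (coords A b)" "\<And>c i. z c i \<asymp> boundary (D (Suc j)) w c i"
    using exact_atD[OF exact_coords] cyc by metis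
  show "\<exists>n'\<in>fchains (B (Suc (Suc j))) (relations b g). \<forall>c i. z c i \<asymp> boundary (D (Suc j)) n' c i"
    by (rule boundary_in_relations[OF assms z w]) blast
qed

text \<open>Shifting \<open>j\<close> times leads to a free module, whose module of relations is zero and hence
  oriented; the property returns along the relations.\<close>

lemma exact_at_oriented:
  fixes g :: "nat \<Rightarrow> nat \<Rightarrow> 'a"
  assumes "exact_at j (span A b g)"
  shows "oriented (span A b g)"
  using assms
proof (induction j arbitrary: b g)
  case 0
  obtain n y where y: "minimal_generators A (span A b g) n y"
    using minimal_generators_exist[OF refl] by blast
  then have eq: "span A b g = span A n y" by (simp add: minimal_generators_def)
  have "v \<in> relations n y \<longleftrightarrow> (\<forall>i. v i \<in> Z)" for v
    using relations_trivial[of n y v] 0 y submodD(1)[OF relations_submod, of v n y] unfolding eq by blast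
  then have "oriented (relations n y)" by (rule oriented_zero)
  then show ?case unfolding eq by (rule oriented_quotient)
next
  case (Suc j)
  obtain n y where y: "relations b g = span A n y"
    using submodule_fg[OF relations_submod, of b g b] by (auto simp: relations_def)
  have "oriented (relations b g)"
    unfolding y by (rule Suc.IH) (use exact_at_relations[OF Suc.prems] y in simp)
  then show ?case by (rule oriented_quotient)
qed

end

section \<open>Divisorial ideals with torsion classes\<close>

context noetherian_subdomain
begin

definition dual :: "'a set \<Rightarrow> 'a set" where
  "dual S = {x \<in> K. \<forall>y\<in>S. x * y \<in> A}"

text \<open>The inverse of the \<open>n\<close>-th power of \<open>I\<close>, obtained by dividing \<open>n\<close> times by \<open>I\<close>; the dual of
  it is the divisorial hull of the power.\<close>

primrec dual_power :: "'a set \<Rightarrow> nat \<Rightarrow> 'a set" where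
  "dual_power I 0 = A"
| "dual_power I (Suc n) = {g \<in> K. \<forall>y\<in>I. g * y \<in> dual_power I n}"

definition divisorial :: "'a set \<Rightarrow> bool" where
  "divisorial I \<longleftrightarrow> I \<subseteq> K \<and> ideal_like I \<and> (\<exists>x\<in>I. x \<notin> Z) \<and>
     (\<exists>d\<in>A. d \<notin> Z \<and> (\<forall>x\<in>I. d * x \<in> A)) \<and> dual (dual I) = I"

definition torsion_classes :: bool where
  "torsion_classes \<longleftrightarrow> (\<forall>I. divisorial I \<longrightarrow>
     (\<exists>n\<ge>1. \<exists>f\<in>K. f \<notin> Z \<and> dual (dual_power I n) = {x. \<exists>a\<in>A. x \<asymp> a * f}))"

lemma dual_dual_superset: "I \<subseteq> K \<Longrightarrow> I \<subseteq> dual (dual I)"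
  unfolding dual_def by (auto simp: mult.commute)

lemma dual_dual_dual:
  assumes "S \<subseteq> K"
  shows "dual (dual (dual S)) = dual S"
proof
  have "dual S \<subseteq> K" by (auto simp: dual_def)
  then show "dual S \<subseteq> dual (dual (dual S))" by (rule dual_dual_superset)
  show "dual (dual (dual S)) \<subseteq> dual S"
  proof
    fix x assume "x \<in> dual (dual (dual S))"
    then have x: "x \<in> K" "\<forall>y\<in>dual (dual S). x * y \<in> A"
      by (simp_all add: dual_def[of "dual (dual S)"])
    then have "\<forall>y\<in>S. x * y \<in> A" using dual_dual_superset[OF assms] by blast
    then show "x \<in> dual S" using x(1) by (simp add: dual_def)
  qed
qed

lemma dual_ideal_like: "S \<subseteq> K \<Longrightarrow> ideal_like (dual S)"
  using subrD(3)[OF K_subr] subrD(3)[OF A_subr Z_mult_right] subrD(4,5)[OF K_subr] subrD(4,5)[OF A_subr] A_subset_K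
  by (auto simp: ideal_like_def dual_def distrib_right mult.assoc subset_iff)

lemma divisorial_dual:
  assumes "S \<subseteq> K" "x \<in> dual S" "x \<notin> Z" "d \<in> A" "d \<in> S" "d \<notin> Z"
  shows "divisorial (dual S)"
  unfolding divisorial_def
proof (intro conjI)
  show "dual S \<subseteq> K" by (auto simp: dual_def)
  show "ideal_like (dual S)" by (rule dual_ideal_like[OF assms(1)])
  show "\<exists>x\<in>dual S. x \<notin> Z" using assms by blast
  show "\<exists>d\<in>A. d \<notin> Z \<and> (\<forall>x\<in>dual S. d * x \<in> A)"
    using assms by (intro bexI[of _ d]) (auto simp: dual_def mult.commute)
  show "dual (dual (dual S)) = dual S" by (rule dual_dual_dual[OF assms(1)])
qed

text \<open>The divisorial ideal \<open>J\<close> of all \<open>y\<close> with \<open>y t\<^sup>k \<in> A\<close> for every \<open>k\<close> is nonzero, as it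
  contains \<open>x\<close>, and stable under \<open>t\<close>. So are the powers of \<open>J\<close>, their inverses and their
  divisorial hulls. When the hull is generated by \<open>f\<close>, the element \<open>t f\<close> is a multiple \<open>a f\<close>
  with \<open>a \<in> A\<close>.\<close>

lemma torsion_imp_completely_integrally_closed:
  assumes tors: "torsion_classes"
    and x: "x \<in> A" "x \<notin> Z" and t: "t \<in> K" and xt: "\<And>k. x * t ^ k \<in> A"
  shows "t \<in> A"
proof -
  define S where "S = range (\<lambda>k. t ^ k)"
  let ?J = "dual S"
  have SK: "S \<subseteq> K" using subr_power[OF K_subr t] by (auto simp: S_def)
  have "divisorial ?J"
  proof (rule divisorial_dual[OF SK _ x(2) subrD(2)[OF A_subr] _ Z_proper])
    show "x \<in> ?J" using x(1) xt A_subset_K by (auto simp: dual_def S_def)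
    show "1 \<in> S" unfolding S_def by (rule range_eqI[of _ _ 0]) simp
  qed
  then obtain n f where n: "n \<ge> 1" and f: "f \<in> K" "f \<notin> Z" "dual (dual_power ?J n) = {x. \<exists>a\<in>A. x \<asymp> a * f}"
    using tors unfolding torsion_classes_def by blast
  have tJ: "t * y \<in> ?J" if "y \<in> ?J" for y
  proof -
    have "t * y * t ^ k \<in> A" for k
    proof -
      have "t * y * t ^ k = y * t ^ Suc k" by (simp add: ac_simps)
      moreover have "t ^ Suc k \<in> S" unfolding S_def by (rule rangeI)
      moreover have "y * t ^ Suc k \<in> A"
        using that \<open>t ^ Suc k \<in> S\<close> unfolding dual_def by blast
      ultimately show ?thesis by metis
    qed
    then show ?thesis using that subrD(5)[OF K_subr t] by (auto simp: dual_def S_def)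
  qed
  have tI: "t * g \<in> dual_power ?J n" if "g \<in> dual_power ?J n" for g
  proof -
    obtain k where k: "n = Suc k" using n by (cases n) auto
    have "t * g * y \<in> dual_power ?J k" if "y \<in> ?J" for y
      using tJ[OF that] \<open>g \<in> dual_power ?J n\<close> by (simp add: k) (metis mult.assoc mult.commute)
    then show ?thesis using that subrD(5)[OF K_subr t] by (simp add: k)
  qed
  have "f \<in> dual (dual_power ?J n)"
    unfolding f(3) using subrD(2)[OF A_subr] by (auto intro!: bexI[of _ 1])
  then have "t * f \<in> dual (dual_power ?J n)"
  proof -
    assume "f \<in> dual (dual_power ?J n)"
    then have ftg: "f * (t * g) \<in> A" if "g \<in> dual_power ?J n" for g
      using tI[OF that] unfolding dual_def by blast
    have "t * f * g = f * (t * g)" for g by (simp add: ac_simps)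
    then have "t * f * g \<in> A" if "g \<in> dual_power ?J n" for g
      using ftg[OF that] by metis
    then show ?thesis
      using subrD(5)[OF K_subr t f(1)] by (simp add: dual_def[of "dual_power ?J n"])
  qed
  then obtain a where a: "a \<in> A" "t * f \<asymp> a * f" unfolding f(3) by blast
  have "t \<asymp> a" using eqv_cancel'[OF f(2), of t a] a(2) by (simp add: mult.commute)
  then show ?thesis using subr_cong[OF A_subr a(1)] by blast
qed

section \<open>Integral elements and traces\<close>

text \<open>The degree \<open>n\<close> is automatically positive, since 1 is not in \<open>Z\<close>.\<close>

definition integral :: "'a set \<Rightarrow> 'a \<Rightarrow> bool" where
  "integral W x \<longleftrightarrow> (\<exists>n c. (\<forall>k<n. c k \<in> W) \<and> x ^ n \<asymp> (\<Sum>k<n. c k * x ^ k))"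

lemma integral_mono: "W \<subseteq> W' \<Longrightarrow> integral W x \<Longrightarrow> integral W' x"
  unfolding integral_def by blast

lemma integral_root:
  assumes "subr W" "n \<ge> 1" "a \<in> W" "x ^ n \<asymp> a"
  shows "integral W x"
  unfolding integral_def
proof (intro exI conjI allI impI)
  show "(if k = 0 then a else 0) \<in> W" for k :: nat using assms(3) subrD(1)[OF assms(1)] by simp
  have "(\<Sum>k<n. (if k = 0 then a else 0) * x ^ k) = (\<Sum>k<n. if k = 0 then a else 0)"
    by (intro sum.cong) auto
  also have "\<dots> = a" using assms(2) by simp
  finally show "x ^ n \<asymp> (\<Sum>k<n. (if k = 0 then a else 0) * x ^ k)" using assms(4) by simp
qed

definition stable :: "'a \<Rightarrow> ('i \<Rightarrow> 'a) set \<Rightarrow> bool" where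
  "stable x N \<longleftrightarrow> (\<forall>v\<in>N. (\<lambda>i. x * v i) \<in> N)"

lemma stable_span:
  assumes W: "subr W" and "\<And>k. k < n \<Longrightarrow> (\<lambda>i. x * u k i) \<in> span W n u"
  shows "stable x (span W n u)"
proof -
  have "submod W {v. (\<lambda>i. x * v i) \<in> span W n u}"
    using submodD[OF span_submod[OF W, of n u]] Z_mult
    unfolding submod_def by (auto simp: distrib_left mult.left_commute)
  then have "span W n u \<subseteq> {v. (\<lambda>i. x * v i) \<in> span W n u}"
    by (rule span_least) (use assms(2) in simp)
  then show ?thesis by (auto simp: stable_def)
qed

text \<open>The products of the generators \<open>u\<close> with the powers of \<open>x\<close> below the degree of an integral
  equation generate the smallest module that contains \<open>u\<close> and is stable under \<open>x\<close>. Stability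
  under other elements is inherited because multiplication is commutative.\<close>

lemma stable_lattice_step:
  assumes W: "subr W" and x: "integral W x"
  shows "\<exists>n' u'. span W n u \<subseteq> span W n' u' \<and> stable x (span W n' u') \<and>
    (\<forall>y. stable y (span W n u) \<longrightarrow> stable y (span W n' u')) \<and>
    (\<forall>M. submod W M \<and> span W n u \<subseteq> M \<and> stable x M \<longrightarrow> span W n' u' \<subseteq> M)"
proof -
  obtain d c where c: "\<And>k. k < d \<Longrightarrow> c k \<in> W" "x ^ d \<asymp> (\<Sum>k<d. c k * x ^ k)"
    using x unfolding integral_def by blast
  have "d \<noteq> 0"
  proof
    assume "d = 0"
    then have "1 \<asymp> 0" using c(2) by simp
    then show False using Z_proper by (simp add: Z_iff)
  qed
  \<comment> \<open>The index \<open>k * n + l\<close> stands for the product of \<open>x\<^sup>k\<close> and \<open>u l\<close>.\<close>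
  define u' where "u' = (\<lambda>j i. x ^ (j div n) * u (j mod n) i)"
  let ?N = "span W (d * n) u'"
  note sub = span_submod[OF W, of "d * n" u']
  have gen: "(\<lambda>i. x ^ k * u l i) \<in> ?N" if "k < d" "l < n" for k l
  proof -
    have "k * n + l < d * n"
    proof -
      have "k * n + l < k * n + n" using that(2) by simp
      also have "\<dots> = Suc k * n" by simp
      also have "\<dots> \<le> d * n" using that(1) by (intro mult_right_mono) auto
      finally show ?thesis .
    qed
    moreover have "u' (k * n + l) = (\<lambda>i. x ^ k * u l i)" using that by (simp add: u'_def)
    ultimately show ?thesis using span_generator[OF W, of "k * n + l" "d * n" u'] by simp
  qed
  have dec: "\<exists>k l. k < d \<and> l < n \<and> u' j = (\<lambda>i. x ^ k * u l i)" if "j < d * n" for j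
  proof -
    have "0 < n" using that by (cases n) auto
    then have "j div n < d" "j mod n < n" using that by (simp_all add: less_mult_imp_div_less)
    then show ?thesis unfolding u'_def by blast
  qed
  have sub1: "span W n u \<subseteq> ?N"
  proof (rule span_least[OF sub])
    fix l assume "l < n"
    then show "u l \<in> ?N" using gen[of 0 l] \<open>d \<noteq> 0\<close> by simp
  qed
  have top: "(\<lambda>i. x ^ d * u l i) \<in> ?N" if l: "l < n" for l
  proof -
    have "(\<lambda>i. \<Sum>k<d. c k * (x ^ k * u l i)) \<in> ?N"
      by (rule submod_sum[OF sub], rule submodD(3)[OF sub]) (use c(1) gen l in auto)
    moreover have "x ^ d * u l i \<asymp> (\<Sum>k<d. c k * (x ^ k * u l i))" for i
      using eqv_mult_right[OF c(2), of "u l i"] by (simp add: sum_distrib_right mult.assoc)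
    ultimately show ?thesis by (rule submod_cong[OF sub])
  qed
  have "stable x ?N"
  proof (rule stable_span[OF W])
    fix j assume "j < d * n"
    then obtain k l where kl: "k < d" "l < n" "u' j = (\<lambda>i. x ^ k * u l i)" using dec by blast
    have "(\<lambda>i. x ^ Suc k * u l i) \<in> ?N"
      using gen[of "Suc k" l] top[of l] kl by (cases "Suc k = d") auto
    then show "(\<lambda>i. x * u' j i) \<in> ?N" by (simp add: kl mult.assoc)
  qed
  moreover have "stable y ?N" if y: "stable y (span W n u)" for y
  proof (rule stable_span[OF W])
    fix j assume "j < d * n"
    then obtain k l where kl: "k < d" "l < n" "u' j = (\<lambda>i. x ^ k * u l i)" using dec by blast
    have "(\<lambda>i. y * u l i) \<in> span W n u"
      using y span_generator[OF W kl(2), of u] by (simp add: stable_def)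
    then obtain a where a: "\<And>r. r < n \<Longrightarrow> a r \<in> W" "\<And>i. y * u l i \<asymp> lin_comb n a u i" by (metis spanE)
    have "(\<lambda>i. \<Sum>r<n. a r * (x ^ k * u r i)) \<in> ?N"
      by (rule submod_sum[OF sub], rule submodD(3)[OF sub]) (use a(1) gen kl in auto)
    moreover have "y * u' j i \<asymp> (\<Sum>r<n. a r * (x ^ k * u r i))" for i
    proof -
      have "y * u' j i = x ^ k * (y * u l i)" by (simp add: kl ac_simps)
      also have "\<dots> \<asymp> x ^ k * lin_comb n a u i" by (rule eqv_mult_left[OF a(2)])
      also have "\<dots> = (\<Sum>r<n. a r * (x ^ k * u r i))" by (simp add: lin_comb_def sum_distrib_left ac_simps)
      finally show ?thesis .
    qed
    ultimately show "(\<lambda>i. y * u' j i) \<in> ?N" by (rule submod_cong[OF sub])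
  qed
  moreover have "?N \<subseteq> M" if M: "submod W M" "span W n u \<subseteq> M" "stable x M" for M
  proof (rule span_least[OF M(1)])
    fix j assume "j < d * n"
    then obtain k l where kl: "k < d" "l < n" "u' j = (\<lambda>i. x ^ k * u l i)" using dec by blast
    have "(\<lambda>i. x ^ k * u l i) \<in> M"
    proof (induction k)
      case 0
      then show ?case using M(2) span_generator[OF W kl(2), of u] by auto
    next
      case (Suc k)
      then have "(\<lambda>i. x * (x ^ k * u l i)) \<in> M" using M(3) by (simp add: stable_def)
      then show ?case by (simp add: mult.assoc)
    qed
    then show "u' j \<in> M" by (simp add: kl)
  qed
  ultimately show ?thesis using sub1 by blast
qed

text \<open>The elements of the list are adjoined one after another, each step preserving the stability
  under the previous ones.\<close>

lemma stable_lattice: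
  assumes W: "subr W" and "\<forall>x\<in>set xs. integral W x"
  shows "\<exists>n' u'. span W n u \<subseteq> span W n' u' \<and> (\<forall>x\<in>set xs. stable x (span W n' u')) \<and>
    (\<forall>y. stable y (span W n u) \<longrightarrow> stable y (span W n' u')) \<and>
    (\<forall>M. submod W M \<and> span W n u \<subseteq> M \<and> (\<forall>x\<in>set xs. stable x M) \<longrightarrow> span W n' u' \<subseteq> M)"
  using assms(2)
proof (induction xs)
  case Nil
  then show ?case by auto
next
  case (Cons x xs)
  then obtain n1 u1 where 1: "span W n u \<subseteq> span W n1 u1" "\<forall>x\<in>set xs. stable x (span W n1 u1)"
    "\<forall>y. stable y (span W n u) \<longrightarrow> stable y (span W n1 u1)"
    "\<forall>M. submod W M \<and> span W n u \<subseteq> M \<and> (\<forall>x\<in>set xs. stable x M) \<longrightarrow> span W n1 u1 \<subseteq> M"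
    by auto
  have "integral W x" using Cons.prems by simp
  from stable_lattice_step[OF W this, of n1 u1] obtain n2 u2 where 2: "span W n1 u1 \<subseteq> span W n2 u2"
    "stable x (span W n2 u2)" "\<forall>y. stable y (span W n1 u1) \<longrightarrow> stable y (span W n2 u2)"
    "\<forall>M. submod W M \<and> span W n1 u1 \<subseteq> M \<and> stable x M \<longrightarrow> span W n2 u2 \<subseteq> M"
    by auto
  show ?case
    using 1 2 by (intro exI[of _ n2] exI[of _ u2]) auto
qed

text \<open>The submodules \<open>S k\<close> generated by the powers of \<open>w\<close> below \<open>k\<close> form an ascending chain in a
  finitely generated module. Their preimages under the map from the free module have a
  finitely generated union \<open>Y\<close>, so some \<open>S k\<close> contains all powers of \<open>w\<close>, in particular
  \<open>w\<^sup>k\<close>.\<close>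

lemma stable_imp_integral:
  fixes u :: "nat \<Rightarrow> unit \<Rightarrow> 'a"
  assumes w: "stable w (span A n u)" and one: "(\<lambda>_. 1) \<in> span A n u"
  shows "integral A w"
proof -
  define S where "S = (\<lambda>k. span A k (\<lambda>k (_::unit). w ^ k))"
  have S_sub: "submod A (S k)" for k unfolding S_def by (rule span_submod[OF A_subr])
  have S_mono: "S k \<subseteq> S l" if "k \<le> l" for k l
    unfolding S_def by (rule span_least[OF span_submod[OF A_subr]]) (rule span_generator[OF A_subr], use that in simp)
  have pow: "(\<lambda>_. w ^ k) \<in> span A n u" for k
  proof (induction k)
    case 0
    then show ?case using one by simp
  next
    case (Suc k)
    then show ?case using w by (auto simp: stable_def)
  qed
  define Y where "Y = {a \<in> coords A n. \<exists>k. lin_comb n a u \<in> S k}"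
  have "submod A Y"
    unfolding submod_def
  proof (intro conjI allI impI ballI)
    fix v :: "nat \<Rightarrow> 'a" assume v: "\<forall>i. v i \<in> Z"
    then have "lin_comb n v u i \<in> Z" for i unfolding lin_comb_def by (intro Z_sum Z_mult_right) auto
    then have "lin_comb n v u \<in> S 0" by (rule submodD(1)[OF S_sub])
    then show "v \<in> Y" using v submodD(1)[OF coords_submod[OF A_subr]] by (auto simp: Y_def)
  next
    fix v v' assume "v \<in> Y" "v' \<in> Y"
    then obtain k k' where k: "v \<in> coords A n" "v' \<in> coords A n" "lin_comb n v u \<in> S k" "lin_comb n v' u \<in> S k'"
      by (auto simp: Y_def)
    have "lin_comb n v u \<in> S (max k k')" "lin_comb n v' u \<in> S (max k k')"
      using k S_mono[of k "max k k'"] S_mono[of k' "max k k'"] by auto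
    then have "(\<lambda>i. lin_comb n v u i + lin_comb n v' u i) \<in> S (max k k')" by (rule submodD(2)[OF S_sub])
    moreover have "(\<lambda>i. lin_comb n v u i + lin_comb n v' u i) = lin_comb n (\<lambda>i. v i + v' i) u" by (simp add: fun_eq_iff lin_comb_plus)
    ultimately show "(\<lambda>i. v i + v' i) \<in> Y"
      using submodD(2)[OF coords_submod[OF A_subr] k(1,2)] unfolding Y_def by auto
  next
    fix a v assume "a \<in> A" "v \<in> Y"
    then obtain k where k: "v \<in> coords A n" "lin_comb n v u \<in> S k" by (auto simp: Y_def)
    have "(\<lambda>i. a * lin_comb n v u i) \<in> S k" by (rule submodD(3)[OF S_sub \<open>a \<in> A\<close> k(2)])
    moreover have "(\<lambda>i. a * lin_comb n v u i) = lin_comb n (\<lambda>i. a * v i) u" by (simp add: fun_eq_iff lin_comb_smult)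
    ultimately show "(\<lambda>i. a * v i) \<in> Y"
      using submodD(3)[OF coords_submod[OF A_subr] \<open>a \<in> A\<close> k(1)] unfolding Y_def by auto
  qed
  then obtain p b where Y: "Y = span A p b"
    using submodule_fg[of Y n] by (auto simp: Y_def)
  have "\<exists>k. lin_comb n (b l) u \<in> S k" if "l < p" for l
    using span_generator[OF A_subr that, of b] Y by (auto simp: Y_def)
  then obtain \<kappa> where \<kappa>: "\<And>l. l < p \<Longrightarrow> lin_comb n (b l) u \<in> S (\<kappa> l)" by metis
  define k where "k = (\<Sum>l<p. \<kappa> l)"
  have bS: "lin_comb n (b l) u \<in> S k" if "l < p" for l
    using \<kappa>[OF that] S_mono[of "\<kappa> l" k] that member_le_sum[of l "{..<p}" \<kappa>] by (auto simp: k_def)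
  obtain a where a: "a \<in> coords A n" "\<And>i. w ^ k \<asymp> lin_comb n a u i"
    using span_lift[OF pow[of k] A_subr] by metis
  have wS: "(\<lambda>_. w ^ k) \<in> S (Suc k)"
    unfolding S_def by (rule span_generator[OF A_subr]) simp
  have "lin_comb n a u \<in> S (Suc k)"
    by (rule submod_cong[OF S_sub wS]) (rule eqv_sym[OF a(2)])
  then have "a \<in> span A p b" using a(1) unfolding Y[symmetric] by (auto simp: Y_def)
  then obtain \<beta> where \<beta>: "\<And>l. l < p \<Longrightarrow> \<beta> l \<in> A" "\<And>i. a i \<asymp> lin_comb p \<beta> b i" by (metis spanE)
  have "lin_comb p \<beta> (\<lambda>l. lin_comb n (b l) u) \<in> S k"
    by (rule submod_lin_comb[OF S_sub \<beta>(1) bS])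
  moreover have "w ^ k \<asymp> lin_comb p \<beta> (\<lambda>l. lin_comb n (b l) u) i" for i
  proof -
    have "w ^ k \<asymp> lin_comb n a u i" by (rule a(2))
    also have "\<dots> \<asymp> lin_comb n (lin_comb p \<beta> b) u i" using \<beta>(2) by (intro lin_comb_eqv) auto
    also have "\<dots> = lin_comb p \<beta> (\<lambda>l. lin_comb n (b l) u) i" by (simp add: lin_comb_transpose)
    finally show ?thesis .
  qed
  ultimately have "(\<lambda>_. w ^ k) \<in> S k" by (rule submod_cong[OF S_sub])
  then obtain c where "\<And>l. l < k \<Longrightarrow> c l \<in> A" "\<And>i::unit. w ^ k \<asymp> lin_comb k c (\<lambda>k _. w ^ k) i"
    unfolding S_def by (metis spanE)
  then show ?thesis unfolding integral_def lin_comb_def by blast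
qed

lemma integral_add_mult:
  assumes "integral A x" "integral A y"
  shows "integral A (x + y)" "integral A (x * y)"
proof -
  let ?one = "\<lambda>(_::nat) (_::unit). 1 :: 'a"
  obtain n u where u: "span A 1 ?one \<subseteq> span A n u" "\<forall>z\<in>set [x, y]. stable z (span A n u)"
    using stable_lattice[OF A_subr, of "[x, y]" 1 ?one] assms by auto
  have one: "(\<lambda>_. 1) \<in> span A n u"
    using span_generator[OF A_subr, of 0 1 ?one] u(1) by auto
  have st: "stable x (span A n u)" "stable y (span A n u)" using u(2) by auto
  have "stable (x + y) (span A n u)"
    unfolding stable_def
  proof
    fix v assume v: "v \<in> span A n u"
    show "(\<lambda>i. (x + y) * v i) \<in> span A n u"
      using submodD(2)[OF span_submod[OF A_subr], of "\<lambda>i. x * v i" n u "\<lambda>i. y * v i"] st v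
      by (auto simp: stable_def distrib_right)
  qed
  then show "integral A (x + y)" using stable_imp_integral one by blast
  have "stable (x * y) (span A n u)"
    unfolding stable_def
  proof
    fix v assume v: "v \<in> span A n u"
    show "(\<lambda>i. x * y * v i) \<in> span A n u"
      using bspec[OF st(1)[unfolded stable_def] bspec[OF st(2)[unfolded stable_def] v]]
      unfolding mult.assoc .
  qed
  then show "integral A (x * y)" using stable_imp_integral one by blast
qed

lemma integral_A: "subr W \<Longrightarrow> a \<in> W \<Longrightarrow> integral W a"
  by (rule integral_root[of W 1 a]) auto

definition integrals :: "('i \<Rightarrow> 'a) set" where
  "integrals = {v. \<forall>i. integral A (v i)}"

text \<open>The trace of multiplication by \<open>y\<close> on the span of \<open>u\<close>. The representing matrix \<open>Y\<close> is
  determined only up to congruence (for independent \<open>u\<close>), so the trace is a relation rather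
  than a function.\<close>

definition trace_of :: "nat \<Rightarrow> (nat \<Rightarrow> 'i \<Rightarrow> 'a) \<Rightarrow> 'a \<Rightarrow> 'a \<Rightarrow> bool" where
  "trace_of n u y t \<longleftrightarrow> (\<exists>Y. (\<forall>k<n. \<forall>l<n. Y k l \<in> K) \<and> (\<forall>k<n. \<forall>i. y * u k i \<asymp> lin_comb n (Y k) u i) \<and>
     t \<asymp> (\<Sum>k<n. Y k k))"

lemma trace_ofI:
  assumes "\<And>k l. k < n \<Longrightarrow> l < n \<Longrightarrow> Y k l \<in> K" "\<And>k i. k < n \<Longrightarrow> y * u k i \<asymp> lin_comb n (Y k) u i"
    "t \<asymp> (\<Sum>k<n. Y k k)"
  shows "trace_of n u y t"
  using assms unfolding trace_of_def by blast

lemma trace_ofE: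
  assumes "trace_of n u y t"
  obtains Y where "\<And>k l. k < n \<Longrightarrow> l < n \<Longrightarrow> Y k l \<in> K" "\<And>k i. k < n \<Longrightarrow> y * u k i \<asymp> lin_comb n (Y k) u i"
    "t \<asymp> (\<Sum>k<n. Y k k)"
  using assms unfolding trace_of_def by blast

lemma trace_exists:
  assumes "stable y (span K n u)"
  shows "\<exists>t. trace_of n u y t"
proof -
  have "(\<lambda>i. y * u k i) \<in> span K n u" if "k < n" for k
    by (rule bspec[OF assms[unfolded stable_def] span_generator[OF K_subr that]])
  then obtain Y where "\<And>k l. k < n \<Longrightarrow> l < n \<Longrightarrow> Y k l \<in> K" "\<And>k i. k < n \<Longrightarrow> y * u k i \<asymp> lin_comb n (Y k) u i"
    by (rule span_matrix[of n "\<lambda>k i. y * u k i" K n u]) auto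
  then show ?thesis using trace_ofI[of n Y y u, OF _ _ eqv_refl] by blast
qed

lemma trace_in_K: "trace_of n u y t \<Longrightarrow> t \<in> K"
  by (elim trace_ofE) (rule subr_cong[OF K_subr subr_sum[OF K_subr]], auto)

text \<open>The matrices are conjugate, and the trace of \<open>P Y Q\<close> is that of \<open>Y Q P\<close>, where \<open>Q P\<close> is the
  identity.\<close>

lemma trace_basis_independent:
  assumes u: "indep K n u" and u': "indep K n' u'"
    and uu': "\<And>k. k < n \<Longrightarrow> u k \<in> span K n' u'" "\<And>k. k < n' \<Longrightarrow> u' k \<in> span K n u"
    and t: "trace_of n u y t" and t': "trace_of n' u' y t'"
  shows "t' \<asymp> t"
proof -
  obtain Q where Q: "\<And>i k. i < n \<Longrightarrow> k < n' \<Longrightarrow> Q i k \<in> K" "\<And>i j. i < n \<Longrightarrow> u i j \<asymp> lin_comb n' (Q i) u' j"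
    by (rule span_matrix[of n u K n' u']) (use uu' in auto)
  obtain P where P: "\<And>i k. i < n' \<Longrightarrow> k < n \<Longrightarrow> P i k \<in> K" "\<And>i j. i < n' \<Longrightarrow> u' i j \<asymp> lin_comb n (P i) u j"
    by (rule span_matrix[of n' u' K n u]) (use uu' in auto)
  obtain Y where Y: "\<And>k l. k < n \<Longrightarrow> l < n \<Longrightarrow> Y k l \<in> K" "\<And>k i. k < n \<Longrightarrow> y * u k i \<asymp> lin_comb n (Y k) u i"
    "t \<asymp> (\<Sum>k<n. Y k k)" using t by (rule trace_ofE) blast
  obtain Y' where Y': "\<And>k l. k < n' \<Longrightarrow> l < n' \<Longrightarrow> Y' k l \<in> K" "\<And>k i. k < n' \<Longrightarrow> y * u' k i \<asymp> lin_comb n' (Y' k) u' i"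
    "t' \<asymp> (\<Sum>k<n'. Y' k k)" using t' by (rule trace_ofE) blast
  have QP: "(\<Sum>k<n'. Q i k * P k j) \<asymp> (if i = j then 1 else 0)" if "i < n" "j < n" for i j
    by (rule indep_coeff_matrix[OF u K_subr Q P that])
  have "Y' i j \<asymp> (\<Sum>l<n. (\<Sum>k<n. P i k * Y k l) * Q l j)" if ij: "i < n'" "j < n'" for i j
  proof (rule indep_coeff[OF u' K_subr Y'(1)[OF ij(1)] _ _ ij(2)])
    fix k assume "k < n'"
    then show "(\<Sum>l<n. (\<Sum>k<n. P i k * Y k l) * Q l k) \<in> K"
      using P(1) Q(1) Y(1) ij by (intro subr_sum[OF K_subr] subrD(5)[OF K_subr]) auto
  next
    fix r
    have "lin_comb n' (Y' i) u' r \<asymp> y * u' i r" by (rule eqv_sym[OF Y'(2)[OF ij(1)]])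
    also have "\<dots> \<asymp> y * lin_comb n (P i) u r" by (rule eqv_mult_left[OF P(2)[OF ij(1)]])
    also have "\<dots> = lin_comb n (P i) (\<lambda>k i. y * u k i) r" by (simp add: lin_comb_def sum_distrib_left ac_simps)
    also have "\<dots> \<asymp> lin_comb n (P i) (\<lambda>k. lin_comb n (Y k) u) r" using Y(2) by (intro lin_comb_eqv) auto
    also have "\<dots> = lin_comb n (\<lambda>l. \<Sum>k<n. P i k * Y k l) u r" by (simp add: lin_comb_lin_comb)
    also have "\<dots> \<asymp> lin_comb n (\<lambda>l. \<Sum>k<n. P i k * Y k l) (\<lambda>l. lin_comb n' (Q l) u') r"
      using Q(2) by (intro lin_comb_eqv) auto
    also have "\<dots> = lin_comb n' (\<lambda>j. \<Sum>l<n. (\<Sum>k<n. P i k * Y k l) * Q l j) u' r" by (simp add: lin_comb_lin_comb)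
    finally show "lin_comb n' (Y' i) u' r \<asymp> lin_comb n' (\<lambda>j. \<Sum>l<n. (\<Sum>k<n. P i k * Y k l) * Q l j) u' r" .
  qed
  then have "(\<Sum>i<n'. Y' i i) \<asymp> (\<Sum>i<n'. \<Sum>l<n. (\<Sum>k<n. P i k * Y k l) * Q l i)"
    by (intro eqv_sum) auto
  also have "\<dots> = (\<Sum>i<n'. \<Sum>l<n. \<Sum>k<n. Y k l * (Q l i * P i k))"
    by (simp add: sum_distrib_right sum_distrib_left ac_simps)
  also have "\<dots> = (\<Sum>l<n. \<Sum>k<n. \<Sum>i<n'. Y k l * (Q l i * P i k))"
    by (subst sum.swap) (intro sum.cong refl sum.swap)
  also have "\<dots> = (\<Sum>l<n. \<Sum>k<n. Y k l * (\<Sum>i<n'. Q l i * P i k))"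
    by (simp add: sum_distrib_left)
  also have "\<dots> \<asymp> (\<Sum>l<n. \<Sum>k<n. Y k l * (if l = k then 1 else 0))"
    using QP by (intro eqv_sum eqv_mult_left) auto
  also have "\<dots> = (\<Sum>l<n. Y l l)"
    by (intro sum.cong refl) (simp add: if_distrib[of "(*) _"] cong: if_cong)
  also have "\<dots> \<asymp> t" by (rule eqv_sym[OF Y(3)])
  finally show ?thesis using Y'(3) eqv_trans by blast
qed

lemma trace_unique:
  assumes "indep K n u" "trace_of n u y t" "trace_of n u y t'"
  shows "t' \<asymp> t"
  using trace_basis_independent[OF assms(1,1) _ _ assms(2,3)] span_generator[OF K_subr] by blast

lemma trace_cong: "trace_of n u y t \<Longrightarrow> y' \<asymp> y \<Longrightarrow> trace_of n u y' t"
proof -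
  assume t: "trace_of n u y t" and y': "y' \<asymp> y"
  obtain Y where Y: "\<And>k l. k < n \<Longrightarrow> l < n \<Longrightarrow> Y k l \<in> K" "\<And>k i. k < n \<Longrightarrow> y * u k i \<asymp> lin_comb n (Y k) u i"
    "t \<asymp> (\<Sum>k<n. Y k k)" using t by (rule trace_ofE) blast
  show ?thesis
    by (rule trace_ofI[OF Y(1) eqv_trans[OF eqv_mult_right[OF y'] Y(2)] Y(3)])
qed

lemma trace_scalar:
  assumes "c \<in> K"
  shows "trace_of n u c (of_nat n * c)"
proof (rule trace_ofI[of _ "\<lambda>k l. if l = k then c else 0"])
  fix k i assume k: "k < n"
  have "lin_comb n (\<lambda>l. if l = k then c else 0) u i = (\<Sum>l<n. if l = k then c * u k i else 0)"
    unfolding lin_comb_def by (intro sum.cong) auto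
  then show "c * u k i \<asymp> lin_comb n (\<lambda>l. if l = k then c else 0) u i" using k by simp
qed (use assms subrD(1)[OF K_subr] in auto)

lemma trace_sum:
  assumes "finite S" "\<And>b. b \<in> S \<Longrightarrow> c b \<in> K" "\<And>b. b \<in> S \<Longrightarrow> trace_of n u (y b) (t b)"
  shows "trace_of n u (\<Sum>b\<in>S. c b * y b) (\<Sum>b\<in>S. c b * t b)"
proof -
  have "\<forall>b\<in>S. \<exists>Y. (\<forall>k<n. \<forall>l<n. Y k l \<in> K) \<and> (\<forall>k<n. \<forall>i. y b * u k i \<asymp> lin_comb n (Y k) u i) \<and> t b \<asymp> (\<Sum>k<n. Y k k)"
    using assms(3) unfolding trace_of_def by blast
  then obtain Y where "\<forall>b\<in>S. (\<forall>k<n. \<forall>l<n. Y b k l \<in> K) \<and> (\<forall>k<n. \<forall>i. y b * u k i \<asymp> lin_comb n (Y b k) u i) \<and>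
     t b \<asymp> (\<Sum>k<n. Y b k k)" by (rule bchoice[THEN exE]) blast
  then have Y: "\<And>b k l. b \<in> S \<Longrightarrow> k < n \<Longrightarrow> l < n \<Longrightarrow> Y b k l \<in> K"
    "\<And>b k i. b \<in> S \<Longrightarrow> k < n \<Longrightarrow> y b * u k i \<asymp> lin_comb n (Y b k) u i" "\<And>b. b \<in> S \<Longrightarrow> t b \<asymp> (\<Sum>k<n. Y b k k)"
    by auto
  show ?thesis
  proof (rule trace_ofI[of _ "\<lambda>k l. \<Sum>b\<in>S. c b * Y b k l"])
    show "(\<Sum>b\<in>S. c b * Y b k l) \<in> K" if "k < n" "l < n" for k l
      using that Y(1) assms(2) by (intro subr_sum[OF K_subr] subrD(5)[OF K_subr]) auto
    show "(\<Sum>b\<in>S. c b * y b) * u k i \<asymp> lin_comb n (\<lambda>l. \<Sum>b\<in>S. c b * Y b k l) u i" if k: "k < n" for k i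
    proof -
      have "(\<Sum>b\<in>S. c b * y b) * u k i = (\<Sum>b\<in>S. c b * (y b * u k i))"
        by (simp add: sum_distrib_right mult.assoc)
      also have "\<dots> \<asymp> (\<Sum>b\<in>S. c b * lin_comb n (Y b k) u i)"
        using Y(2) k by (intro eqv_sum eqv_mult_left) auto
      also have "\<dots> = (\<Sum>b\<in>S. \<Sum>l<n. c b * Y b k l * u l i)"
        by (simp add: lin_comb_def sum_distrib_left mult.assoc)
      also have "\<dots> = lin_comb n (\<lambda>l. \<Sum>b\<in>S. c b * Y b k l) u i"
        unfolding lin_comb_def by (subst sum.swap) (simp add: sum_distrib_right)
      finally show ?thesis .
    qed
    have "(\<Sum>b\<in>S. c b * t b) \<asymp> (\<Sum>b\<in>S. c b * (\<Sum>k<n. Y b k k))"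
      using Y(3) by (intro eqv_sum eqv_mult_left) auto
    also have "\<dots> = (\<Sum>k<n. \<Sum>b\<in>S. c b * Y b k k)"
      unfolding sum_distrib_left by (rule sum.swap)
    finally show "(\<Sum>b\<in>S. c b * t b) \<asymp> (\<Sum>k<n. \<Sum>b\<in>S. c b * Y b k k)" .
  qed
qed

end

context normal_subdomain
begin

text \<open>It suffices to show that the trace lies in the valuation ring at each essential prime. There
  \<open>u\<close> generates a lattice that can be enlarged to one stable under \<open>y\<close>; it is free, and in a
  basis of it the matrix of \<open>y\<close> has local entries.\<close>

lemma trace_integral:
  assumes u: "indep K n u" and st: "stable y (span K n u)" and y: "integral A y" and t: "trace_of n u y t"
  shows "t \<in> A"
proof (rule A_eq_Inter_loc[OF trace_in_K[OF t]])
  fix q assume qe: "q \<in> essential_primes"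
  then have q: "prime_in_A q" by (rule essential_primeD)
  note S = loc_subr[OF q] and SK = loc_subset_K[OF q]
  have "integral (loc q) y" using integral_mono[OF A_subset_loc[OF q] y] .
  from stable_lattice_step[OF S this, of n u] obtain n1 u1 where 1: "span (loc q) n u \<subseteq> span (loc q) n1 u1"
    "stable y (span (loc q) n1 u1)"
    "\<forall>M. submod (loc q) M \<and> span (loc q) n u \<subseteq> M \<and> stable y M \<longrightarrow> span (loc q) n1 u1 \<subseteq> M" by auto
  obtain n2 u2 where 2: "minimal_generators (loc q) (span (loc q) n1 u1) n2 u2"
    using minimal_generators_exist[OF refl] by blast
  then have eq: "span (loc q) n1 u1 = span (loc q) n2 u2" by (simp add: minimal_generators_def)
  have i2: "indep K n2 u2" by (rule valuation_minimal_indep[OF K_subfld loc_valuation[OF qe] 2])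
  have subE: "span (loc q) n2 u2 \<subseteq> span K n u"
    using 1(3) submod_antimono[OF span_submod[OF K_subr] SK] st span_mono[OF SK] unfolding eq[symmetric] by blast
  have a: "u k \<in> span K n2 u2" if "k < n" for k
    using span_generator[OF S that, of u] 1(1) eq span_mono[OF SK] by blast
  have b: "u2 k \<in> span K n u" if "k < n2" for k
    using span_generator[OF S that, of u2] subE by blast
  have "(\<lambda>i. y * u2 k i) \<in> span (loc q) n2 u2" if "k < n2" for k
    by (rule bspec[OF 1(2)[unfolded stable_def eq] span_generator[OF S that]])
  then obtain Y where Y: "\<And>k l. k < n2 \<Longrightarrow> l < n2 \<Longrightarrow> Y k l \<in> loc q" "\<And>k i. k < n2 \<Longrightarrow> y * u2 k i \<asymp> lin_comb n2 (Y k) u2 i"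
    by (rule span_matrix[of n2 "\<lambda>k i. y * u2 k i" "loc q" n2 u2]) auto
  have "trace_of n2 u2 y (\<Sum>k<n2. Y k k)"
    using Y SK by (intro trace_ofI[of _ Y]) auto
  then have "(\<Sum>k<n2. Y k k) \<asymp> t" using trace_basis_independent[OF u i2 _ _ t] a b by blast
  then show "t \<in> loc q"
    using subr_cong[OF S subr_sum[OF S], of "{..<n2}" "\<lambda>k. Y k k"] Y(1) eqv_sym by blast
qed

end

section \<open>Vanishing of Tor for divisorial ideals\<close>

context normal_subdomain
begin

lemma dual_power_smult: "g \<in> dual_power I n \<Longrightarrow> a \<in> A \<Longrightarrow> a * g \<in> dual_power I n"
proof (induction n arbitrary: g)
  case 0
  then show ?case using subrD(5)[OF A_subr] by simp
next
  case (Suc n)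
  have "a * g \<in> K" using Suc.prems A_subset_K subrD(5)[OF K_subr] by auto
  moreover have "a * g * y \<in> dual_power I n" if "y \<in> I" for y
    using Suc.IH[of "g * y"] Suc.prems that by (simp add: mult.assoc)
  ultimately show ?case by simp
qed

lemma power_in_dual_power: "z \<in> dual I \<Longrightarrow> z ^ n \<in> dual_power I n"
proof (induction n)
  case 0
  then show ?case using subrD(2)[OF A_subr] by simp
next
  case (Suc n)
  have "z ^ Suc n \<in> K" using Suc.prems by (intro subr_power[OF K_subr]) (simp add: dual_def)
  moreover have "z ^ Suc n * y \<in> dual_power I n" if "y \<in> I" for y
  proof -
    have "z * y \<in> A" using Suc.prems that by (simp add: dual_def)
    then have "(z * y) * z ^ n \<in> dual_power I n" using dual_power_smult Suc by blast
    then show ?thesis by (simp add: ac_simps)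
  qed
  ultimately show ?case by simp
qed

lemma dual_power_mult_power: "g \<in> dual_power I n \<Longrightarrow> x \<in> I \<Longrightarrow> g * x ^ n \<in> A"
proof (induction n arbitrary: g)
  case (Suc n)
  then have "(g * x) * x ^ n \<in> A" by simp
  then show ?case by (simp add: ac_simps)
qed simp

text \<open>Multiplication by a common denominator \<open>d\<close> identifies \<open>I\<close> with an ideal of \<open>A\<close>.\<close>

lemma rank_one_fg:
  assumes I: "divisorial I"
  shows "\<exists>n g. rank_one I = span A n g"
proof -
  have Il: "ideal_like I" using I by (simp add: divisorial_def)
  obtain d where d: "d \<in> A" "d \<notin> Z" "\<And>x. x \<in> I \<Longrightarrow> d * x \<in> A" using I unfolding divisorial_def by blast
  have sub: "submod A (rank_one I)"
    using Il Z_add Z_mult unfolding submod_def rank_one_def ideal_like_def by auto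
  define Y where "Y = {w \<in> coords A 1. \<exists>x\<in>I. w 0 \<asymp> d * x}"
  have "submod A Y"
    unfolding submod_def
  proof (intro conjI allI impI ballI)
    fix v :: "nat \<Rightarrow> 'a" assume v: "\<forall>i. v i \<in> Z"
    have "0 \<in> I" using Il Z_zero by (auto simp: ideal_like_def)
    then show "v \<in> Y" using v submodD(1)[OF coords_submod[OF A_subr]] by (auto simp: Y_def Z_iff intro!: bexI[of _ 0])
  next
    fix v w assume "v \<in> Y" "w \<in> Y"
    then obtain x y where xy: "v \<in> coords A 1" "w \<in> coords A 1" "x \<in> I" "y \<in> I" "v 0 \<asymp> d * x" "w 0 \<asymp> d * y"
      by (auto simp: Y_def)
    have "x + y \<in> I" using Il xy by (auto simp: ideal_like_def)
    moreover have "v 0 + w 0 \<asymp> d * (x + y)" using eqv_add[OF xy(5,6)] by (simp add: distrib_left)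
    ultimately show "(\<lambda>i. v i + w i) \<in> Y"
      using submodD(2)[OF coords_submod[OF A_subr] xy(1,2)] by (auto simp: Y_def)
  next
    fix a v assume "a \<in> A" "v \<in> Y"
    then obtain x where x: "v \<in> coords A 1" "x \<in> I" "v 0 \<asymp> d * x" by (auto simp: Y_def)
    have "a * x \<in> I" using Il x \<open>a \<in> A\<close> by (auto simp: ideal_like_def)
    moreover have "a * v 0 \<asymp> d * (a * x)" using eqv_mult_left[OF x(3), of a] by (simp add: ac_simps)
    ultimately show "(\<lambda>i. a * v i) \<in> Y"
      using submodD(3)[OF coords_submod[OF A_subr] \<open>a \<in> A\<close> x(1)] by (auto simp: Y_def)
  qed
  then obtain n y where Y: "Y = span A n y" using submodule_fg[of Y 1] by (auto simp: Y_def)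
  have "\<exists>x\<in>I. y k 0 \<asymp> d * x" if "k < n" for k
    using span_generator[OF A_subr that, of y] Y by (auto simp: Y_def)
  then obtain x where x: "\<And>k. k < n \<Longrightarrow> x k \<in> I \<and> y k 0 \<asymp> d * x k" by metis
  define g where "g = (\<lambda>k i::nat. if i = 0 then x k else 0)"
  have gI: "g k \<in> rank_one I" if "k < n" for k using x[OF that] Z_zero by (auto simp: g_def rank_one_def)
  have "v \<in> span A n g" if v: "v \<in> rank_one I" for v
  proof -
    have "(\<lambda>i. if i = 0 then d * v 0 else 0) \<in> Y"
      using v d Z_zero by (auto simp: Y_def rank_one_def coords_def intro!: bexI[of _ "v 0"])
    then obtain a where a: "\<And>k. k < n \<Longrightarrow> a k \<in> A" "\<And>i. (\<lambda>i. if i = 0 then d * v 0 else 0) i \<asymp> lin_comb n a y i"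
      unfolding Y by (metis spanE)
    have "d * v 0 \<asymp> lin_comb n a y 0" using a(2)[of 0] by simp
    also have "\<dots> \<asymp> (\<Sum>k<n. a k * (d * x k))"
      unfolding lin_comb_def using x by (intro eqv_sum eqv_mult_left) auto
    also have "\<dots> = d * (\<Sum>k<n. a k * x k)" by (simp add: sum_distrib_left ac_simps)
    finally have v0: "v 0 \<asymp> (\<Sum>k<n. a k * x k)" by (rule eqv_cancel'[OF d(2)])
    show ?thesis
    proof (rule spanI[of _ a])
      show "v i \<asymp> lin_comb n a g i" for i
        using v0 v by (cases "i = 0") (auto simp: lin_comb_def g_def rank_one_def Z_iff)
    qed (use a in auto)
  qed
  then have "rank_one I = span A n g" using span_least[OF sub, of n g] gI by blast
  then show ?thesis by blast
qed

end

context residue_field_resolution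
begin

text \<open>The ideal \<open>I\<close> is a retract of the integral closure, at least as far as a given finite set of
  elements is concerned. Division by \<open>\<alpha>\<close> takes a cycle \<open>c\<close> with coefficients in \<open>I\<close> to one
  with integral coefficients, which is the boundary of a chain \<open>v\<close>. There is a space \<open>E\<close> of
  finite dimension \<open>N\<close> over \<open>K\<close> that contains 1 and is stable under \<open>\<alpha>\<close> and the coefficients
  of \<open>v\<close>, and the map \<open>y \<mapsto> tr (\<alpha> y) / N\<close> with the trace on \<open>E\<close> is linear and recovers \<open>c\<close>
  from \<open>\<alpha>\<^sup>-\<^sup>1 c\<close>. If \<open>z\<close> belongs to the inverse of \<open>I\<close>, the product \<open>z \<alpha>\<close> is integral, hence
  \<open>z tr (\<alpha> y) = tr (z \<alpha> y)\<close> lies in \<open>A\<close> for integral \<open>y\<close>. So the map takes the coefficients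
  of \<open>v\<close> to the double dual of \<open>I\<close>, which is \<open>I\<close>, and the chain obtained from \<open>v\<close> has
  boundary \<open>c\<close>.\<close>

lemma exact_at_rank_one:
  assumes ex: "exact_at j (integrals :: (unit \<Rightarrow> 'a) set)"
    and I: "divisorial I" and n: "n \<ge> 1" and f: "f \<in> K" "f \<notin> Z" "dual (dual_power I n) = {x. \<exists>a\<in>A. x \<asymp> a * f}"
    and \<alpha>: "\<alpha> ^ n \<asymp> f" and rat: "\<And>n. n > 0 \<Longrightarrow> \<exists>x\<in>A. of_nat n * x \<asymp> 1"
  shows "exact_at j (rank_one I)"
  unfolding exact_at_def
proof (intro ballI impI)
  fix c assume c: "c \<in> fchains (B (Suc j)) (rank_one I)" and cyc: "\<forall>x i. boundary (D j) c x i \<in> Z"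
  have Il: "ideal_like I" and IK: "I \<subseteq> K" and Idd: "dual (dual I) = I" using I by (auto simp: divisorial_def)
  have fdual: "f \<in> dual (dual_power I n)"
    unfolding f(3) using subrD(2)[OF A_subr] by (auto intro!: bexI[of _ 1])
  have "\<alpha> \<notin> Z"
  proof
    assume "\<alpha> \<in> Z"
    then have "\<alpha> ^ n \<in> Z" using n Z_mult_right by (cases n) auto
    then show False using Z_cong[OF \<alpha>] f(2) by blast
  qed
  then obtain \<beta> where \<beta>: "\<alpha> * \<beta> \<asymp> 1" using inverse_exists by blast
  have integral_\<beta>: "integral A (\<beta> * x)" if x: "x \<in> I" for x
  proof -
    have "x ^ n \<in> dual (dual_power I n)"
    proof -
      have "x ^ n \<in> K" using subr_power[OF K_subr] x IK by blast
      moreover have "x ^ n * g \<in> A" if "g \<in> dual_power I n" for g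
        using dual_power_mult_power[OF that x] by (simp add: mult.commute)
      ultimately show ?thesis by (simp add: dual_def)
    qed
    then obtain a where a: "a \<in> A" "x ^ n \<asymp> a * f" unfolding f(3) by blast
    have "(\<beta> * x) ^ n = \<beta> ^ n * x ^ n" by (simp add: power_mult_distrib)
    also have "\<dots> \<asymp> \<beta> ^ n * (a * f)" by (rule eqv_mult_left[OF a(2)])
    also have "\<dots> \<asymp> \<beta> ^ n * (a * \<alpha> ^ n)" by (intro eqv_mult_left eqv_sym[OF \<alpha>])
    also have "\<dots> = a * (\<alpha> * \<beta>) ^ n" by (simp add: power_mult_distrib ac_simps)
    also have "\<dots> \<asymp> a * 1 ^ n" by (intro eqv_mult_left eqv_power \<beta>)
    finally have "(\<beta> * x) ^ n \<asymp> a" by simp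
    then show ?thesis by (rule integral_root[OF A_subr n a(1)])
  qed
  have integral_\<alpha>: "integral A (z * \<alpha>)" if z: "z \<in> dual I" for z
  proof -
    have "(z * \<alpha>) ^ n \<asymp> z ^ n * f" using eqv_mult_left[OF \<alpha>, of "z ^ n"] by (simp add: power_mult_distrib)
    also have "\<dots> = f * z ^ n" by simp
    finally have "(z * \<alpha>) ^ n \<asymp> f * z ^ n" .
    moreover have "f * z ^ n \<in> A" using fdual power_in_dual_power[OF z] by (simp add: dual_def)
    ultimately show ?thesis using integral_root[OF A_subr n] by blast
  qed
  define c1 where "c1 = (\<lambda>b (_::unit). \<beta> * c b 0)"
  have sc1: "supp c1 \<subseteq> supp c" by (auto simp: c1_def supp_def)
  have c0I: "c b 0 \<in> I" "\<And>i. i > 0 \<Longrightarrow> c b i \<in> Z" for b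
    using chainsD(3)[OF c, of b] by (auto simp: rank_one_def)
  have fc: "finite (supp c)" by (rule chainsD(1)[OF c])
  have "c1 \<in> fchains (B (Suc j)) integrals"
    using finite_subset[OF sc1 fc] subset_trans[OF sc1 chainsD(2)[OF c]] integral_\<beta>[OF c0I(1)]
    by (simp add: fchains_def integrals_def c1_def)
  moreover have "boundary (D j) c1 x i \<in> Z" for x i
  proof -
    have "boundary (D j) c1 x i = \<beta> * boundary (D j) c x 0"
      using boundary_superset[OF fc sc1, of "D j" x i] boundary_superset[OF fc order_refl, of "D j" x 0]
      by (simp add: c1_def sum_distrib_left ac_simps)
    then show ?thesis using cyc Z_mult by simp
  qed
  ultimately obtain v where v: "v \<in> fchains (B (Suc (Suc j))) integrals" "\<And>x i. c1 x i \<asymp> boundary (D (Suc j)) v x i"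
    using exact_atD[OF ex] by metis
  have fv: "finite (supp v)" by (rule chainsD(1)[OF v(1)])
  have vint: "integral A (v b ())" for b using chainsD(3)[OF v(1), of b] by (simp add: integrals_def)
  obtain xs where xs: "set xs = (\<lambda>b. v b ()) ` supp v"
    using finite_list[OF finite_imageI[OF fv, of "\<lambda>b. v b ()"]] by metis
  have "integral K \<alpha>" by (rule integral_root[OF K_subr n f(1) \<alpha>])
  moreover have "integral K (v b ())" for b by (rule integral_mono[OF A_subset_K vint])
  ultimately have int: "\<forall>y\<in>set (\<alpha> # xs). integral K y" by (auto simp: xs)
  from stable_lattice[OF K_subr int, of 1 "\<lambda>_ (_::unit). 1"] obtain n1 u1 where 1: "span K 1 (\<lambda>_ (_::unit). 1) \<subseteq> span K n1 u1"
    "\<forall>y\<in>set (\<alpha> # xs). stable y (span K n1 u1)"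
    by (elim exE conjE) (rule that; assumption)
  obtain N u where Nu: "minimal_generators K (span K n1 u1) N u" using minimal_generators_exist[OF refl] by blast
  then have eq: "span K n1 u1 = span K N u" by (simp add: minimal_generators_def)
  let ?E = "span K N u"
  have u: "indep K N u" by (rule valuation_minimal_indep[OF K_subfld subfld_valuation[OF K_subfld] Nu])
  have "N > 0"
  proof (rule ccontr)
    assume "\<not> N > 0"
    moreover have "(\<lambda>_::unit. 1) \<in> ?E"
      using 1(1) span_generator[OF K_subr, of 0 1 "\<lambda>_ (_::unit). 1"] unfolding eq by auto
    ultimately have "1 \<asymp> 0" by (auto simp: span_def lin_comb_def)
    then show False using Z_proper by (simp add: Z_iff)
  qed
  then obtain r where r: "r \<in> A" "of_nat N * r \<asymp> 1" using rat by blast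
  have st\<alpha>: "stable \<alpha> ?E" and stv: "\<And>b. b \<in> supp v \<Longrightarrow> stable (v b ()) ?E"
    using 1(2) by (auto simp: eq xs)
  have st_mult: "stable (x * y) ?E" if "stable x ?E" "stable y ?E" for x y
    unfolding stable_def
  proof
    fix w assume w: "w \<in> ?E"
    show "(\<lambda>i. x * y * w i) \<in> ?E"
      using bspec[OF that(1)[unfolded stable_def] bspec[OF that(2)[unfolded stable_def] w]]
      unfolding mult.assoc .
  qed
  have st_K: "stable x ?E" if "x \<in> K" for x
    unfolding stable_def by (intro ballI submodD(3)[OF span_submod[OF K_subr] that])
  have "\<exists>t. b \<in> supp v \<longrightarrow> trace_of N u (\<alpha> * v b ()) t" for b
    using trace_exists[OF st_mult[OF st\<alpha> stv[of b]]] by blast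
  then obtain t where t: "\<And>b. b \<in> supp v \<Longrightarrow> trace_of N u (\<alpha> * v b ()) (t b)" by metis
  have tI: "r * t b \<in> I" if b: "b \<in> supp v" for b
  proof -
    have tK: "t b \<in> K" by (rule trace_in_K[OF t[OF b]])
    then have "r * t b \<in> K" using r(1) A_subset_K subrD(5)[OF K_subr] by blast
    moreover have "r * t b * z \<in> A" if z: "z \<in> dual I" for z
    proof -
      have zK: "z \<in> K" using z by (simp add: dual_def)
      have "trace_of N u (\<Sum>b'\<in>{b}. z * (\<alpha> * v b' ())) (\<Sum>b'\<in>{b}. z * t b')"
        by (rule trace_sum) (use zK t b in auto)
      then have "trace_of N u (z * \<alpha> * v b ()) (z * t b)" by (simp add: mult.assoc)
      moreover have "stable (z * \<alpha> * v b ()) ?E" by (intro st_mult st_K[OF zK] st\<alpha> stv[OF b])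
      ultimately have "z * t b \<in> A"
        using trace_integral[OF u] integral_add_mult(2)[OF integral_\<alpha>[OF z] vint] by blast
      then have "r * (z * t b) \<in> A" using subrD(5)[OF A_subr r(1)] by blast
      then show ?thesis by (simp add: ac_simps)
    qed
    ultimately have "r * t b \<in> dual (dual I)" by (simp add: dual_def[of "dual I"])
    then show ?thesis by (simp add: Idd)
  qed
  \<comment> \<open>Since \<open>r\<close> is the inverse of the dimension, this is \<open>tr (\<alpha> y) / N\<close> for the
    coefficients \<open>y\<close> of \<open>v\<close>.\<close>
  define c' where "c' = (\<lambda>b (i::nat). if i = 0 \<and> b \<in> supp v then r * t b else 0)"
  have sc': "supp c' \<subseteq> supp v" by (auto simp: c'_def supp_def fun_eq_iff)
  have "c' b \<in> rank_one I" for b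
    using tI[of b] Il Z_zero by (auto simp: c'_def rank_one_def ideal_like_def)
  then have "c' \<in> fchains (B (Suc (Suc j))) (rank_one I)"
    using finite_subset[OF sc' fv] subset_trans[OF sc' chainsD(2)[OF v(1)]] by (simp add: fchains_def)
  moreover have "c x i \<asymp> boundary (D (Suc j)) c' x i" for x i
  proof (cases "i = 0")
    case True
    let ?M = "D (Suc j)"
    have "c x 0 = 1 * c x 0" by simp
    also have "\<dots> \<asymp> \<alpha> * \<beta> * c x 0" by (rule eqv_mult_right[OF eqv_sym[OF \<beta>]])
    also have "\<dots> = \<alpha> * c1 x ()" by (simp add: c1_def ac_simps)
    also have "\<dots> \<asymp> \<alpha> * boundary ?M v x ()" by (rule eqv_mult_left[OF v(2)])
    also have "\<dots> = (\<Sum>b\<in>supp v. ?M b x * (\<alpha> * v b ()))"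
      by (simp add: boundary_superset[OF fv order_refl] sum_distrib_left ac_simps)
    finally have "c x 0 \<asymp> (\<Sum>b\<in>supp v. ?M b x * (\<alpha> * v b ()))" .
    moreover have "trace_of N u (\<Sum>b\<in>supp v. ?M b x * (\<alpha> * v b ())) (\<Sum>b\<in>supp v. ?M b x * t b)"
      by (rule trace_sum[OF fv]) (use D_in A_subset_K t in auto)
    ultimately have "trace_of N u (c x 0) (\<Sum>b\<in>supp v. ?M b x * t b)" using trace_cong by blast
    moreover have "trace_of N u (c x 0) (of_nat N * c x 0)"
      using c0I(1) IK by (intro trace_scalar) blast
    ultimately have tr: "of_nat N * c x 0 \<asymp> (\<Sum>b\<in>supp v. ?M b x * t b)"
      using trace_unique[OF u] by blast
    have "c x 0 = 1 * c x 0" by simp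
    also have "\<dots> \<asymp> of_nat N * r * c x 0" by (rule eqv_mult_right[OF eqv_sym[OF r(2)]])
    also have "\<dots> = r * (of_nat N * c x 0)" by (simp add: ac_simps)
    also have "\<dots> \<asymp> r * (\<Sum>b\<in>supp v. ?M b x * t b)" by (rule eqv_mult_left[OF tr])
    also have "\<dots> = (\<Sum>b\<in>supp v. ?M b x * c' b 0)" by (simp add: c'_def sum_distrib_left ac_simps)
    also have "\<dots> = boundary ?M c' x 0" by (rule boundary_superset[OF fv sc', symmetric])
    finally show ?thesis using True by simp
  next
    case False
    then have "boundary (D (Suc j)) c' x i = 0" using boundary_superset[OF fv sc'] by (simp add: c'_def)
    then show ?thesis using c0I(2)[of i x] False by (simp add: Z_iff)
  qed
  ultimately show "\<exists>n'\<in>fchains (B (Suc (Suc j))) (rank_one I). \<forall>x i. c x i \<asymp> boundary (D (Suc j)) n' x i"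
    by blast
qed

text \<open>Orientation gives an element \<open>h\<close> that generates \<open>I\<close> at each essential prime. It lies in the
  double dual of \<open>I\<close>, since its products with elements of the dual lie in all the
  localizations.\<close>

theorem divisorial_principal:
  assumes ex: "exact_at j (integrals :: (unit \<Rightarrow> 'a) set)"
    and tors: "torsion_classes" and I: "divisorial I"
    and roots: "\<And>f n. f \<in> K \<Longrightarrow> n \<ge> 1 \<Longrightarrow> \<exists>\<alpha>. \<alpha> ^ n \<asymp> f"
    and rat: "\<And>n. n > 0 \<Longrightarrow> \<exists>x\<in>A. of_nat n * x \<asymp> 1"
  shows "\<exists>f\<in>I. f \<notin> Z \<and> (\<forall>x\<in>I. \<exists>a\<in>A. x \<asymp> a * f)"
proof -
  obtain n f where nf: "n \<ge> 1" "f \<in> K" "f \<notin> Z" "dual (dual_power I n) = {x. \<exists>a\<in>A. x \<asymp> a * f}"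
    using tors I unfolding torsion_classes_def by blast
  obtain \<alpha> where "\<alpha> ^ n \<asymp> f" using roots nf by blast
  then have ex': "exact_at j (rank_one I)" using exact_at_rank_one[OF ex I nf _ rat] by blast
  obtain b g where bg: "rank_one I = span A b g" using rank_one_fg[OF I] by blast
  have or: "oriented (rank_one I)" using exact_at_oriented ex' unfolding bg by blast
  have I': "I \<subseteq> K" "ideal_like I" "dual (dual I) = I" using I by (auto simp: divisorial_def)
  obtain x0 where x0: "x0 \<in> I" "x0 \<notin> Z" using I unfolding divisorial_def by blast
  obtain h where h: "h \<in> K" "h \<notin> Z" "\<And>q. q \<in> essential_primes \<Longrightarrow> \<exists>s\<in>A. s \<notin> q \<and> s * h \<in> I"
    "\<forall>x\<in>I. \<exists>a\<in>A. x \<asymp> a * h"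
    using oriented_rank_one[OF or I'(1,2) x0] by blast
  have "h * z \<in> A" if z: "z \<in> dual I" for z
  proof (rule A_eq_Inter_loc)
    show "h * z \<in> K" using h(1) z subrD(5)[OF K_subr] by (simp add: dual_def)
    fix q assume "q \<in> essential_primes"
    then obtain s where s: "s \<in> A" "s \<notin> q" "s * h \<in> I" using h(3) by blast
    have "z * (s * h) \<in> A" using z s(3) by (simp add: dual_def)
    then have "s * (h * z) \<in> A" by (simp add: ac_simps)
    then show "h * z \<in> loc q" by (rule locI[OF s(1,2)])
  qed
  then have "h \<in> dual (dual I)" using h(1) by (simp add: dual_def[of "dual I"])
  then have "h \<in> I" by (simp add: I'(3))
  then show ?thesis using h by blast
qed

end

section \<open>A ring type above all commutative rings on a carrier\<close>

text \<open>The product of the integers and of all commutative rings on subsets of \<open>'c\<close>. The integers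
  ensure that 0 and 1 differ; the value at records that are not commutative rings is fixed,
  to make the elements extensional.\<close>

typedef 'c universal_ring =
  "{p :: int \<times> ('c ring \<Rightarrow> 'c). \<forall>S. if cring S then snd p S \<in> carrier S else snd p S = undefined}"
  by (rule exI[of _ "(0, \<lambda>S. if cring S then \<zero>\<^bsub>S\<^esub> else undefined)"])
    (auto simp: cring.cring_simprules)

setup_lifting type_definition_universal_ring

instantiation universal_ring :: (type) comm_ring_1
begin

lift_definition zero_universal_ring :: "'a universal_ring" is
  "(0, \<lambda>S. if cring S then \<zero>\<^bsub>S\<^esub> else undefined)"
  by (auto simp: cring.cring_simprules)

lift_definition one_universal_ring :: "'a universal_ring" is
  "(1, \<lambda>S. if cring S then \<one>\<^bsub>S\<^esub> else undefined)"
  by (auto simp: cring.cring_simprules)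

lift_definition plus_universal_ring :: "'a universal_ring \<Rightarrow> 'a universal_ring \<Rightarrow> 'a universal_ring" is
  "\<lambda>p q. (fst p + fst q, \<lambda>S. if cring S then snd p S \<oplus>\<^bsub>S\<^esub> snd q S else undefined)"
  by (auto simp: cring.cring_simprules)

lift_definition times_universal_ring :: "'a universal_ring \<Rightarrow> 'a universal_ring \<Rightarrow> 'a universal_ring" is
  "\<lambda>p q. (fst p * fst q, \<lambda>S. if cring S then snd p S \<otimes>\<^bsub>S\<^esub> snd q S else undefined)"
  by (auto simp: cring.cring_simprules)

lift_definition uminus_universal_ring :: "'a universal_ring \<Rightarrow> 'a universal_ring" is
  "\<lambda>p. (- fst p, \<lambda>S. if cring S then \<ominus>\<^bsub>S\<^esub> snd p S else undefined)"
  by (auto simp: cring.cring_simprules)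

definition minus_universal_ring :: "'a universal_ring \<Rightarrow> 'a universal_ring \<Rightarrow> 'a universal_ring" where
  "minus_universal_ring x y = x + - y"

instance
proof
  fix a b c :: "'a universal_ring"
  show "a * b * c = a * (b * c)" by transfer (auto simp: fun_eq_iff cring.cring_simprules)
  show "a * b = b * a" by transfer (auto simp: fun_eq_iff cring.cring_simprules)
  show "1 * a = a" by transfer (auto simp: fun_eq_iff prod_eq_iff cring.cring_simprules)
  show "a + b + c = a + (b + c)" by transfer (auto simp: fun_eq_iff cring.cring_simprules)
  show "a + b = b + a" by transfer (auto simp: fun_eq_iff cring.cring_simprules)
  show "0 + a = a" by transfer (auto simp: fun_eq_iff prod_eq_iff cring.cring_simprules)
  show "- a + a = 0" by transfer (auto simp: fun_eq_iff cring.cring_simprules)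
  show "a - b = a + - b" by (rule minus_universal_ring_def)
  show "(a + b) * c = a * c + b * c" by transfer (auto simp: fun_eq_iff cring.cring_simprules distrib_right)
  show "(0 :: 'a universal_ring) \<noteq> 1" by transfer auto
qed

end

lift_definition component :: "'c ring \<Rightarrow> 'c universal_ring \<Rightarrow> 'c" is "\<lambda>S p. snd p S" .

lemma component_simps:
  assumes "cring S"
  shows "component S x \<in> carrier S" "component S 0 = \<zero>\<^bsub>S\<^esub>" "component S 1 = \<one>\<^bsub>S\<^esub>"
    "component S (x + y) = component S x \<oplus>\<^bsub>S\<^esub> component S y"
    "component S (x * y) = component S x \<otimes>\<^bsub>S\<^esub> component S y"
    "component S (- x) = \<ominus>\<^bsub>S\<^esub> component S x"
  using assms by (transfer, auto)+

lemma component_surj: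
  assumes "cring S" "a \<in> carrier S"
  shows "\<exists>x. component S x = a"
proof -
  define p where "p = (0 :: int, \<lambda>T. if cring T then if T = S then a else \<zero>\<^bsub>T\<^esub> else undefined)"
  have "p \<in> {p. \<forall>S. if cring S then snd p S \<in> carrier S else snd p S = undefined}"
    using assms by (auto simp: p_def cring.cring_simprules)
  then have "component S (Abs_universal_ring p) = snd p S"
    by (simp add: component.rep_eq Abs_universal_ring_inverse)
  then show ?thesis using assms by (auto simp: p_def)
qed

text \<open>The components of the product are indexed by plain ring records, so extra fields of a record
  are cut off.\<close>

lemma truncate_sel:
  "carrier (ring.truncate L) = carrier L" "monoid.mult (ring.truncate L) = monoid.mult L"
  "monoid.one (ring.truncate L) = monoid.one L" "ring.zero (ring.truncate L) = ring.zero L"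
  "ring.add (ring.truncate L) = ring.add L"
  by (simp_all add: ring.truncate_def)

lemma truncate_cring:
  assumes "cring L"
  shows "cring (ring.truncate L)"
proof -
  interpret L: cring L by fact
  show ?thesis
    by (intro cringI abelian_groupI comm_monoidI)
      (auto simp: truncate_sel L.a_ac L.m_ac L.l_distr L.r_distr intro: L.l_neg)
qed

context field
begin

definition pr :: "'a universal_ring \<Rightarrow> 'a" where "pr = component (ring.truncate R)"

lemma pr_simps:
  "pr x \<in> carrier R" "pr 0 = \<zero>" "pr 1 = \<one>" "pr (x + y) = pr x \<oplus> pr y" "pr (x * y) = pr x \<otimes> pr y"
  using component_simps[OF truncate_cring[OF cring_axioms]] unfolding pr_def truncate_sel by auto

lemma pr_uminus: "pr (- x) = \<ominus> pr x"
proof -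
  have "pr x \<oplus> pr (- x) = \<zero>" using pr_simps(4)[of x "- x"] pr_simps(2) by simp
  then show ?thesis using pr_simps(1) by (metis minus_equality a_comm)
qed

lemma pr_diff: "pr (x - y) = pr x \<ominus> pr y"
  using pr_simps(4)[of x "- y"] by (simp add: pr_uminus a_minus_def)

lemma pr_surj: "a \<in> carrier R \<Longrightarrow> \<exists>x. pr x = a"
  using component_surj[OF truncate_cring[OF cring_axioms], of a] by (simp add: pr_def truncate_sel)

lemma pr_power: "pr (x ^ n) = pr x [^] n"
  by (induction n) (auto simp: pr_simps nat_pow_mult m_comm)

text \<open>Zero is lifted to 0 itself, so that families with finite support have lifts with finite
  support.\<close>

definition lift :: "'a \<Rightarrow> 'a universal_ring" where
  "lift a = (if a = \<zero> then 0 else SOME x. pr x = a)"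

lemma pr_lift: "a \<in> carrier R \<Longrightarrow> pr (lift a) = a"
  unfolding lift_def using someI_ex[OF pr_surj[of a]] by (simp add: pr_simps)

lemma lift_zero [simp]: "lift \<zero> = 0"
  by (simp add: lift_def)

definition vanishing :: "'a universal_ring set" where "vanishing = {x. pr x = \<zero>}"

lemma vanishing_iff: "x \<in> vanishing \<longleftrightarrow> pr x = \<zero>"
  by (simp add: vanishing_def)

sublocale quot: residue_field vanishing
proof
  fix x assume "x \<notin> vanishing"
  then have x: "pr x \<in> carrier R - {\<zero>}" by (simp add: vanishing_def pr_simps)
  then have i: "inv (pr x) \<in> carrier R" "pr x \<otimes> inv (pr x) = \<one>" using field_Units by auto
  then have "pr (x * lift (inv (pr x)) - 1) = \<zero>"
    by (simp add: pr_diff pr_simps pr_lift a_minus_def r_neg)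
  then show "\<exists>y. x * y - 1 \<in> vanishing" by (auto simp: vanishing_def)
qed (auto simp: vanishing_def pr_simps)

lemma eqv_iff: "quot.eqv x y \<longleftrightarrow> pr x = pr y"
proof -
  have "pr x = pr x \<ominus> pr y \<oplus> pr y"
    by (simp add: a_minus_def a_assoc l_neg pr_simps)
  moreover have "quot.eqv x y \<longleftrightarrow> pr (x - y) = \<zero>"
    unfolding quot.eqv_def by (simp add: vanishing_def)
  ultimately show ?thesis
    by (auto simp: pr_diff pr_simps a_minus_def r_neg)
qed

end

section \<open>The domain inside the algebraic closure\<close>

text \<open>Factorizations exist because the domain is Noetherian; primeness makes them unique.\<close>

lemma (in noetherian_domain) factorial_if_irreducible_prime:
  assumes "\<And>p. p \<in> carrier (mult_of R) \<Longrightarrow> irreducible (mult_of R) p \<Longrightarrow> prime (mult_of R) p"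
  shows "factorial_domain R"
proof -
  interpret M: primeness_condition_monoid "mult_of R"
    using assms mult_of.comm_monoid_cancel_axioms
    by (simp add: primeness_condition_monoid_def primeness_condition_monoid_axioms_def)
  have "factorial_monoid (mult_of R)"
  proof (rule mult_of.factorial_monoidI)
    fix a assume a: "a \<in> carrier (mult_of R)"
    show "\<exists>fs. set fs \<subseteq> carrier (mult_of R) \<and> wfactors (mult_of R) fs a" if "a \<notin> Units (mult_of R)"
      using factorization_property[of a] a that by simp
  next
    fix a fs fs'
    assume "a \<in> carrier (mult_of R)" "set fs \<subseteq> carrier (mult_of R)" "set fs' \<subseteq> carrier (mult_of R)"
      "wfactors (mult_of R) fs a" "wfactors (mult_of R) fs' a"
    then show "essentially_equal (mult_of R) fs fs'" using M.wfactors_unique by blast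
  qed
  then show ?thesis by (simp add: factorial_domain_def domain_axioms)
qed

locale fraction_closure = R?: noetherian_domain R + L?: algebraic_closure L "fraction_field L (\<phi> ` carrier R)"
  for R :: "('a, 'b) ring_scheme" and L :: "('c, 'd) ring_scheme" and \<phi> :: "'a \<Rightarrow> 'c" +
  assumes phi_hom: "\<phi> \<in> ring_hom R L" and phi_inj: "inj_on \<phi> (carrier R)"
begin

sublocale phi: ring_hom_ring R L \<phi>
  by (rule ring_hom_ringI2[OF R.ring_axioms L.ring_axioms phi_hom])

text \<open>The preimage of \<open>R\<close> in the universal ring. Being closed under congruence modulo the
  vanishing elements, it represents the subring \<open>\<phi> ` carrier R\<close> of \<open>L\<close>.\<close>

definition A :: "'c universal_ring set" where "A = {x. L.pr x \<in> \<phi> ` carrier R}"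

lemma A_iff: "x \<in> A \<longleftrightarrow> L.pr x \<in> \<phi> ` carrier R"
  by (simp add: A_def)

lemma phi_eq_iff: "a \<in> carrier R \<Longrightarrow> b \<in> carrier R \<Longrightarrow> \<phi> a = \<phi> b \<longleftrightarrow> a = b"
  using phi_inj by (auto dest: inj_onD)

lemma pr_lift_phi: "a \<in> carrier R \<Longrightarrow> L.pr (L.lift (\<phi> a)) = \<phi> a"
  by (simp add: L.pr_lift)

lemma lift_phi_in_A: "a \<in> carrier R \<Longrightarrow> L.lift (\<phi> a) \<in> A"
  by (simp add: A_iff pr_lift_phi)

lemma A_cases:
  assumes "x \<in> A"
  obtains a where "a \<in> carrier R" "L.pr x = \<phi> a" "L.quot.eqv x (L.lift (\<phi> a))"
  using assms unfolding A_iff L.eqv_iff by (auto simp: pr_lift_phi)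

lemma A_subr: "L.quot.subr A"
  unfolding L.quot.subr_def
proof (intro conjI ballI)
  show "L.vanishing \<subseteq> A" by (auto simp: L.vanishing_iff A_iff intro!: image_eqI[of _ _ "\<zero>\<^bsub>R\<^esub>"])
  show "1 \<in> A" by (auto simp: A_iff L.pr_simps intro!: image_eqI[of _ _ "\<one>\<^bsub>R\<^esub>"])
  fix x assume "x \<in> A"
  then obtain a where a: "a \<in> carrier R" "L.pr x = \<phi> a" by (auto simp: A_iff)
  show "- x \<in> A" using a by (auto simp: A_iff L.pr_uminus intro!: image_eqI[of _ _ "\<ominus>\<^bsub>R\<^esub> a"])
  fix y assume "y \<in> A"
  then obtain b where b: "b \<in> carrier R" "L.pr y = \<phi> b" by (auto simp: A_iff)
  show "x + y \<in> A" using a b by (auto simp: A_iff L.pr_simps intro!: image_eqI[of _ _ "a \<oplus>\<^bsub>R\<^esub> b"])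
  show "x * y \<in> A" using a b by (auto simp: A_iff L.pr_simps intro!: image_eqI[of _ _ "a \<otimes>\<^bsub>R\<^esub> b"])
qed

text \<open>Such a set \<open>J\<close> is the preimage of the image of an ideal \<open>I\<close> of \<open>R\<close>, which has finitely many
  generators.\<close>

lemma A_fg:
  assumes J: "J \<subseteq> A" "L.vanishing \<subseteq> J" "\<And>x y. x \<in> J \<Longrightarrow> y \<in> J \<Longrightarrow> x + y \<in> J"
    "\<And>a x. a \<in> A \<Longrightarrow> x \<in> J \<Longrightarrow> a * x \<in> J"
  shows "\<exists>n y. (\<forall>k<n::nat. y k \<in> J) \<and> (\<forall>x\<in>J. \<exists>a. (\<forall>k<n. a k \<in> A) \<and> L.quot.eqv x (\<Sum>k<n. a k * y k))"
proof -
  note S = L.quot.subrD[OF A_subr]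
  have J_cong: "y \<in> J" if "x \<in> J" "L.pr y = L.pr x" for x y
  proof -
    have "y - x \<in> L.vanishing" using that(2) L.eqv_iff[of y x] by (simp add: L.quot.eqv_def)
    then have "x + (y - x) \<in> J" using J(2,3) that(1) by blast
    then show ?thesis by simp
  qed
  define I where "I = {r \<in> carrier R. L.lift (\<phi> r) \<in> J}"
  have I_iff: "r \<in> I \<longleftrightarrow> x \<in> J" if "r \<in> carrier R" "L.pr x = \<phi> r" for r x
    using that J_cong[of x "L.lift (\<phi> r)"] J_cong[of "L.lift (\<phi> r)" x] by (auto simp: I_def pr_lift_phi)
  have lin: "ideal T R"
    if T: "T \<subseteq> carrier R" and zero: "\<zero>\<^bsub>R\<^esub> \<in> T" and add: "\<And>a b. a \<in> T \<Longrightarrow> b \<in> T \<Longrightarrow> a \<oplus>\<^bsub>R\<^esub> b \<in> T"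
      and mult: "\<And>a b. a \<in> carrier R \<Longrightarrow> b \<in> T \<Longrightarrow> a \<otimes>\<^bsub>R\<^esub> b \<in> T" for T
  proof (rule idealI[OF R.ring_axioms])
    have "\<ominus>\<^bsub>R\<^esub> a \<in> T" if "a \<in> T" for a
      using mult[of "\<ominus>\<^bsub>R\<^esub> \<one>\<^bsub>R\<^esub>" a] that T by (auto simp: R.l_minus)
    then show "subgroup T (add_monoid R)"
      using T zero add by (intro R.add.subgroupI) (auto simp: a_inv_def)
    show "b \<otimes>\<^bsub>R\<^esub> a \<in> T" "a \<otimes>\<^bsub>R\<^esub> b \<in> T" if "a \<in> T" "b \<in> carrier R" for a b
      using mult[OF that(2,1)] that T R.m_comm[of a b] by auto
  qed
  have "ideal I R"
  proof (rule lin)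
    show "I \<subseteq> carrier R" by (auto simp: I_def)
    show "\<zero>\<^bsub>R\<^esub> \<in> I" using J(2) by (auto simp: I_def L.vanishing_iff L.pr_simps)
    fix a b assume b: "b \<in> I"
    then have b': "b \<in> carrier R" "L.lift (\<phi> b) \<in> J" by (auto simp: I_def)
    show "a \<oplus>\<^bsub>R\<^esub> b \<in> I" if "a \<in> I"
    proof -
      have a': "a \<in> carrier R" "L.lift (\<phi> a) \<in> J" using that by (auto simp: I_def)
      show ?thesis
        using J(3)[OF a'(2) b'(2)] I_iff[of "a \<oplus>\<^bsub>R\<^esub> b" "L.lift (\<phi> a) + L.lift (\<phi> b)"] a' b'
        by (auto simp: L.pr_simps pr_lift_phi)
    qed
    show "a \<otimes>\<^bsub>R\<^esub> b \<in> I" if a: "a \<in> carrier R"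
      using J(4)[OF lift_phi_in_A[OF a] b'(2)] I_iff[of "a \<otimes>\<^bsub>R\<^esub> b" "L.lift (\<phi> a) * L.lift (\<phi> b)"] a b'
      by (auto simp: L.pr_simps pr_lift_phi)
  qed
  then obtain G where G: "G \<subseteq> carrier R" "finite G" "I = Idl\<^bsub>R\<^esub> G" using R.finetely_gen by blast
  obtain n :: nat and g where g: "G = g ` {..<n}"
    using finite_imp_nat_seg_image_inj_on[OF G(2)] by (auto simp: lessThan_def)
  define y where "y = (\<lambda>k. L.lift (\<phi> (g k)))"
  define T where "T = {r \<in> carrier R. \<exists>a. (\<forall>k<n. a k \<in> A) \<and> \<phi> r = L.pr (\<Sum>k<n. a k * y k)}"
  have gR: "g k \<in> carrier R" if "k < n" for k using G(1) g that by auto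
  have yJ: "y k \<in> J" if "k < n" for k
  proof -
    have "g k \<in> I" using R.genideal_self[OF G(1)] G(3) g that by auto
    then show ?thesis by (simp add: I_def y_def)
  qed
  have "ideal T R"
  proof (rule lin)
    show "T \<subseteq> carrier R" by (auto simp: T_def)
    show "\<zero>\<^bsub>R\<^esub> \<in> T" using S(1) by (auto simp: T_def L.pr_simps intro!: exI[of _ "\<lambda>_. 0"])
    fix a b assume "b \<in> T"
    then obtain d where b: "b \<in> carrier R" "\<forall>k<n. d k \<in> A" "\<phi> b = L.pr (\<Sum>k<n. d k * y k)" by (auto simp: T_def)
    show "a \<oplus>\<^bsub>R\<^esub> b \<in> T" if "a \<in> T"
    proof -
      obtain c where a: "a \<in> carrier R" "\<forall>k<n. c k \<in> A" "\<phi> a = L.pr (\<Sum>k<n. c k * y k)"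
        using \<open>a \<in> T\<close> by (auto simp: T_def)
      have "\<phi> (a \<oplus>\<^bsub>R\<^esub> b) = L.pr (\<Sum>k<n. (c k + d k) * y k)"
        using a b by (simp add: distrib_right sum.distrib L.pr_simps)
      moreover have "\<forall>k<n. c k + d k \<in> A" using a b S(4) by auto
      ultimately show ?thesis using a b unfolding T_def by (auto intro!: exI[of _ "\<lambda>k. c k + d k"])
    qed
    show "a \<otimes>\<^bsub>R\<^esub> b \<in> T" if a: "a \<in> carrier R"
    proof -
      have "\<phi> (a \<otimes>\<^bsub>R\<^esub> b) = L.pr (L.lift (\<phi> a) * (\<Sum>k<n. d k * y k))"
        using a b by (simp add: L.pr_simps(5) pr_lift_phi)
      also have "\<dots> = L.pr (\<Sum>k<n. (L.lift (\<phi> a) * d k) * y k)"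
        by (simp add: sum_distrib_left mult.assoc)
      finally have "\<phi> (a \<otimes>\<^bsub>R\<^esub> b) = L.pr (\<Sum>k<n. (L.lift (\<phi> a) * d k) * y k)" .
      moreover have "\<forall>k<n. L.lift (\<phi> a) * d k \<in> A" using S(5)[OF lift_phi_in_A[OF a]] b by auto
      ultimately show ?thesis using a b unfolding T_def by (auto intro!: exI[of _ "\<lambda>k. L.lift (\<phi> a) * d k"])
    qed
  qed
  moreover have "G \<subseteq> T"
  proof
    fix r assume "r \<in> G"
    then obtain k where k: "k < n" "r = g k" using g by auto
    have "(\<Sum>l<n. (if l = k then 1 else 0) * y l) = y k"
      using k(1) by (simp add: if_distrib[of "\<lambda>x. x * _"] cong: if_cong)
    then have "\<phi> r = L.pr (\<Sum>l<n. (if l = k then 1 else 0) * y l)"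
      using k gR by (simp add: y_def pr_lift_phi)
    then show "r \<in> T" using k gR S(1,2) by (auto simp: T_def intro!: exI[of _ "\<lambda>l. if l = k then 1 else 0"])
  qed
  ultimately have IT: "I \<subseteq> T" using R.genideal_minimal G(3) by blast
  have "\<exists>a. (\<forall>k<n. a k \<in> A) \<and> L.quot.eqv x (\<Sum>k<n. a k * y k)" if xJ: "x \<in> J" for x
  proof -
    obtain r where r: "r \<in> carrier R" "L.pr x = \<phi> r" using subsetD[OF J(1) xJ] by (auto simp: A_iff)
    then have "r \<in> T" using I_iff xJ IT by blast
    then show ?thesis using r by (auto simp: T_def L.eqv_iff)
  qed
  then show ?thesis using yJ by blast
qed

sublocale D: noetherian_subdomain L.vanishing A
  by unfold_locales (fact A_subr, rule A_fg)

lemma K_iff: "x \<in> D.loc L.vanishing \<longleftrightarrow> L.pr x \<in> fraction_field L (\<phi> ` carrier R)"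
proof
  assume "x \<in> D.loc L.vanishing"
  then obtain s where s: "L.pr s \<in> \<phi> ` carrier R" "L.pr s \<noteq> \<zero>\<^bsub>L\<^esub>" "L.pr s \<otimes>\<^bsub>L\<^esub> L.pr x \<in> \<phi> ` carrier R"
    by (auto simp: D.loc_def A_iff L.vanishing_iff L.pr_simps)
  have "L.pr s \<in> Units L" using s(2) L.pr_simps(1) L.field_Units by auto
  then have "L.pr x = (L.pr s \<otimes>\<^bsub>L\<^esub> L.pr x) \<otimes>\<^bsub>L\<^esub> inv\<^bsub>L\<^esub> L.pr s"
    using L.pr_simps(1) by (simp add: L.m_comm[of "L.pr s"] L.m_assoc)
  then show "L.pr x \<in> fraction_field L (\<phi> ` carrier R)"
    using s unfolding fraction_field_def by blast
next
  assume "L.pr x \<in> fraction_field L (\<phi> ` carrier R)"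
  then obtain a b where ab: "a \<in> carrier R" "b \<in> carrier R" "\<phi> b \<noteq> \<zero>\<^bsub>L\<^esub>" "L.pr x = \<phi> a \<otimes>\<^bsub>L\<^esub> inv\<^bsub>L\<^esub> \<phi> b"
    by (auto simp: fraction_field_def)
  have "\<phi> b \<in> Units L" using ab L.field_Units by auto
  then have "\<phi> b \<otimes>\<^bsub>L\<^esub> L.pr x = \<phi> a"
    using ab by (simp add: L.m_lcomm[of "\<phi> b"])
  then have "L.lift (\<phi> b) * x \<in> A" "L.lift (\<phi> b) \<notin> L.vanishing"
    using ab by (auto simp: A_iff L.pr_simps pr_lift_phi L.vanishing_iff)
  then show "x \<in> D.loc L.vanishing" using lift_phi_in_A[OF ab(2)] by (auto simp: D.loc_def)
qed

lemma pr_image_preimage: "S \<subseteq> carrier L \<Longrightarrow> L.pr ` {x. L.pr x \<in> S} = S"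
  using L.pr_surj by (auto simp: image_iff)

lemma fraction_field_carrier: "fraction_field L (\<phi> ` carrier R) \<subseteq> carrier L"
  using L.subfield_axioms subfieldE(3) by blast

lemma inverse_ideal_carrier: "inverse_ideal L (\<phi> ` carrier R) I \<subseteq> carrier L"
  using fraction_field_carrier by (auto simp: inverse_ideal_def)

lemma dual_iff: "x \<in> D.dual J \<longleftrightarrow> L.pr x \<in> inverse_ideal L (\<phi> ` carrier R) (L.pr ` J)"
  unfolding D.dual_def inverse_ideal_def by (auto simp: K_iff A_iff L.pr_simps)

lemma inverse_ideal_pr: "inverse_ideal L (\<phi> ` carrier R) (L.pr ` J) = L.pr ` D.dual J"
  using pr_image_preimage[OF inverse_ideal_carrier] dual_iff by (metis (no_types, lifting) Collect_cong Collect_mem_eq)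

lemma divisorial_hull_pr: "divisorial_hull L (\<phi> ` carrier R) (L.pr ` J) = L.pr ` D.dual (D.dual J)"
  unfolding divisorial_hull_def inverse_ideal_pr ..

lemma divisorial_pr:
  assumes J: "D.divisorial J"
  shows "divisorial_ideal L (\<phi> ` carrier R) (L.pr ` J)"
  unfolding divisorial_ideal_def fractional_ideal_def
proof (intro conjI)
  have JK: "J \<subseteq> D.loc L.vanishing" and Jl: "D.ideal_like J" and Jd: "D.dual (D.dual J) = J"
    using J by (auto simp: D.divisorial_def)
  show "L.pr ` J \<subseteq> fraction_field L (\<phi> ` carrier R)" using JK K_iff by auto
  show "L.pr ` J \<noteq> {\<zero>\<^bsub>L\<^esub>}" using J by (auto simp: D.divisorial_def L.vanishing_iff)
  show "divisorial_hull L (\<phi> ` carrier R) (L.pr ` J) = L.pr ` J" by (simp add: divisorial_hull_pr Jd)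
  have um: "- x \<in> J" if "x \<in> J" for x
  proof -
    have "(-1) * x \<in> J"
      using Jl that L.quot.subrD(6)[OF A_subr L.quot.subrD(2)[OF A_subr]] unfolding D.ideal_like_def by blast
    then show ?thesis by simp
  qed
  have "0 \<in> J" using Jl L.quot.Z_zero by (auto simp: D.ideal_like_def)
  show "subgroup (L.pr ` J) (add_monoid L)"
  proof (rule L.add.subgroupI)
    show "L.pr ` J \<subseteq> carrier L" by (auto simp: L.pr_simps)
    show "L.pr ` J \<noteq> {}" using \<open>0 \<in> J\<close> by blast
    show "\<ominus>\<^bsub>L\<^esub> a \<in> L.pr ` J" if "a \<in> L.pr ` J" for a
      using that um by (auto simp flip: L.pr_uminus)
    show "a \<oplus>\<^bsub>L\<^esub> b \<in> L.pr ` J" if "a \<in> L.pr ` J" "b \<in> L.pr ` J" for a b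
      using that Jl by (auto simp: D.ideal_like_def simp flip: L.pr_simps(4))
  qed
  show "\<forall>a\<in>\<phi> ` carrier R. \<forall>x\<in>L.pr ` J. a \<otimes>\<^bsub>L\<^esub> x \<in> L.pr ` J"
  proof (intro ballI)
    fix a x assume "a \<in> \<phi> ` carrier R" "x \<in> L.pr ` J"
    then obtain r y where "r \<in> carrier R" "a = \<phi> r" "y \<in> J" "x = L.pr y" by auto
    then have "a \<otimes>\<^bsub>L\<^esub> x = L.pr (L.lift (\<phi> r) * y)" "L.lift (\<phi> r) * y \<in> J"
      using Jl lift_phi_in_A by (auto simp: L.pr_simps pr_lift_phi D.ideal_like_def)
    then show "a \<otimes>\<^bsub>L\<^esub> x \<in> L.pr ` J" by simp
  qed
  obtain d where "d \<in> A" "d \<notin> L.vanishing" "\<forall>x\<in>J. d * x \<in> A" using J unfolding D.divisorial_def by blast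
  then show "\<exists>d\<in>\<phi> ` carrier R. d \<noteq> \<zero>\<^bsub>L\<^esub> \<and> (\<forall>x\<in>L.pr ` J. d \<otimes>\<^bsub>L\<^esub> x \<in> \<phi> ` carrier R)"
    by (intro bexI[of _ "L.pr d"]) (auto simp: A_iff L.vanishing_iff simp flip: L.pr_simps(5))
qed

lemma ideal_power_carrier: "I \<subseteq> carrier L \<Longrightarrow> ideal_power L (\<phi> ` carrier R) I n \<subseteq> carrier L"
proof (induction n)
  case 0
  then show ?case by auto
next
  case (Suc n)
  have "x \<in> carrier L" if "x \<in> ideal_prod L (ideal_power L (\<phi> ` carrier R) I n) I" for x
    using that by (induction rule: ideal_prod.induct) (use Suc in auto)
  then show ?case by auto
qed

text \<open>Dividing \<open>n\<close> times by \<open>J\<close> is the same as dividing by the \<open>n\<close>-th power.\<close>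

lemma dual_power_iff:
  assumes JK: "J \<subseteq> D.loc L.vanishing"
  shows "x \<in> D.dual_power J n \<longleftrightarrow> L.pr x \<in> inverse_ideal L (\<phi> ` carrier R) (ideal_power L (\<phi> ` carrier R) (L.pr ` J) n)"
proof (induction n arbitrary: x)
  case 0
  have "L.pr x \<otimes>\<^bsub>L\<^esub> \<one>\<^bsub>L\<^esub> \<in> \<phi> ` carrier R \<Longrightarrow> x \<in> A" using L.pr_simps(1) by (simp add: A_iff)
  moreover have "\<one>\<^bsub>L\<^esub> \<in> \<phi> ` carrier R" by (rule image_eqI[of _ _ "\<one>\<^bsub>R\<^esub>"]) auto
  moreover have "L.pr x \<otimes>\<^bsub>L\<^esub> b \<in> \<phi> ` carrier R" if "x \<in> A" "b \<in> \<phi> ` carrier R" for b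
  proof -
    obtain r s where "r \<in> carrier R" "L.pr x = \<phi> r" "s \<in> carrier R" "b = \<phi> s"
      using \<open>x \<in> A\<close> \<open>b \<in> \<phi> ` carrier R\<close> by (auto simp: A_iff)
    then show ?thesis by (intro image_eqI[of _ _ "r \<otimes>\<^bsub>R\<^esub> s"]) auto
  qed
  moreover have "x \<in> A \<Longrightarrow> L.pr x \<in> fraction_field L (\<phi> ` carrier R)" using D.A_subset_K K_iff by blast
  ultimately have "x \<in> A \<longleftrightarrow> L.pr x \<in> inverse_ideal L (\<phi> ` carrier R) (\<phi> ` carrier R)"
    unfolding inverse_ideal_def by blast
  then show ?case by simp
next
  case (Suc n)
  let ?P = "ideal_power L (\<phi> ` carrier R) (L.pr ` J) n"
  have PL: "?P \<subseteq> carrier L" by (rule ideal_power_carrier) (auto simp: L.pr_simps)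
  show ?case
  proof
    assume x: "x \<in> D.dual_power J (Suc n)"
    have "L.pr x \<otimes>\<^bsub>L\<^esub> y \<in> \<phi> ` carrier R" if "y \<in> ideal_prod L ?P (L.pr ` J)" for y
      using that
    proof (induction rule: ideal_prod.induct)
      case (prod i j)
      then obtain z where z: "z \<in> J" "j = L.pr z" by auto
      have "x * z \<in> D.dual_power J n" using x z by simp
      then have "L.pr (x * z) \<otimes>\<^bsub>L\<^esub> i \<in> \<phi> ` carrier R" using Suc.IH[of "x * z"] prod(1) unfolding inverse_ideal_def by blast
      moreover have "L.pr (x * z) \<otimes>\<^bsub>L\<^esub> i = L.pr x \<otimes>\<^bsub>L\<^esub> (i \<otimes>\<^bsub>L\<^esub> j)"
        using L.pr_simps(1)[of x] L.pr_simps(1)[of z] prod PL by (simp add: L.pr_simps(5) z L.m_ac subset_iff)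
      ultimately show ?case by simp
    next
      case (sum s1 s2)
      have "s \<in> carrier L" if "s \<in> ideal_prod L ?P (L.pr ` J)" for s
        using that by (induction rule: ideal_prod.induct) (use PL L.pr_simps(1) in auto)
      then have "L.pr x \<otimes>\<^bsub>L\<^esub> (s1 \<oplus>\<^bsub>L\<^esub> s2) = L.pr x \<otimes>\<^bsub>L\<^esub> s1 \<oplus>\<^bsub>L\<^esub> L.pr x \<otimes>\<^bsub>L\<^esub> s2"
        using sum L.pr_simps(1) by (simp add: L.r_distr)
      moreover have "\<phi> r \<oplus>\<^bsub>L\<^esub> \<phi> s \<in> \<phi> ` carrier R" if "r \<in> carrier R" "s \<in> carrier R" for r s
        using that by (intro image_eqI[of _ _ "r \<oplus>\<^bsub>R\<^esub> s"]) auto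
      ultimately show ?case using sum.IH by auto
    qed
    moreover have "L.pr x \<in> fraction_field L (\<phi> ` carrier R)" using x K_iff by simp
    ultimately show "L.pr x \<in> inverse_ideal L (\<phi> ` carrier R) (ideal_power L (\<phi> ` carrier R) (L.pr ` J) (Suc n))"
      by (simp add: inverse_ideal_def)
  next
    assume x: "L.pr x \<in> inverse_ideal L (\<phi> ` carrier R) (ideal_power L (\<phi> ` carrier R) (L.pr ` J) (Suc n))"
    then have xK: "x \<in> D.loc L.vanishing" using K_iff by (simp add: inverse_ideal_def)
    have "x * z \<in> D.dual_power J n" if z: "z \<in> J" for z
      unfolding Suc.IH inverse_ideal_def
    proof (intro CollectI conjI ballI)
      show "L.pr (x * z) \<in> fraction_field L (\<phi> ` carrier R)"
        unfolding K_iff[symmetric] using xK z JK L.quot.subrD(5)[OF D.K_subr] by blast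
      fix i assume i: "i \<in> ?P"
      have "i \<otimes>\<^bsub>L\<^esub> L.pr z \<in> ideal_prod L ?P (L.pr ` J)" using i z by (intro ideal_prod.prod) auto
      then have "L.pr x \<otimes>\<^bsub>L\<^esub> (i \<otimes>\<^bsub>L\<^esub> L.pr z) \<in> \<phi> ` carrier R" using x by (auto simp: inverse_ideal_def)
      moreover have "L.pr (x * z) \<otimes>\<^bsub>L\<^esub> i = L.pr x \<otimes>\<^bsub>L\<^esub> (i \<otimes>\<^bsub>L\<^esub> L.pr z)"
        using L.pr_simps(1)[of x] L.pr_simps(1)[of z] i PL by (simp add: L.pr_simps(5) L.m_ac subset_iff)
      ultimately show "L.pr (x * z) \<otimes>\<^bsub>L\<^esub> i \<in> \<phi> ` carrier R" by simp
    qed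
    then show "x \<in> D.dual_power J (Suc n)" using xK by simp
  qed
qed

lemma torsion_classes:
  assumes "torsion_class_group L (\<phi> ` carrier R)"
  shows "D.torsion_classes"
  unfolding D.torsion_classes_def
proof (intro allI impI)
  fix J assume J: "D.divisorial J"
  then have JK: "J \<subseteq> D.loc L.vanishing" by (simp add: D.divisorial_def)
  let ?ip = "ideal_power L (\<phi> ` carrier R) (L.pr ` J)"
  obtain n x where n: "n \<ge> 1" and x: "x \<in> fraction_field L (\<phi> ` carrier R)" "x \<noteq> \<zero>\<^bsub>L\<^esub>"
    and hull: "divisorial_hull L (\<phi> ` carrier R) (?ip n) = (\<lambda>a. a \<otimes>\<^bsub>L\<^esub> x) ` \<phi> ` carrier R"
    using assms divisorial_pr[OF J] unfolding torsion_class_group_def principal_fractional_ideal_def by blast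
  have xL: "x \<in> carrier L" using x fraction_field_carrier by blast
  have "inverse_ideal L (\<phi> ` carrier R) (?ip n) = L.pr ` D.dual_power J n"
    using pr_image_preimage[OF inverse_ideal_carrier] dual_power_iff[OF JK]
    by (metis (no_types, lifting) Collect_cong Collect_mem_eq)
  then have dd: "y \<in> D.dual (D.dual_power J n) \<longleftrightarrow> L.pr y \<in> divisorial_hull L (\<phi> ` carrier R) (?ip n)" for y
    by (simp add: dual_iff divisorial_hull_def)
  let ?f = "L.lift x"
  have f: "L.pr ?f = x" using L.pr_lift xL by blast
  have "D.dual (D.dual_power J n) = {y. \<exists>a\<in>A. L.quot.eqv y (a * ?f)}"
  proof (intro subset_antisym subsetI)
    fix y assume "y \<in> D.dual (D.dual_power J n)"
    then obtain r where "r \<in> carrier R" "L.pr y = \<phi> r \<otimes>\<^bsub>L\<^esub> x" using dd hull by auto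
    then show "y \<in> {y. \<exists>a\<in>A. L.quot.eqv y (a * ?f)}"
      using lift_phi_in_A by (auto simp: L.eqv_iff L.pr_simps f pr_lift_phi intro!: bexI[of _ "L.lift (\<phi> r)"])
  next
    fix y assume "y \<in> {y. \<exists>a\<in>A. L.quot.eqv y (a * ?f)}"
    then show "y \<in> D.dual (D.dual_power J n)"
      unfolding dd hull by (auto simp: L.eqv_iff L.pr_simps f A_iff)
  qed
  moreover have "?f \<in> D.loc L.vanishing" "?f \<notin> L.vanishing"
    using x f K_iff by (auto simp: L.vanishing_iff)
  ultimately show "\<exists>n\<ge>1. \<exists>f\<in>D.loc L.vanishing. f \<notin> L.vanishing \<and>
      D.dual (D.dual_power J n) = {x. \<exists>a\<in>A. L.quot.eqv x (a * f)}"
    using n by blast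
qed

end

text \<open>Noetherianity provides a maximal element among the proper ideals that contain \<open>r\<close>.\<close>

lemma (in noetherian_domain) nonunit_in_maximalideal:
  assumes "r \<in> carrier R" "r \<notin> Units R"
  shows "\<exists>M. maximalideal M R \<and> r \<in> M"
proof -
  let ?S = "{I. ideal I R \<and> \<one> \<notin> I \<and> r \<in> I}"
  have "PIdl r \<in> ?S"
    using cgenideal_ideal[OF assms(1)] cgenideal_self[OF assms(1)] ideal_eq_carrier_iff[OF assms(1)] assms(2)
      ideal.one_imp_carrier[of "PIdl r" R] by auto
  then have "?S \<noteq> {}" by blast
  then have "\<exists>M\<in>?S. \<forall>J\<in>?S. M \<subseteq> J \<longrightarrow> J = M"
  proof (rule subset_Zorn_nonempty)
    fix C assume C: "C \<noteq> {}" "subset.chain ?S C"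
    then have "subset.chain {I. ideal I R} C" by (auto simp: subset.chain_def)
    then have "\<Union>C \<in> C" using ideal_chain_is_trivial C(1) by blast
    then show "\<Union>C \<in> ?S" using C(2) by (auto simp: subset.chain_def)
  qed
  then obtain M where M: "ideal M R" "\<one> \<notin> M" "r \<in> M" and max: "\<forall>J\<in>?S. M \<subseteq> J \<longrightarrow> J = M"
    by auto
  have "maximalideal M R"
  proof (rule maximalidealI[OF M(1)])
    show "carrier R \<noteq> M" using M(2) by auto
    fix J assume J: "ideal J R" "M \<subseteq> J" "J \<subseteq> carrier R"
    show "J = M \<or> J = carrier R"
    proof (cases "\<one> \<in> J")
      case True
      then show ?thesis using ideal.one_imp_carrier[OF J(1)] by blast
    next
      case False
      then show ?thesis using max J M(3) by blast
    qed
  qed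
  then show ?thesis using M(3) by blast
qed

context fraction_closure
begin

text \<open>The coefficient lists start with the leading coefficient, so that of \<open>x\<^sup>k\<close> is at position
  \<open>length p - 1 - k\<close>.\<close>

lemma pr_eval:
  assumes "set p \<subseteq> carrier L"
  shows "L.pr (\<Sum>k<length p. L.lift (p ! (length p - 1 - k)) * x ^ k) = L.eval p (L.pr x)"
  using assms
proof (induction p)
  case Nil
  then show ?case by (simp add: L.pr_simps)
next
  case (Cons a p)
  have "(\<Sum>k<length p. L.lift ((a # p) ! (length (a # p) - 1 - k)) * x ^ k) =
      (\<Sum>k<length p. L.lift (p ! (length p - 1 - k)) * x ^ k)"
  proof (rule sum.cong[OF refl])
    fix k assume "k \<in> {..<length p}"
    then have "length p - k = Suc (length p - 1 - k)" by auto
    then have "(a # p) ! (length (a # p) - 1 - k) = p ! (length p - 1 - k)" by simp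
    then show "L.lift ((a # p) ! (length (a # p) - 1 - k)) * x ^ k = L.lift (p ! (length p - 1 - k)) * x ^ k" by simp
  qed
  then have "(\<Sum>k<length (a # p). L.lift ((a # p) ! (length (a # p) - 1 - k)) * x ^ k) =
      (\<Sum>k<length p. L.lift (p ! (length p - 1 - k)) * x ^ k) + L.lift a * x ^ length p"
    by simp
  moreover have "L.eval p (L.pr x) \<in> carrier L"
    using Cons.prems L.eval_in_carrier[of p "L.pr x"] L.pr_simps(1) by simp
  ultimately show ?case
    using Cons by (simp add: L.pr_simps L.pr_power L.pr_lift L.a_comm)
qed

lemma integral_iff: "D.integral A x \<longleftrightarrow> L.pr x \<in> integral_closure L (\<phi> ` carrier R)"
proof
  assume "D.integral A x"
  then obtain n c where c: "\<And>k. k < n \<Longrightarrow> c k \<in> A" "L.pr (x ^ n) = L.pr (\<Sum>k<n. c k * x ^ k)"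
    unfolding D.integral_def L.eqv_iff by blast
  define q where "q = map (\<lambda>i. L.pr (- c (n - 1 - i))) [0..<n]"
  have qL: "set q \<subseteq> \<phi> ` carrier R"
  proof
    fix a assume "a \<in> set q"
    then obtain i where i: "i < n" "a = L.pr (- c (n - 1 - i))" by (auto simp: q_def)
    then have "- c (n - 1 - i) \<in> A" using c(1) L.quot.subrD(6)[OF A_subr] by simp
    then show "a \<in> \<phi> ` carrier R" using i A_iff by simp
  qed
  let ?p = "\<one>\<^bsub>L\<^esub> # q"
  have one: "\<one>\<^bsub>L\<^esub> \<in> \<phi> ` carrier R" by (rule image_eqI[of _ _ "\<one>\<^bsub>R\<^esub>"]) auto
  have "?p \<in> carrier (univ_poly L (\<phi> ` carrier R))"
    using qL one by (simp add: univ_poly_def polynomial_def)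
  moreover have "L.eval ?p (L.pr x) = \<zero>\<^bsub>L\<^esub>"
  proof -
    have "set q \<subseteq> carrier L" using qL by auto
    from pr_eval[OF this, of x]
    have "L.eval q (L.pr x) = L.pr (\<Sum>k<n. L.lift (q ! (n - 1 - k)) * x ^ k)" by (simp add: q_def)
    also have "\<dots> = L.pr (\<Sum>k<n. (- c k) * x ^ k)"
    proof -
      have "L.quot.eqv (\<Sum>k<n. L.lift (q ! (n - 1 - k)) * x ^ k) (\<Sum>k<n. (- c k) * x ^ k)"
      proof (intro L.quot.eqv_sum L.quot.eqv_mult_right)
        fix k assume "k \<in> {..<n}"
        then have "q ! (n - 1 - k) = L.pr (- c k)" by (simp add: q_def)
        then show "L.quot.eqv (L.lift (q ! (n - 1 - k))) (- c k)"
          by (simp add: L.eqv_iff L.pr_lift L.pr_simps(1))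
      qed
      then show ?thesis by (simp add: L.eqv_iff)
    qed
    also have "\<dots> = L.pr (- (\<Sum>k<n. c k * x ^ k))" by (simp add: sum_negf)
    also have "\<dots> = \<ominus>\<^bsub>L\<^esub> L.pr (x ^ n)" by (simp add: L.pr_uminus c(2))
    finally show ?thesis
      using L.pr_simps(1) by (simp add: q_def L.pr_power L.r_neg)
  qed
  ultimately show "L.pr x \<in> integral_closure L (\<phi> ` carrier R)"
    using L.pr_simps(1) unfolding integral_closure_def integral_over_def by (auto intro!: bexI[of _ ?p])
next
  assume "L.pr x \<in> integral_closure L (\<phi> ` carrier R)"
  then obtain p where p: "p \<in> carrier (univ_poly L (\<phi> ` carrier R))" "p \<noteq> []" "hd p = \<one>\<^bsub>L\<^esub>"
    "L.eval p (L.pr x) = \<zero>\<^bsub>L\<^esub>"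
    by (auto simp: integral_closure_def integral_over_def)
  define q where "q = tl p"
  have pq: "p = \<one>\<^bsub>L\<^esub> # q" using p by (cases p) (auto simp: q_def)
  have qA: "set q \<subseteq> \<phi> ` carrier R" using p(1) by (simp add: pq univ_poly_def polynomial_def)
  then have qL: "set q \<subseteq> carrier L" by auto
  let ?n = "length q"
  define c where "c = (\<lambda>k. - L.lift (q ! (?n - 1 - k)))"
  have cA: "c k \<in> A" if "k < ?n" for k
  proof -
    have "q ! (?n - 1 - k) \<in> \<phi> ` carrier R" using qA that by (auto simp: subset_iff)
    then have "L.lift (q ! (?n - 1 - k)) \<in> A" using lift_phi_in_A by auto
    then show ?thesis unfolding c_def by (rule L.quot.subrD(6)[OF A_subr])
  qed
  have ev: "L.pr (x ^ ?n) \<oplus>\<^bsub>L\<^esub> L.eval q (L.pr x) = \<zero>\<^bsub>L\<^esub>"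
    using p(4) L.pr_simps(1) by (simp add: pq L.pr_power)
  have "L.pr (x ^ ?n + (\<Sum>k<?n. L.lift (q ! (?n - 1 - k)) * x ^ k)) = \<zero>\<^bsub>L\<^esub>"
    unfolding L.pr_simps(4) pr_eval[OF qL] by (rule ev)
  then have "L.quot.eqv (x ^ ?n) (\<Sum>k<?n. c k * x ^ k)"
    unfolding L.quot.eqv_def L.vanishing_iff by (simp add: c_def sum_negf)
  then show "D.integral A x" using cA unfolding D.integral_def by blast
qed

text \<open>A root of the polynomial \<open>X\<^sup>n - f\<close>.\<close>

lemma roots_exist:
  assumes f: "f \<in> D.loc L.vanishing" and n: "n \<ge> 1"
  shows "\<exists>\<alpha>. L.quot.eqv (\<alpha> ^ n) f"
proof -
  let ?K = "fraction_field L (\<phi> ` carrier R)"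
  let ?b = "\<ominus>\<^bsub>L\<^esub> L.pr f"
  let ?p = "\<one>\<^bsub>L\<^esub> # replicate (n - 1) \<zero>\<^bsub>L\<^esub> @ [?b]"
  have fK: "L.pr f \<in> ?K" using f K_iff by simp
  have sr: "subring ?K L" using L.subfield_axioms subfieldE(1) by blast
  have K: "\<one>\<^bsub>L\<^esub> \<in> ?K" "\<zero>\<^bsub>L\<^esub> \<in> ?K" "?b \<in> ?K"
    using subringE(2,3,5)[OF sr] fK by auto
  have pK: "?p \<in> carrier (univ_poly L ?K)"
    using K by (auto simp: univ_poly_def polynomial_def)
  have pL: "?p \<in> carrier (univ_poly L (carrier L))"
    using L.pr_simps(1) by (auto simp: univ_poly_def polynomial_def)
  have "L.splitted ?p" by (rule L.roots_over_subfield[OF pK])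
  then have "size (L.roots ?p) = n" using n by (simp add: L.splitted_def)
  then obtain a where "a \<in># L.roots ?p" using n by (metis One_nat_def Suc_le_D size_eq_Suc_imp_elem)
  then have a: "a \<in> carrier L" "L.eval ?p a = \<zero>\<^bsub>L\<^esub>"
    using L.roots_mem_iff_is_root[OF pL] by (auto simp: L.is_root_def)
  have ev: "L.eval (replicate k \<zero>\<^bsub>L\<^esub> @ [?b]) a = ?b" for k
    using a(1) L.pr_simps(1) by (induction k) auto
  have "a [^]\<^bsub>L\<^esub> n \<oplus>\<^bsub>L\<^esub> ?b = \<zero>\<^bsub>L\<^esub>"
    using a n ev by simp
  then have "a [^]\<^bsub>L\<^esub> n = L.pr f"
    using a(1) L.pr_simps(1) by (metis L.minus_equality L.minus_minus L.a_inv_closed L.nat_pow_closed)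
  then show ?thesis
    using a(1) by (intro exI[of _ "L.lift a"]) (simp add: L.eqv_iff L.pr_power L.pr_lift)
qed

lemma of_nat_invertible:
  assumes Q: "contains_rationals R" and n: "n > 0"
  shows "\<exists>x\<in>A. L.quot.eqv (of_nat n * x) 1"
proof -
  obtain h where h: "h \<in> ring_hom (ring_of_type_algebra :: rat ring) R"
    using Q unfolding contains_rationals_def by blast
  have hc: "h q \<in> carrier R" for q using ring_hom_closed[OF h, of q] by (simp add: ring_of_type_algebra_def)
  have hadd: "h (p + q) = h p \<oplus>\<^bsub>R\<^esub> h q" for p q
    using ring_hom_add[OF h, of p q] by (simp add: ring_of_type_algebra_def)
  have hmult: "h (p * q) = h p \<otimes>\<^bsub>R\<^esub> h q" for p q
    using ring_hom_mult[OF h, of p q] by (simp add: ring_of_type_algebra_def)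
  have hone: "h 1 = \<one>\<^bsub>R\<^esub>" using ring_hom_one[OF h] by (simp add: ring_of_type_algebra_def)
  have hzero: "h 0 = \<zero>\<^bsub>R\<^esub>"
    using R.add.l_cancel_one[of "h 0" "h 0"] hadd[of 0 0] hc by simp
  have pn: "L.pr (of_nat k) = \<phi> (h (of_nat k))" for k
    by (induction k) (auto simp: L.pr_simps hzero hadd hone hc L.a_comm)
  let ?r = "h (1 / of_nat n)"
  have "L.pr (of_nat n * L.lift (\<phi> ?r)) = \<phi> (h (of_nat n * (1 / of_nat n)))"
    by (simp only: L.pr_simps(5) pn pr_lift_phi[OF hc] hmult phi.hom_mult[OF hc hc])
  also have "\<dots> = L.pr 1" using n by (simp add: hone L.pr_simps)
  finally show ?thesis using lift_phi_in_A[OF hc] by (auto simp: L.eqv_iff intro!: bexI[of _ "L.lift (\<phi> ?r)"])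
qed

definition max_A :: "'a set \<Rightarrow> 'c universal_ring set" where
  "max_A m = {x. L.pr x \<in> \<phi> ` m}"

text \<open>An element of \<open>R\<close> that is not a unit lies in some maximal ideal, and \<open>m\<close> is the only one.\<close>

lemma max_A_local:
  assumes loc: "local_ring R m"
  shows "D.ideal_in_A (max_A m)" "1 \<notin> max_A m" "x \<in> A \<Longrightarrow> x \<notin> max_A m \<Longrightarrow> \<exists>y\<in>A. L.quot.eqv (x * y) 1"
    "ideal m R" "a \<in> carrier R \<Longrightarrow> L.lift (\<phi> a) \<in> max_A m \<longleftrightarrow> a \<in> m"
proof -
  have mx: "maximalideal m R" and uniq: "\<And>n. maximalideal n R \<Longrightarrow> n = m" using loc by (auto simp: local_ring_def)
  interpret m: maximalideal m R by (rule mx)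
  show im: "ideal m R" by (rule m.ideal_axioms)
  have mc: "m \<subseteq> carrier R" using m.a_subset .
  show "L.lift (\<phi> a) \<in> max_A m \<longleftrightarrow> a \<in> m" if "a \<in> carrier R" for a
    using that mc phi_eq_iff by (auto simp: max_A_def pr_lift_phi)
  have one_m: "\<one>\<^bsub>R\<^esub> \<notin> m" using m.I_notcarr m.one_imp_carrier by blast
  show "1 \<notin> max_A m"
  proof
    assume "1 \<in> max_A m"
    then obtain a where "a \<in> m" "\<phi> a = \<phi> \<one>\<^bsub>R\<^esub>" by (auto simp: max_A_def L.pr_simps)
    then show False using phi_eq_iff[of a "\<one>\<^bsub>R\<^esub>"] mc one_m by auto
  qed
  show "D.ideal_in_A (max_A m)"
    unfolding D.ideal_in_A_def
  proof (intro conjI ballI)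
    show "max_A m \<subseteq> A" using mc by (auto simp: max_A_def A_iff)
    show "L.vanishing \<subseteq> max_A m"
      using m.zero_closed by (auto simp: max_A_def L.vanishing_iff intro!: image_eqI[of _ _ "\<zero>\<^bsub>R\<^esub>"])
    fix x assume "x \<in> max_A m"
    then obtain a where a: "a \<in> m" "L.pr x = \<phi> a" by (auto simp: max_A_def)
    show "x + y \<in> max_A m" if y: "y \<in> max_A m" for y
    proof -
      obtain b where b: "b \<in> m" "L.pr y = \<phi> b" using y by (auto simp: max_A_def)
      have "L.pr (x + y) = \<phi> (a \<oplus>\<^bsub>R\<^esub> b)"
        using a b subsetD[OF mc a(1)] subsetD[OF mc b(1)] by (simp add: L.pr_simps(4))
      then show ?thesis using m.a_closed[OF a(1) b(1)] unfolding max_A_def by blast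
    qed
    show "y * x \<in> max_A m" if y: "y \<in> A" for y
    proof -
      obtain b where b: "b \<in> carrier R" "L.pr y = \<phi> b" using y by (auto simp: A_iff)
      have "L.pr (y * x) = \<phi> (b \<otimes>\<^bsub>R\<^esub> a)"
        using a b subsetD[OF mc a(1)] by (simp add: L.pr_simps(5))
      then show ?thesis using m.I_l_closed[OF a(1) b(1)] unfolding max_A_def by blast
    qed
  qed
  assume x: "x \<in> A" "x \<notin> max_A m"
  then obtain a where a: "a \<in> carrier R" "L.pr x = \<phi> a" by (auto simp: A_iff)
  have "a \<notin> m" using x(2) a by (auto simp: max_A_def)
  then have "a \<in> Units R" using R.nonunit_in_maximalideal[OF a(1)] uniq by blast
  then obtain b where b: "b \<in> carrier R" "a \<otimes>\<^bsub>R\<^esub> b = \<one>\<^bsub>R\<^esub>" using R.Units_r_inv_ex by blast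
  have "L.pr (x * L.lift (\<phi> b)) = \<phi> (a \<otimes>\<^bsub>R\<^esub> b)" using a b(1) by (simp add: L.pr_simps(5) pr_lift_phi)
  then show "\<exists>y\<in>A. L.quot.eqv (x * y) 1"
    using lift_phi_in_A[OF b(1)] b(2) by (intro bexI[of _ "L.lift (\<phi> b)"]) (auto simp: L.eqv_iff L.pr_simps)
qed

end

section \<open>The matrices of a free resolution\<close>

locale resolution = fraction_closure R L \<phi>
  for R :: "('a, 'b) ring_scheme" and L :: "('c, 'd) ring_scheme" and \<phi> :: "'a \<Rightarrow> 'c" +
  fixes m :: "'a set" and F :: "nat \<Rightarrow> ('a, 'p) module" and d :: "nat \<Rightarrow> 'p \<Rightarrow> 'p" and \<epsilon> :: "'p \<Rightarrow> 'a set"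
  assumes R_local: "local_ring R m"
    and F_resolution: "free_resolution R (residue_module R m) F d \<epsilon>"
begin

abbreviation sc :: "'a \<Rightarrow> 'c universal_ring" where "sc a \<equiv> L.lift (\<phi> a)"

abbreviation L_eqv (infix "\<asymp>" 50) where "x \<asymp> y \<equiv> L.quot.eqv x y"

lemma sc_simps:
  assumes "a \<in> carrier R" "b \<in> carrier R"
  shows "sc (a \<oplus>\<^bsub>R\<^esub> b) \<asymp> sc a + sc b" "sc (a \<otimes>\<^bsub>R\<^esub> b) \<asymp> sc a * sc b"
  using assms by (auto simp: L.eqv_iff L.pr_simps L.pr_lift)

lemma sc_eq_0: "a \<in> carrier R \<Longrightarrow> sc a = 0 \<longleftrightarrow> a = \<zero>\<^bsub>R\<^esub>"
proof
  assume a: "a \<in> carrier R" and "sc a = 0"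
  then have "L.pr (sc a) = \<zero>\<^bsub>L\<^esub>" by (simp add: L.pr_simps)
  then show "a = \<zero>\<^bsub>R\<^esub>" using a phi_eq_iff[of a "\<zero>\<^bsub>R\<^esub>"] by (simp add: pr_lift_phi)
qed simp

lemma sc_one: "sc \<one>\<^bsub>R\<^esub> \<asymp> 1" by (simp add: L.eqv_iff L.pr_lift L.pr_simps)

lemma sc_inj: "a \<in> carrier R \<Longrightarrow> b \<in> carrier R \<Longrightarrow> sc a \<asymp> sc b \<Longrightarrow> a = b"
  by (simp add: L.eqv_iff pr_lift_phi phi_eq_iff)

lemma F_module: "module R (F j)" and d_linear: "d j \<in> linear_maps R (F (Suc j)) (F j)"
  using F_resolution by (auto simp: free_resolution_def free_module_def)

lemma F_abelian: "abelian_group (F j)"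
  using F_module[of j] by (simp add: module_def)

definition basis :: "nat \<Rightarrow> 'p set" where
  "basis j = (SOME B. B \<subseteq> carrier (F j) \<and> (\<forall>x \<in> carrier (F j). \<exists>!c. c \<in> coefficient_families R B \<and>
        x = (\<Oplus>\<^bsub>F j\<^esub>b\<in>{b. c b \<noteq> \<zero>\<^bsub>R\<^esub>}. c b \<odot>\<^bsub>F j\<^esub> b)))"

lemma basis_props:
  "basis j \<subseteq> carrier (F j)"
  "\<forall>x \<in> carrier (F j). \<exists>!c. c \<in> coefficient_families R (basis j) \<and>
        x = (\<Oplus>\<^bsub>F j\<^esub>b\<in>{b. c b \<noteq> \<zero>\<^bsub>R\<^esub>}. c b \<odot>\<^bsub>F j\<^esub> b)"
proof -
  have "\<exists>B. B \<subseteq> carrier (F j) \<and> (\<forall>x \<in> carrier (F j). \<exists>!c. c \<in> coefficient_families R B \<and>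
        x = (\<Oplus>\<^bsub>F j\<^esub>b\<in>{b. c b \<noteq> \<zero>\<^bsub>R\<^esub>}. c b \<odot>\<^bsub>F j\<^esub> b))"
    using F_resolution by (auto simp: free_resolution_def free_module_def)
  from someI_ex[OF this]
  show "basis j \<subseteq> carrier (F j)" "\<forall>x \<in> carrier (F j). \<exists>!c. c \<in> coefficient_families R (basis j) \<and>
        x = (\<Oplus>\<^bsub>F j\<^esub>b\<in>{b. c b \<noteq> \<zero>\<^bsub>R\<^esub>}. c b \<odot>\<^bsub>F j\<^esub> b)"
    unfolding basis_def by auto
qed

definition comb :: "nat \<Rightarrow> 'p set \<Rightarrow> ('p \<Rightarrow> 'a) \<Rightarrow> 'p" where
  "comb j T c = (\<Oplus>\<^bsub>F j\<^esub>b\<in>T. c b \<odot>\<^bsub>F j\<^esub> b)"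

definition coordinate :: "nat \<Rightarrow> 'p \<Rightarrow> 'p \<Rightarrow> 'a" where
  "coordinate j x = (THE c. c \<in> coefficient_families R (basis j) \<and> x = comb j {b. c b \<noteq> \<zero>\<^bsub>R\<^esub>} c)"

lemma coordinate_props:
  assumes "x \<in> carrier (F j)"
  shows "coordinate j x \<in> coefficient_families R (basis j)" "x = comb j {b. coordinate j x b \<noteq> \<zero>\<^bsub>R\<^esub>} (coordinate j x)"
  using theI'[OF bspec[OF basis_props(2) assms]] unfolding coordinate_def comb_def by auto

lemma coordinate_closed: "x \<in> carrier (F j) \<Longrightarrow> coordinate j x b \<in> carrier R"
  and coordinate_finite: "x \<in> carrier (F j) \<Longrightarrow> finite {b. coordinate j x b \<noteq> \<zero>\<^bsub>R\<^esub>}"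
  and coordinate_outside: "x \<in> carrier (F j) \<Longrightarrow> coordinate j x b \<noteq> \<zero>\<^bsub>R\<^esub> \<Longrightarrow> b \<in> basis j"
  using coordinate_props(1)[of x j] by (auto simp: coefficient_families_def)

lemma smult_closed: "a \<in> carrier R \<Longrightarrow> x \<in> carrier (F j) \<Longrightarrow> a \<odot>\<^bsub>F j\<^esub> x \<in> carrier (F j)"
  by (rule module.smult_closed[OF F_module])

lemma add_closed: "x \<in> carrier (F j) \<Longrightarrow> y \<in> carrier (F j) \<Longrightarrow> x \<oplus>\<^bsub>F j\<^esub> y \<in> carrier (F j)"
  by (rule abelian_monoid.a_closed[OF abelian_group.axioms(1)[OF F_abelian]])

lemma comb_insert:
  assumes "finite T" "b \<notin> T" "insert b T \<subseteq> carrier (F j)" "\<And>x. x \<in> insert b T \<Longrightarrow> c x \<in> carrier R"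
  shows "comb j (insert b T) c = c b \<odot>\<^bsub>F j\<^esub> b \<oplus>\<^bsub>F j\<^esub> comb j T c"
proof -
  interpret M: abelian_group "F j" by (rule F_abelian)
  show ?thesis
    unfolding comb_def by (rule M.finsum_insert) (use assms smult_closed in auto)
qed

lemma comb_empty: "comb j {} c = \<zero>\<^bsub>F j\<^esub>"
proof -
  interpret M: abelian_group "F j" by (rule F_abelian)
  show ?thesis by (simp add: comb_def)
qed

lemma comb_closed:
  assumes "T \<subseteq> carrier (F j)" "\<And>x. x \<in> T \<Longrightarrow> c x \<in> carrier R"
  shows "comb j T c \<in> carrier (F j)"
proof -
  interpret M: abelian_group "F j" by (rule F_abelian)
  show ?thesis unfolding comb_def by (rule M.finsum_closed) (use assms smult_closed in auto)
qed

lemma comb_superset: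
  assumes "finite T" "{b. c b \<noteq> \<zero>\<^bsub>R\<^esub>} \<subseteq> T" "T \<subseteq> carrier (F j)" "\<And>x. x \<in> T \<Longrightarrow> c x \<in> carrier R"
  shows "comb j {b. c b \<noteq> \<zero>\<^bsub>R\<^esub>} c = comb j T c"
proof -
  interpret M: abelian_group "F j" by (rule F_abelian)
  show ?thesis
    unfolding comb_def
    by (rule M.add.finprod_mono_neutral_cong_left)
      (use assms smult_closed module.smult_l_null[OF F_module] in auto)
qed

lemma coordinate_eqI:
  assumes "finite T" "T \<subseteq> basis j" "\<And>b. c b \<in> carrier R" "\<And>b. b \<notin> T \<Longrightarrow> c b = \<zero>\<^bsub>R\<^esub>"
  shows "coordinate j (comb j T c) = c"
proof -
  have T: "T \<subseteq> carrier (F j)" using assms(2) basis_props(1) by blast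
  have "{b. c b \<noteq> \<zero>\<^bsub>R\<^esub>} \<subseteq> T" using assms(4) by blast
  then have c: "c \<in> coefficient_families R (basis j)"
    using assms finite_subset by (auto simp: coefficient_families_def)
  have "comb j {b. c b \<noteq> \<zero>\<^bsub>R\<^esub>} c = comb j T c"
    by (rule comb_superset[OF assms(1) _ T]) (use assms in auto)
  moreover have "comb j T c \<in> carrier (F j)" by (rule comb_closed[OF T assms(3)])
  moreover have "\<exists>!c'. c' \<in> coefficient_families R (basis j) \<and> comb j T c = comb j {b. c' b \<noteq> \<zero>\<^bsub>R\<^esub>} c'"
    if "comb j T c \<in> carrier (F j)"
    using bspec[OF basis_props(2) that] by (simp add: comb_def)
  ultimately show ?thesis
    unfolding coordinate_def by (intro the1_equality conjI c) auto
qed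

text \<open>A map \<open>h\<close> that is linear modulo an additive subgroup \<open>J\<close> is determined modulo \<open>J\<close> by its
  values on a basis. The coordinates of a differential are such maps with \<open>J\<close> the vanishing
  elements, and representatives of the augmentation with \<open>J\<close> the maximal ideal.\<close>

lemma functional_comb:
  assumes J: "0 \<in> J" "\<And>x y. x \<in> J \<Longrightarrow> y \<in> J \<Longrightarrow> x + y \<in> J"
    and h0: "h \<zero>\<^bsub>F j\<^esub> \<in> J"
    and add: "\<And>x y. x \<in> carrier (F j) \<Longrightarrow> y \<in> carrier (F j) \<Longrightarrow> h (x \<oplus>\<^bsub>F j\<^esub> y) - (h x + h y) \<in> J"
    and smult: "\<And>a x. a \<in> carrier R \<Longrightarrow> x \<in> carrier (F j) \<Longrightarrow> h (a \<odot>\<^bsub>F j\<^esub> x) - sc a * h x \<in> J"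
    and T: "finite T" "T \<subseteq> carrier (F j)" "\<And>x. x \<in> T \<Longrightarrow> c x \<in> carrier R"
  shows "h (comb j T c) - (\<Sum>b\<in>T. sc (c b) * h b) \<in> J"
  using T
proof (induction T rule: finite_induct)
  case empty
  then show ?case using h0 by (simp add: comb_empty)
next
  case (insert b T)
  have *: "comb j (insert b T) c = c b \<odot>\<^bsub>F j\<^esub> b \<oplus>\<^bsub>F j\<^esub> comb j T c"
    using insert by (intro comb_insert) auto
  have 1: "h (comb j (insert b T) c) - (h (c b \<odot>\<^bsub>F j\<^esub> b) + h (comb j T c)) \<in> J"
    unfolding * using insert smult_closed comb_closed by (intro add) auto
  have 2: "h (c b \<odot>\<^bsub>F j\<^esub> b) - sc (c b) * h b \<in> J" using insert by (intro smult) auto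
  have 3: "h (comb j T c) - (\<Sum>b\<in>T. sc (c b) * h b) \<in> J" using insert by auto
  have "h (comb j (insert b T) c) - (\<Sum>b\<in>insert b T. sc (c b) * h b) =
    (h (comb j (insert b T) c) - (h (c b \<odot>\<^bsub>F j\<^esub> b) + h (comb j T c))) +
    ((h (c b \<odot>\<^bsub>F j\<^esub> b) - sc (c b) * h b) + (h (comb j T c) - (\<Sum>b\<in>T. sc (c b) * h b)))"
    using insert(1,2) by simp
  also have "\<dots> \<in> J" by (intro J(2) 1 2 3)
  finally show ?case .
qed

lemma functional_expand:
  assumes J: "0 \<in> J" "\<And>x y. x \<in> J \<Longrightarrow> y \<in> J \<Longrightarrow> x + y \<in> J"
    and h0: "h \<zero>\<^bsub>F j\<^esub> \<in> J"
    and add: "\<And>x y. x \<in> carrier (F j) \<Longrightarrow> y \<in> carrier (F j) \<Longrightarrow> h (x \<oplus>\<^bsub>F j\<^esub> y) - (h x + h y) \<in> J"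
    and smult: "\<And>a x. a \<in> carrier R \<Longrightarrow> x \<in> carrier (F j) \<Longrightarrow> h (a \<odot>\<^bsub>F j\<^esub> x) - sc a * h x \<in> J"
    and x: "x \<in> carrier (F j)"
  shows "h x - (\<Sum>b | sc (coordinate j x b) \<noteq> 0. sc (coordinate j x b) * h b) \<in> J"
proof -
  have eq: "{b. sc (coordinate j x b) \<noteq> 0} = {b. coordinate j x b \<noteq> \<zero>\<^bsub>R\<^esub>}"
    using sc_eq_0[OF coordinate_closed[OF x]] by auto
  have "h (comb j {b. coordinate j x b \<noteq> \<zero>\<^bsub>R\<^esub>} (coordinate j x)) - (\<Sum>b | coordinate j x b \<noteq> \<zero>\<^bsub>R\<^esub>. sc (coordinate j x b) * h b) \<in> J"
    by (rule functional_comb[OF assms(1-5) coordinate_finite[OF x]])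
      (use coordinate_outside[OF x] basis_props(1) coordinate_closed[OF x] in blast)+
  then show ?thesis unfolding eq using coordinate_props(2)[OF x] by simp
qed

lemma coordinate_add:
  assumes "x \<in> carrier (F j)" "y \<in> carrier (F j)"
  shows "coordinate j (x \<oplus>\<^bsub>F j\<^esub> y) b = coordinate j x b \<oplus>\<^bsub>R\<^esub> coordinate j y b"
proof -
  interpret M: abelian_group "F j" by (rule F_abelian)
  let ?T = "{b. coordinate j x b \<noteq> \<zero>\<^bsub>R\<^esub>} \<union> {b. coordinate j y b \<noteq> \<zero>\<^bsub>R\<^esub>}"
  have T: "finite ?T" "?T \<subseteq> basis j" using coordinate_finite coordinate_outside assms by auto
  then have TF: "?T \<subseteq> carrier (F j)" using basis_props(1) by blast
  have "x = comb j ?T (coordinate j x)" "y = comb j ?T (coordinate j y)"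
    using coordinate_props(2)[OF assms(1)] coordinate_props(2)[OF assms(2)]
      comb_superset[OF T(1) _ TF, of "coordinate j x"] comb_superset[OF T(1) _ TF, of "coordinate j y"] coordinate_closed assms by auto
  then have "x \<oplus>\<^bsub>F j\<^esub> y = comb j ?T (coordinate j x) \<oplus>\<^bsub>F j\<^esub> comb j ?T (coordinate j y)" by simp
  also have "\<dots> = (\<Oplus>\<^bsub>F j\<^esub>b\<in>?T. coordinate j x b \<odot>\<^bsub>F j\<^esub> b \<oplus>\<^bsub>F j\<^esub> coordinate j y b \<odot>\<^bsub>F j\<^esub> b)"
    unfolding comb_def
    by (rule M.finsum_addf[symmetric]) (use TF coordinate_closed[OF assms(1)] coordinate_closed[OF assms(2)] smult_closed in auto)
  also have "\<dots> = comb j ?T (\<lambda>b. coordinate j x b \<oplus>\<^bsub>R\<^esub> coordinate j y b)"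
    unfolding comb_def
    by (rule M.finsum_cong')
      (use TF coordinate_closed[OF assms(1)] coordinate_closed[OF assms(2)] smult_closed module.smult_l_distr[OF F_module] in \<open>auto intro!: smult_closed\<close>)
  finally have "coordinate j (x \<oplus>\<^bsub>F j\<^esub> y) = coordinate j (comb j ?T (\<lambda>b. coordinate j x b \<oplus>\<^bsub>R\<^esub> coordinate j y b))" by simp
  also have "\<dots> = (\<lambda>b. coordinate j x b \<oplus>\<^bsub>R\<^esub> coordinate j y b)"
    by (rule coordinate_eqI[OF T]) (use coordinate_closed assms in auto)
  finally show ?thesis by simp
qed

lemma coordinate_smult:
  assumes "a \<in> carrier R" "x \<in> carrier (F j)"
  shows "coordinate j (a \<odot>\<^bsub>F j\<^esub> x) b = a \<otimes>\<^bsub>R\<^esub> coordinate j x b"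
proof -
  interpret M: module R "F j" by (rule F_module)
  let ?T = "{b. coordinate j x b \<noteq> \<zero>\<^bsub>R\<^esub>}"
  have T: "finite ?T" "?T \<subseteq> basis j" using coordinate_finite coordinate_outside assms by auto
  then have TF: "?T \<subseteq> carrier (F j)" using basis_props(1) by blast
  have "a \<odot>\<^bsub>F j\<^esub> x = a \<odot>\<^bsub>F j\<^esub> comb j ?T (coordinate j x)" using coordinate_props(2)[OF assms(2)] by simp
  also have "\<dots> = (\<Oplus>\<^bsub>F j\<^esub>b\<in>?T. a \<odot>\<^bsub>F j\<^esub> (coordinate j x b \<odot>\<^bsub>F j\<^esub> b))"
    unfolding comb_def
    by (rule M.finsum_smult_ldistr[OF T(1) assms(1)]) (use TF coordinate_closed[OF assms(2)] in auto)
  also have "\<dots> = comb j ?T (\<lambda>b. a \<otimes>\<^bsub>R\<^esub> coordinate j x b)"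
    unfolding comb_def
    by (rule M.finsum_cong') (use TF assms coordinate_closed[OF assms(2)] M.smult_assoc1 in \<open>auto intro!: M.smult_closed\<close>)
  finally have "coordinate j (a \<odot>\<^bsub>F j\<^esub> x) = coordinate j (comb j ?T (\<lambda>b. a \<otimes>\<^bsub>R\<^esub> coordinate j x b))" by simp
  also have "\<dots> = (\<lambda>b. a \<otimes>\<^bsub>R\<^esub> coordinate j x b)"
    by (rule coordinate_eqI[OF T]) (use coordinate_closed assms in auto)
  finally show ?thesis by simp
qed

lemma coordinate_zero: "coordinate j \<zero>\<^bsub>F j\<^esub> b = \<zero>\<^bsub>R\<^esub>"
proof -
  have "coordinate j (comb j {} (\<lambda>_. \<zero>\<^bsub>R\<^esub>)) = (\<lambda>_. \<zero>\<^bsub>R\<^esub>)" by (rule coordinate_eqI) auto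
  then show ?thesis by (simp add: comb_empty)
qed

lemma zero_closed: "\<zero>\<^bsub>F j\<^esub> \<in> carrier (F j)"
  by (rule abelian_monoid.zero_closed[OF abelian_group.axioms(1)[OF F_abelian]])

lemma coordinate_eq_zero_imp: "x \<in> carrier (F j) \<Longrightarrow> (\<And>b. coordinate j x b = \<zero>\<^bsub>R\<^esub>) \<Longrightarrow> x = \<zero>\<^bsub>F j\<^esub>"
  using coordinate_props(2)[of x j] by (simp add: comb_empty)

lemma coordinate_basis:
  assumes "b \<in> basis j"
  shows "coordinate j b b' = (if b' = b then \<one>\<^bsub>R\<^esub> else \<zero>\<^bsub>R\<^esub>)"
proof -
  interpret M: module R "F j" by (rule F_module)
  have b: "b \<in> carrier (F j)" using assms basis_props(1) by blast
  have "comb j {b} (\<lambda>b'. if b' = b then \<one>\<^bsub>R\<^esub> else \<zero>\<^bsub>R\<^esub>) = b"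
    using comb_insert[of "{}" b j "\<lambda>b'. if b' = b then \<one>\<^bsub>R\<^esub> else \<zero>\<^bsub>R\<^esub>"] b by (simp add: comb_empty)
  moreover have "coordinate j (comb j {b} (\<lambda>b'. if b' = b then \<one>\<^bsub>R\<^esub> else \<zero>\<^bsub>R\<^esub>)) = (\<lambda>b'. if b' = b then \<one>\<^bsub>R\<^esub> else \<zero>\<^bsub>R\<^esub>)"
    by (rule coordinate_eqI) (use assms in auto)
  ultimately show ?thesis by simp
qed

definition d_matrix :: "nat \<Rightarrow> 'p \<Rightarrow> 'p \<Rightarrow> 'c universal_ring" where
  "d_matrix j b c = (if b \<in> basis (Suc j) then sc (coordinate j (d j b) c) else 0)"

lemma d_closed: "x \<in> carrier (F (Suc j)) \<Longrightarrow> d j x \<in> carrier (F j)"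
  and d_add: "x \<in> carrier (F (Suc j)) \<Longrightarrow> y \<in> carrier (F (Suc j)) \<Longrightarrow>
    d j (x \<oplus>\<^bsub>F (Suc j)\<^esub> y) = d j x \<oplus>\<^bsub>F j\<^esub> d j y"
  and d_smult: "a \<in> carrier R \<Longrightarrow> x \<in> carrier (F (Suc j)) \<Longrightarrow> d j (a \<odot>\<^bsub>F (Suc j)\<^esub> x) = a \<odot>\<^bsub>F j\<^esub> d j x"
  using d_linear[of j] by (auto simp: linear_maps_def)

lemma d_zero: "d j \<zero>\<^bsub>F (Suc j)\<^esub> = \<zero>\<^bsub>F j\<^esub>"
  using d_smult[OF R.zero_closed zero_closed[of "Suc j"]]
    module.smult_l_null[OF F_module zero_closed] module.smult_l_null[OF F_module d_closed[OF zero_closed[of "Suc j"]]]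
  by simp

text \<open>As the coordinates of \<open>d j x\<close> are linear in \<open>x\<close>, it suffices that the equation holds for
  basis elements.\<close>

lemma sc_coordinate_d:
  assumes x: "x \<in> carrier (F (Suc j))"
  shows "sc (coordinate j (d j x) c) \<asymp> scalar_boundary (d_matrix j) (\<lambda>b. sc (coordinate (Suc j) x b)) c"
proof -
  have "sc (coordinate j (d j x) c) - (\<Sum>b | sc (coordinate (Suc j) x b) \<noteq> 0. sc (coordinate (Suc j) x b) * sc (coordinate j (d j b) c)) \<in> L.vanishing"
  proof (rule functional_expand[OF L.quot.Z_zero L.quot.Z_add _ _ _ x])
    show "sc (coordinate j (d j \<zero>\<^bsub>F (Suc j)\<^esub>) c) \<in> L.vanishing" by (simp add: d_zero coordinate_zero L.quot.Z_zero)
    fix x y assume "x \<in> carrier (F (Suc j))" "y \<in> carrier (F (Suc j))"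
    then show "sc (coordinate j (d j (x \<oplus>\<^bsub>F (Suc j)\<^esub> y)) c) - (sc (coordinate j (d j x) c) + sc (coordinate j (d j y) c)) \<in> L.vanishing"
      using sc_simps(1)[OF coordinate_closed coordinate_closed, OF d_closed d_closed] by (simp add: d_add coordinate_add d_closed L.quot.eqv_def)
  next
    fix a x assume "a \<in> carrier R" "x \<in> carrier (F (Suc j))"
    then show "sc (coordinate j (d j (a \<odot>\<^bsub>F (Suc j)\<^esub> x)) c) - sc a * sc (coordinate j (d j x) c) \<in> L.vanishing"
      using sc_simps(2)[OF _ coordinate_closed, OF _ d_closed] by (simp add: d_smult coordinate_smult d_closed L.quot.eqv_def)
  qed
  moreover have "(\<Sum>b | sc (coordinate (Suc j) x b) \<noteq> 0. sc (coordinate (Suc j) x b) * sc (coordinate j (d j b) c)) =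
      scalar_boundary (d_matrix j) (\<lambda>b. sc (coordinate (Suc j) x b)) c"
    unfolding scalar_boundary_def
  proof (rule sum.cong[OF refl])
    fix b assume "b \<in> {b. sc (coordinate (Suc j) x b) \<noteq> 0}"
    then have "b \<in> basis (Suc j)" using coordinate_outside[OF x, of b] sc_eq_0[OF coordinate_closed[OF x, of b]] by simp
    then show "sc (coordinate (Suc j) x b) * sc (coordinate j (d j b) c) = d_matrix j b c * sc (coordinate (Suc j) x b)"
      by (simp add: d_matrix_def mult.commute)
  qed
  ultimately show ?thesis by (simp add: L.quot.eqv_def)
qed

lemma exact_d: "d (Suc j) ` carrier (F (Suc (Suc j))) = a_kernel (F (Suc j)) (F j) (d j)"
  using F_resolution by (simp add: free_resolution_def)

lemma a_kernel_iff: "x \<in> a_kernel M N f \<longleftrightarrow> x \<in> carrier M \<and> f x = \<zero>\<^bsub>N\<^esub>"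
  by (simp add: a_kernel_def kernel_def)

lemma d_matrix_in_A: "d_matrix j b c \<in> A"
proof (cases "b \<in> basis (Suc j)")
  case True
  then have "coordinate j (d j b) c \<in> carrier R" using basis_props(1) d_closed coordinate_closed by blast
  then show ?thesis using True lift_phi_in_A by (simp add: d_matrix_def)
qed (use L.quot.subrD(1)[OF A_subr] in \<open>simp add: d_matrix_def\<close>)

lemma d_matrix_finite: "finite {c. d_matrix j b c \<noteq> 0}"
proof (cases "b \<in> basis (Suc j)")
  case True
  then have b: "d j b \<in> carrier (F j)" using basis_props(1) d_closed by blast
  have "{c. d_matrix j b c \<noteq> 0} \<subseteq> {c. coordinate j (d j b) c \<noteq> \<zero>\<^bsub>R\<^esub>}" using True by (auto simp: d_matrix_def)
  then show ?thesis using coordinate_finite[OF b] finite_subset by blast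
qed (simp add: d_matrix_def)

lemma d_matrix_supp: "b \<in> basis (Suc j) \<Longrightarrow> d_matrix j b c \<noteq> 0 \<Longrightarrow> c \<in> basis j"
proof -
  assume b: "b \<in> basis (Suc j)" and nz: "d_matrix j b c \<noteq> 0"
  have db: "d j b \<in> carrier (F j)" using b basis_props(1) d_closed by blast
  show "c \<in> basis j"
    using coordinate_outside[OF db, of c] sc_eq_0[OF coordinate_closed[OF db, of c]] b nz by (simp add: d_matrix_def)
qed

lemma d_matrix_d_matrix:
  assumes b: "b \<in> basis (Suc (Suc j))"
  shows "(\<Sum>c' | d_matrix (Suc j) b c' \<noteq> 0. d_matrix (Suc j) b c' * d_matrix j c' c) \<in> L.vanishing"
proof -
  have bF: "b \<in> carrier (F (Suc (Suc j)))" using b basis_props(1) by blast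
  have x: "d (Suc j) b \<in> carrier (F (Suc j))" by (rule d_closed[OF bF])
  have "d (Suc j) b \<in> a_kernel (F (Suc j)) (F j) (d j)" unfolding exact_d[symmetric] using bF by blast
  then have "d j (d (Suc j) b) = \<zero>\<^bsub>F j\<^esub>" by (simp add: a_kernel_iff)
  then have "scalar_boundary (d_matrix j) (\<lambda>c'. sc (coordinate (Suc j) (d (Suc j) b) c')) c \<asymp> 0"
    using L.quot.eqv_sym[OF sc_coordinate_d[OF x, of c]] by (simp add: coordinate_zero)
  then have "scalar_boundary (d_matrix j) (d_matrix (Suc j) b) c \<asymp> 0" using b by (simp add: d_matrix_def[abs_def])
  then show ?thesis by (simp add: scalar_boundary_def L.quot.Z_iff mult.commute)
qed

text \<open>Choosing the zero of \<open>R\<close> as representative wherever \<open>n\<close> is 0 keeps the support finite.\<close>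

lemma lift_chain:
  assumes n: "finite {b. n b \<noteq> 0}" "{b. n b \<noteq> 0} \<subseteq> basis j" "\<And>b. n b \<in> A"
  shows "\<exists>x\<in>carrier (F j). (\<forall>b. sc (coordinate j x b) \<asymp> n b) \<and> {b. sc (coordinate j x b) \<noteq> 0} \<subseteq> {b. n b \<noteq> 0}"
proof -
  have "\<exists>r. r \<in> carrier R \<and> sc r \<asymp> n b \<and> (n b = 0 \<longrightarrow> r = \<zero>\<^bsub>R\<^esub>)" for b
  proof (cases "n b = 0")
    case True
    then show ?thesis by (intro exI[of _ "\<zero>\<^bsub>R\<^esub>"]) simp
  next
    case False
    then show ?thesis using A_cases[OF n(3)[of b]] L.quot.eqv_sym by metis
  qed
  then obtain r where r: "\<And>b. r b \<in> carrier R" "\<And>b. sc (r b) \<asymp> n b" "\<And>b. n b = 0 \<Longrightarrow> r b = \<zero>\<^bsub>R\<^esub>" by metis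
  let ?x = "comb j {b. n b \<noteq> 0} r"
  have "?x \<in> carrier (F j)"
    by (rule comb_closed) (use n(2) basis_props(1) r(1) in auto)
  moreover have "coordinate j ?x = r" by (rule coordinate_eqI[OF n(1,2) r(1)]) (use r(3) in auto)
  ultimately show ?thesis using r by (intro bexI[of _ ?x]) auto
qed

lemma scalar_boundary_eqv:
  assumes "finite {b. n b \<noteq> 0}" "finite {b. n' b \<noteq> 0}" "\<And>b. n b \<asymp> n' b"
  shows "scalar_boundary M n c \<asymp> scalar_boundary M n' c"
proof -
  let ?T = "{b. n b \<noteq> 0} \<union> {b. n' b \<noteq> 0}"
  have "scalar_boundary M n c = (\<Sum>b\<in>?T. M b c * n b)" "scalar_boundary M n' c = (\<Sum>b\<in>?T. M b c * n' b)"
    using assms(1,2) by (auto intro!: scalar_boundary_superset)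
  then show ?thesis using assms(3) by (simp add: L.quot.eqv_sum L.quot.eqv_mult_left)
qed

lemma chain_of:
  assumes "y \<in> carrier (F j)"
  shows "finite {b. sc (coordinate j y b) \<noteq> 0} \<and> {b. sc (coordinate j y b) \<noteq> 0} \<subseteq> basis j \<and> (\<forall>b. sc (coordinate j y b) \<in> A)"
proof -
  have "{b. sc (coordinate j y b) \<noteq> 0} = {b. coordinate j y b \<noteq> \<zero>\<^bsub>R\<^esub>}" using sc_eq_0[OF coordinate_closed[OF assms]] by auto
  then show ?thesis
    using coordinate_finite[OF assms] coordinate_outside[OF assms] lift_phi_in_A[OF coordinate_closed[OF assms]] by auto
qed

lemma d_matrix_exact:
  assumes n: "finite {b. n b \<noteq> 0}" "{b. n b \<noteq> 0} \<subseteq> basis (Suc j)" "\<And>b. n b \<in> A"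
    and cyc: "\<And>c. scalar_boundary (d_matrix j) n c \<in> L.vanishing"
  shows "\<exists>n'. finite {b. n' b \<noteq> 0} \<and> {b. n' b \<noteq> 0} \<subseteq> basis (Suc (Suc j)) \<and> (\<forall>b. n' b \<in> A) \<and>
    (\<forall>c. n c \<asymp> scalar_boundary (d_matrix (Suc j)) n' c)"
proof -
  obtain x where x: "x \<in> carrier (F (Suc j))" "\<And>b. sc (coordinate (Suc j) x b) \<asymp> n b"
    "{b. sc (coordinate (Suc j) x b) \<noteq> 0} \<subseteq> {b. n b \<noteq> 0}" using lift_chain[OF n] by blast
  have "coordinate j (d j x) c = \<zero>\<^bsub>R\<^esub>" for c
  proof -
    have "sc (coordinate j (d j x) c) \<asymp> scalar_boundary (d_matrix j) (\<lambda>b. sc (coordinate (Suc j) x b)) c" by (rule sc_coordinate_d[OF x(1)])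
    also have "scalar_boundary (d_matrix j) (\<lambda>b. sc (coordinate (Suc j) x b)) c \<asymp> scalar_boundary (d_matrix j) n c"
      by (rule scalar_boundary_eqv[OF finite_subset[OF x(3) n(1)] n(1) x(2)])
    also have "scalar_boundary (d_matrix j) n c \<asymp> sc \<zero>\<^bsub>R\<^esub>" using cyc by (simp add: L.quot.Z_iff)
    finally show ?thesis using sc_inj[OF coordinate_closed[OF d_closed[OF x(1)]] R.zero_closed] by blast
  qed
  then have "d j x = \<zero>\<^bsub>F j\<^esub>" by (rule coordinate_eq_zero_imp[OF d_closed[OF x(1)]])
  then have "x \<in> d (Suc j) ` carrier (F (Suc (Suc j)))" unfolding exact_d using x(1) by (simp add: a_kernel_iff)
  then obtain y where y: "y \<in> carrier (F (Suc (Suc j)))" "x = d (Suc j) y" by blast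
  have "n c \<asymp> scalar_boundary (d_matrix (Suc j)) (\<lambda>b. sc (coordinate (Suc (Suc j)) y b)) c" for c
    using L.quot.eqv_trans[OF L.quot.eqv_sym[OF x(2)]] sc_coordinate_d[OF y(1)] unfolding y(2) by blast
  then show ?thesis using chain_of[OF y(1)] by (intro exI[of _ "\<lambda>b. sc (coordinate (Suc (Suc j)) y b)"]) auto
qed

lemmas m_local = max_A_local[OF R_local]

definition rep :: "'a set \<Rightarrow> 'a" where
  "rep C = (SOME r. r \<in> carrier R \<and> C = m +>\<^bsub>R\<^esub> r)"

lemma rep_props:
  assumes "C \<in> carrier (residue_module R m)"
  shows "rep C \<in> carrier R" "C = m +>\<^bsub>R\<^esub> rep C"
proof -
  have "\<exists>r. r \<in> carrier R \<and> C = m +>\<^bsub>R\<^esub> r"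
    using assms by (auto simp: residue_module_def restrict_scalars_def FactRing_def A_RCOSETS_def' a_r_coset_def)
  from someI_ex[OF this] show "rep C \<in> carrier R" "C = m +>\<^bsub>R\<^esub> rep C" unfolding rep_def by auto
qed

lemma coset_eqD: "a \<in> carrier R \<Longrightarrow> b \<in> carrier R \<Longrightarrow> m +>\<^bsub>R\<^esub> a = m +>\<^bsub>R\<^esub> b \<Longrightarrow> sc a - sc b \<in> max_A m"
proof -
  assume ab: "a \<in> carrier R" "b \<in> carrier R" and eq: "m +>\<^bsub>R\<^esub> a = m +>\<^bsub>R\<^esub> b"
  interpret m: ideal m R by (rule m_local(4))
  have "a \<in> m +>\<^bsub>R\<^esub> b" using m.a_rcos_self[OF ab(1)] eq by simp
  then obtain k where k: "k \<in> m" "a = k \<oplus>\<^bsub>R\<^esub> b" by (auto simp: a_r_coset_def')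
  have kc: "k \<in> carrier R" using k(1) m.a_subset by blast
  have "L.pr (sc a - sc b) = \<phi> k"
  proof -
    have "L.pr (sc a - sc b) = (\<phi> k \<oplus>\<^bsub>L\<^esub> \<phi> b) \<ominus>\<^bsub>L\<^esub> \<phi> b"
      using ab kc by (simp add: L.pr_diff L.pr_lift k(2))
    then show ?thesis using ab kc by (simp add: a_minus_def L.a_assoc L.r_neg)
  qed
  then show ?thesis using k(1) by (auto simp: max_A_def)
qed

lemma eps: "x \<in> carrier (F 0) \<Longrightarrow> \<epsilon> x \<in> carrier (residue_module R m)"
  "x \<in> carrier (F 0) \<Longrightarrow> y \<in> carrier (F 0) \<Longrightarrow> \<epsilon> (x \<oplus>\<^bsub>F 0\<^esub> y) = m +>\<^bsub>R\<^esub> (rep (\<epsilon> x) \<oplus>\<^bsub>R\<^esub> rep (\<epsilon> y))"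
  "a \<in> carrier R \<Longrightarrow> x \<in> carrier (F 0) \<Longrightarrow> \<epsilon> (a \<odot>\<^bsub>F 0\<^esub> x) = m +>\<^bsub>R\<^esub> (a \<otimes>\<^bsub>R\<^esub> rep (\<epsilon> x))"
proof -
  interpret m: ideal m R by (rule m_local(4))
  have lin: "\<epsilon> \<in> linear_maps R (F 0) (residue_module R m)" using F_resolution by (simp add: free_resolution_def)
  show c: "x \<in> carrier (F 0) \<Longrightarrow> \<epsilon> x \<in> carrier (residue_module R m)" for x using lin by (auto simp: linear_maps_def)
  show "\<epsilon> (x \<oplus>\<^bsub>F 0\<^esub> y) = m +>\<^bsub>R\<^esub> (rep (\<epsilon> x) \<oplus>\<^bsub>R\<^esub> rep (\<epsilon> y))" if xy: "x \<in> carrier (F 0)" "y \<in> carrier (F 0)"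
  proof -
    have "\<epsilon> (x \<oplus>\<^bsub>F 0\<^esub> y) = \<epsilon> x <+>\<^bsub>R\<^esub> \<epsilon> y"
      using lin xy by (auto simp: linear_maps_def residue_module_def restrict_scalars_def FactRing_def)
    also have "\<dots> = (m +>\<^bsub>R\<^esub> rep (\<epsilon> x)) <+>\<^bsub>R\<^esub> (m +>\<^bsub>R\<^esub> rep (\<epsilon> y))"
      using rep_props(2)[OF c[OF xy(1)]] rep_props(2)[OF c[OF xy(2)]] by simp
    also have "\<dots> = m +>\<^bsub>R\<^esub> (rep (\<epsilon> x) \<oplus>\<^bsub>R\<^esub> rep (\<epsilon> y))"
      by (rule m.a_rcos_sum) (use rep_props(1)[OF c] xy in auto)
    finally show ?thesis .
  qed
  show "\<epsilon> (a \<odot>\<^bsub>F 0\<^esub> x) = m +>\<^bsub>R\<^esub> (a \<otimes>\<^bsub>R\<^esub> rep (\<epsilon> x))" if ax: "a \<in> carrier R" "x \<in> carrier (F 0)"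
  proof -
    have "\<epsilon> (a \<odot>\<^bsub>F 0\<^esub> x) = rcoset_mult R m (m +>\<^bsub>R\<^esub> a) (\<epsilon> x)"
      using lin ax by (auto simp: linear_maps_def residue_module_def restrict_scalars_def FactRing_def)
    also have "\<dots> = rcoset_mult R m (m +>\<^bsub>R\<^esub> a) (m +>\<^bsub>R\<^esub> rep (\<epsilon> x))"
      using rep_props(2)[OF c[OF ax(2)]] by simp
    also have "\<dots> = m +>\<^bsub>R\<^esub> (a \<otimes>\<^bsub>R\<^esub> rep (\<epsilon> x))"
      by (rule m.rcoset_mult_add) (use rep_props(1)[OF c] ax in auto)
    finally show ?thesis .
  qed
qed

definition eps0 :: "'p \<Rightarrow> 'c universal_ring" where
  "eps0 b = (if b \<in> basis 0 then sc (rep (\<epsilon> b)) else 0)"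

lemma rep_cong:
  assumes "x \<in> carrier (F 0)" "r \<in> carrier R" "\<epsilon> x = m +>\<^bsub>R\<^esub> r"
  shows "sc (rep (\<epsilon> x)) - sc r \<in> max_A m"
  using coset_eqD[OF rep_props(1)[OF eps(1)[OF assms(1)]] assms(2)] rep_props(2)[OF eps(1)[OF assms(1)]] assms(3)
  by simp

lemma max_A_closed: "x \<in> max_A m \<Longrightarrow> y \<in> max_A m \<Longrightarrow> x + y \<in> max_A m" "L.vanishing \<subseteq> max_A m" "0 \<in> max_A m"
  using m_local(1) L.quot.Z_zero unfolding D.ideal_in_A_def by blast+

lemma eps_expand:
  assumes x: "x \<in> carrier (F 0)"
  shows "sc (rep (\<epsilon> x)) - (\<Sum>b | sc (coordinate 0 x b) \<noteq> 0. sc (coordinate 0 x b) * eps0 b) \<in> max_A m"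
proof -
  interpret m: ideal m R by (rule m_local(4))
  have repc: "rep (\<epsilon> y) \<in> carrier R" if "y \<in> carrier (F 0)" for y using rep_props(1)[OF eps(1)[OF that]] .
  have "sc (rep (\<epsilon> x)) - (\<Sum>b | sc (coordinate 0 x b) \<noteq> 0. sc (coordinate 0 x b) * sc (rep (\<epsilon> b))) \<in> max_A m"
  proof (rule functional_expand[OF max_A_closed(3) max_A_closed(1) _ _ _ x])
    have "\<zero>\<^bsub>R\<^esub> \<odot>\<^bsub>F 0\<^esub> \<zero>\<^bsub>F 0\<^esub> = \<zero>\<^bsub>F 0\<^esub>" by (rule module.smult_l_null[OF F_module zero_closed])
    then have "\<epsilon> \<zero>\<^bsub>F 0\<^esub> = m +>\<^bsub>R\<^esub> \<zero>\<^bsub>R\<^esub>" using eps(3)[OF R.zero_closed zero_closed] repc[OF zero_closed] by simp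
    then show "sc (rep (\<epsilon> \<zero>\<^bsub>F 0\<^esub>)) \<in> max_A m" using rep_cong[OF zero_closed R.zero_closed] by simp
    fix y z assume yz: "y \<in> carrier (F 0)" "z \<in> carrier (F 0)"
    have 1: "sc (rep (\<epsilon> (y \<oplus>\<^bsub>F 0\<^esub> z))) - sc (rep (\<epsilon> y) \<oplus>\<^bsub>R\<^esub> rep (\<epsilon> z)) \<in> max_A m"
      by (rule rep_cong[OF add_closed[OF yz] _ eps(2)[OF yz]]) (use repc yz in auto)
    have 2: "sc (rep (\<epsilon> y) \<oplus>\<^bsub>R\<^esub> rep (\<epsilon> z)) - (sc (rep (\<epsilon> y)) + sc (rep (\<epsilon> z))) \<in> max_A m"
      using sc_simps(1)[OF repc repc] yz max_A_closed(2) unfolding L.quot.eqv_def by blast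
    show "sc (rep (\<epsilon> (y \<oplus>\<^bsub>F 0\<^esub> z))) - (sc (rep (\<epsilon> y)) + sc (rep (\<epsilon> z))) \<in> max_A m"
      using max_A_closed(1)[OF 1 2] by (simp add: algebra_simps)
  next
    fix a y assume ay: "a \<in> carrier R" "y \<in> carrier (F 0)"
    have 1: "sc (rep (\<epsilon> (a \<odot>\<^bsub>F 0\<^esub> y))) - sc (a \<otimes>\<^bsub>R\<^esub> rep (\<epsilon> y)) \<in> max_A m"
      by (rule rep_cong[OF smult_closed[OF ay] _ eps(3)[OF ay]]) (use repc ay in auto)
    have 2: "sc (a \<otimes>\<^bsub>R\<^esub> rep (\<epsilon> y)) - sc a * sc (rep (\<epsilon> y)) \<in> max_A m"
      using sc_simps(2)[OF ay(1) repc] ay max_A_closed(2) unfolding L.quot.eqv_def by blast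
    show "sc (rep (\<epsilon> (a \<odot>\<^bsub>F 0\<^esub> y))) - sc a * sc (rep (\<epsilon> y)) \<in> max_A m"
      using max_A_closed(1)[OF 1 2] by simp
  qed
  moreover have "(\<Sum>b | sc (coordinate 0 x b) \<noteq> 0. sc (coordinate 0 x b) * sc (rep (\<epsilon> b))) =
      (\<Sum>b | sc (coordinate 0 x b) \<noteq> 0. sc (coordinate 0 x b) * eps0 b)"
    using chain_of[OF x] by (intro sum.cong refl) (auto simp: eps0_def)
  ultimately show ?thesis by simp
qed

lemma exact_0: "d 0 ` carrier (F (Suc 0)) = a_kernel (F 0) (residue_module R m) \<epsilon>"
  using F_resolution by (simp add: free_resolution_def)

lemma kernel_eps: "x \<in> a_kernel (F 0) (residue_module R m) \<epsilon> \<longleftrightarrow> x \<in> carrier (F 0) \<and> \<epsilon> x = m"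
  by (simp add: a_kernel_iff residue_module_def restrict_scalars_def FactRing_def)

lemma coset_of_m: "a \<in> m \<Longrightarrow> m +>\<^bsub>R\<^esub> a = m"
proof -
  interpret m: ideal m R by (rule m_local(4))
  show "a \<in> m \<Longrightarrow> m +>\<^bsub>R\<^esub> a = m" by (rule m.a_rcos_const)
qed

text \<open>The augmentation vanishes on boundaries, so their representatives lie in the maximal ideal.\<close>

lemma d_matrix_eps0:
  assumes b: "b \<in> basis (Suc 0)"
  shows "(\<Sum>c | d_matrix 0 b c \<noteq> 0. d_matrix 0 b c * eps0 c) \<in> max_A m"
proof -
  interpret m: ideal m R by (rule m_local(4))
  have bF: "b \<in> carrier (F (Suc 0))" using b basis_props(1) by blast
  have x: "d 0 b \<in> carrier (F 0)" by (rule d_closed[OF bF])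
  have "\<epsilon> (d 0 b) = m" using exact_0 bF kernel_eps by blast
  then have "\<epsilon> (d 0 b) = m +>\<^bsub>R\<^esub> \<zero>\<^bsub>R\<^esub>" using coset_of_m[OF m.zero_closed] by simp
  then have 1: "sc (rep (\<epsilon> (d 0 b))) \<in> max_A m" using rep_cong[OF x R.zero_closed] by simp
  let ?S = "\<Sum>c | sc (coordinate 0 (d 0 b) c) \<noteq> 0. sc (coordinate 0 (d 0 b) c) * eps0 c"
  have "sc (rep (\<epsilon> (d 0 b))) - ?S \<in> max_A m" by (rule eps_expand[OF x])
  then have "(-1) * (sc (rep (\<epsilon> (d 0 b))) - ?S) \<in> max_A m"
    using m_local(1) L.quot.subrD(6)[OF A_subr L.quot.subrD(2)[OF A_subr]] unfolding D.ideal_in_A_def by blast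
  then have "?S \<in> max_A m" using max_A_closed(1)[OF 1] by fastforce
  then show ?thesis using b by (simp add: d_matrix_def)
qed

lemma unit_lift_exists: "\<exists>x0\<in>carrier (F 0). \<epsilon> x0 = m +>\<^bsub>R\<^esub> \<one>\<^bsub>R\<^esub>"
proof -
  have "\<epsilon> ` carrier (F 0) = carrier (residue_module R m)" using F_resolution by (simp add: free_resolution_def)
  moreover have "m +>\<^bsub>R\<^esub> \<one>\<^bsub>R\<^esub> \<in> carrier (residue_module R m)"
    by (auto simp: residue_module_def restrict_scalars_def FactRing_def A_RCOSETS_def' a_r_coset_def)
  ultimately show ?thesis by (metis imageE)
qed

text \<open>An element \<open>x0\<close> of augmentation 1 serves as the chain \<open>c0\<close> of the resolution. Its multiples
  by elements of the maximal ideal have augmentation 0 and are boundaries.\<close>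

lemma augmentation:
  assumes x0: "x0 \<in> carrier (F 0)" "\<epsilon> x0 = m +>\<^bsub>R\<^esub> \<one>\<^bsub>R\<^esub>"
  shows "(\<Sum>b | sc (coordinate 0 x0 b) \<noteq> 0. eps0 b * sc (coordinate 0 x0 b)) - 1 \<in> max_A m"
    "\<mu> \<in> max_A m \<Longrightarrow> \<exists>n'. finite {b. n' b \<noteq> 0} \<and> {b. n' b \<noteq> 0} \<subseteq> basis (Suc 0) \<and> (\<forall>b. n' b \<in> A) \<and>
        (\<forall>c. \<mu> * sc (coordinate 0 x0 c) \<asymp> scalar_boundary (d_matrix 0) n' c)"
proof -
  interpret m: ideal m R by (rule m_local(4))
  let ?S = "\<Sum>b | sc (coordinate 0 x0 b) \<noteq> 0. eps0 b * sc (coordinate 0 x0 b)"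
  have neg: "- x \<in> max_A m" if "x \<in> max_A m" for x
  proof -
    have "(-1) * x \<in> max_A m"
      using that m_local(1) L.quot.subrD(6)[OF A_subr L.quot.subrD(2)[OF A_subr]] unfolding D.ideal_in_A_def by blast
    then show ?thesis by simp
  qed
  have "sc (rep (\<epsilon> x0)) - ?S \<in> max_A m" using eps_expand[OF x0(1)] by (simp add: mult.commute)
  then have 1: "?S - sc (rep (\<epsilon> x0)) \<in> max_A m" using neg by fastforce
  have 2: "sc (rep (\<epsilon> x0)) - sc \<one>\<^bsub>R\<^esub> \<in> max_A m" by (rule rep_cong[OF x0(1) R.one_closed x0(2)])
  have 3: "sc \<one>\<^bsub>R\<^esub> - 1 \<in> max_A m" using sc_one max_A_closed(2) unfolding L.quot.eqv_def by blast
  show "?S - 1 \<in> max_A m" using max_A_closed(1)[OF max_A_closed(1)[OF 1 2] 3] by simp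
  assume "\<mu> \<in> max_A m"
  then obtain a where a: "a \<in> m" "L.pr \<mu> = \<phi> a" by (auto simp: max_A_def)
  have aR: "a \<in> carrier R" using a(1) m.a_subset by blast
  have repc: "rep (\<epsilon> x0) \<in> carrier R" using rep_props(1)[OF eps(1)[OF x0(1)]] .
  have "a \<otimes>\<^bsub>R\<^esub> rep (\<epsilon> x0) \<in> m" using m.I_r_closed[OF a(1) repc] .
  then have "\<epsilon> (a \<odot>\<^bsub>F 0\<^esub> x0) = m" using eps(3)[OF aR x0(1)] coset_of_m by simp
  then have "a \<odot>\<^bsub>F 0\<^esub> x0 \<in> d 0 ` carrier (F (Suc 0))"
    unfolding exact_0 kernel_eps using smult_closed[OF aR x0(1)] by simp
  then obtain y where y: "y \<in> carrier (F (Suc 0))" "a \<odot>\<^bsub>F 0\<^esub> x0 = d 0 y" by blast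
  have "\<mu> * sc (coordinate 0 x0 c) \<asymp> scalar_boundary (d_matrix 0) (\<lambda>b. sc (coordinate (Suc 0) y b)) c" for c
  proof -
    have "\<mu> * sc (coordinate 0 x0 c) \<asymp> sc a * sc (coordinate 0 x0 c)"
      using a(2) aR by (intro L.quot.eqv_mult_right) (simp add: L.eqv_iff pr_lift_phi)
    also have "sc a * sc (coordinate 0 x0 c) \<asymp> sc (a \<otimes>\<^bsub>R\<^esub> coordinate 0 x0 c)"
      by (rule L.quot.eqv_sym[OF sc_simps(2)[OF aR coordinate_closed[OF x0(1)]]])
    also have "sc (a \<otimes>\<^bsub>R\<^esub> coordinate 0 x0 c) = sc (coordinate 0 (d 0 y) c)"
      by (simp add: coordinate_smult[OF aR x0(1), symmetric] y(2))
    also have "sc (coordinate 0 (d 0 y) c) \<asymp> scalar_boundary (d_matrix 0) (\<lambda>b. sc (coordinate (Suc 0) y b)) c" by (rule sc_coordinate_d[OF y(1)])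
    finally show ?thesis .
  qed
  then show "\<exists>n'. finite {b. n' b \<noteq> 0} \<and> {b. n' b \<noteq> 0} \<subseteq> basis (Suc 0) \<and> (\<forall>b. n' b \<in> A) \<and>
        (\<forall>c. \<mu> * sc (coordinate 0 x0 c) \<asymp> scalar_boundary (d_matrix 0) n' c)"
    using chain_of[OF y(1)] by (intro exI[of _ "\<lambda>b. sc (coordinate (Suc 0) y b)"]) auto
qed

end

section \<open>Tor as the homology of a complex of matrices\<close>

text \<open>The homomorphism on the free abelian group that extends \<open>w\<close>.\<close>

definition frag_eval :: "('k \<Rightarrow> 'u::comm_ring_1) \<Rightarrow> ('k \<Rightarrow>\<^sub>0 int) \<Rightarrow> 'u" where
  "frag_eval w t = (\<Sum>k\<in>Poly_Mapping.keys t. of_int (Poly_Mapping.lookup t k) * w k)"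

lemma frag_eval_superset:
  "finite T \<Longrightarrow> Poly_Mapping.keys t \<subseteq> T \<Longrightarrow> frag_eval w t = (\<Sum>k\<in>T. of_int (Poly_Mapping.lookup t k) * w k)"
  unfolding frag_eval_def by (intro sum.mono_neutral_left) (auto simp: in_keys_iff)

lemma frag_eval_diff: "frag_eval w (s - t) = frag_eval w s - frag_eval w t"
proof -
  let ?T = "Poly_Mapping.keys s \<union> Poly_Mapping.keys t"
  have T: "finite ?T" "Poly_Mapping.keys (s - t) \<subseteq> ?T" using keys_diff[of s t] by auto
  show ?thesis
    using T by (simp add: frag_eval_superset[of ?T] lookup_minus left_diff_distrib sum_subtractf)
qed

lemma frag_eval_0 [simp]: "frag_eval w 0 = 0"
  by (simp add: frag_eval_def)

lemma frag_eval_uminus: "frag_eval w (- t) = - frag_eval w t"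
  using frag_eval_diff[of w 0 t] by simp

lemma frag_eval_add: "frag_eval w (s + t) = frag_eval w s + frag_eval w t"
  using frag_eval_diff[of w s "- t"] by (simp add: frag_eval_uminus)

lemma frag_eval_of [simp]: "frag_eval w (frag_of k) = w k"
  by (simp add: frag_eval_def)

lemma frag_eval_sum: "frag_eval w (sum f S) = (\<Sum>b\<in>S. frag_eval w (f b))"
  by (induction S rule: infinite_finite_induct) (auto simp: frag_eval_add)

context resolution
begin

abbreviation N :: "('a, 'c) module" where "N \<equiv> absolute_integral_closure R L \<phi>"

lemma N_simps:
  "carrier N = integral_closure L (\<phi> ` carrier R)" "x \<oplus>\<^bsub>N\<^esub> y = x \<oplus>\<^bsub>L\<^esub> y" "a \<odot>\<^bsub>N\<^esub> x = \<phi> a \<otimes>\<^bsub>L\<^esub> x"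
  by (simp_all add: absolute_integral_closure_def restrict_scalars_def)

lemma pr_in_N: "L.pr x \<in> carrier N \<longleftrightarrow> D.integral A x"
  by (simp add: N_simps integral_iff)

lemma N_carrier: "y \<in> carrier N \<Longrightarrow> y \<in> carrier L"
  by (simp add: N_simps integral_closure_def)

lemma lift_integral: "y \<in> carrier N \<Longrightarrow> D.integral A (L.lift y)"
  using pr_in_N[of "L.lift y"] L.pr_lift[OF N_carrier[of y]] by simp

lemma integral_scalar: "a \<in> A \<Longrightarrow> D.integral A x \<Longrightarrow> D.integral A (a * x)"
  by (rule D.integral_add_mult(2)[OF D.integral_A[OF A_subr]])

lemma integral_sum: "(\<And>b. b \<in> S \<Longrightarrow> D.integral A (u b)) \<Longrightarrow> D.integral A (sum u S)"
  by (induction S rule: infinite_finite_induct)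
    (auto intro: D.integral_add_mult(1) D.integral_A[OF A_subr] simp: L.quot.subrD(1)[OF A_subr])

lemma N_add: "y \<in> carrier N \<Longrightarrow> y' \<in> carrier N \<Longrightarrow> y \<oplus>\<^bsub>L\<^esub> y' \<in> carrier N"
  using pr_in_N[of "L.lift y + L.lift y'"] D.integral_add_mult(1)[OF lift_integral lift_integral]
  by (simp add: L.pr_simps L.pr_lift N_carrier)

lemma N_smult: "a \<in> carrier R \<Longrightarrow> y \<in> carrier N \<Longrightarrow> \<phi> a \<otimes>\<^bsub>L\<^esub> y \<in> carrier N"
  using pr_in_N[of "sc a * L.lift y"] integral_scalar[OF lift_phi_in_A lift_integral]
  by (simp add: L.pr_simps L.pr_lift N_carrier)

lemma N_zero: "\<zero>\<^bsub>L\<^esub> \<in> carrier N"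
  using pr_in_N[of 0] D.integral_A[OF A_subr L.quot.subrD(1)[OF A_subr]] by (simp add: L.pr_simps)

abbreviation pairs :: "nat \<Rightarrow> ('p \<times> 'c) set" where "pairs j \<equiv> carrier (F j) \<times> carrier N"
abbreviation null :: "nat \<Rightarrow> ('p \<times> 'c \<Rightarrow>\<^sub>0 int) set" where "null j \<equiv> tensor_null R (F j) N"
abbreviation rels :: "nat \<Rightarrow> ('p \<times> 'c \<Rightarrow>\<^sub>0 int) set" where "rels j \<equiv> tensor_relations R (F j) N"
abbreviation free :: "nat \<Rightarrow> ('p \<times> 'c \<Rightarrow>\<^sub>0 int) monoid" where "free j \<equiv> free_Abelian_group (pairs j)"

lemma rels_cases:
  assumes "t \<in> rels j"
  obtains (left) x x' y where "x \<in> carrier (F j)" "x' \<in> carrier (F j)" "y \<in> carrier N"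
      "t = frag_of (x \<oplus>\<^bsub>F j\<^esub> x', y) - frag_of (x, y) - frag_of (x', y)"
  | (right) x y y' where "x \<in> carrier (F j)" "y \<in> carrier N" "y' \<in> carrier N"
      "t = frag_of (x, y \<oplus>\<^bsub>L\<^esub> y') - frag_of (x, y) - frag_of (x, y')"
  | (scalar) a x y where "a \<in> carrier R" "x \<in> carrier (F j)" "y \<in> carrier N"
      "t = frag_of (a \<odot>\<^bsub>F j\<^esub> x, y) - frag_of (x, \<phi> a \<otimes>\<^bsub>L\<^esub> y)"
  using assms unfolding tensor_relations_def N_simps(2,3) by blast

lemma keys_two: "Poly_Mapping.keys s \<subseteq> S \<Longrightarrow> Poly_Mapping.keys t \<subseteq> S \<Longrightarrow> Poly_Mapping.keys (s - t) \<subseteq> S"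
  using keys_diff[of s t] by blast

lemma rels_carrier: "rels j \<subseteq> carrier (free j)"
proof
  fix t assume "t \<in> rels j"
  then have "Poly_Mapping.keys t \<subseteq> pairs j"
  proof (cases rule: rels_cases)
    case (left x x' y)
    then show ?thesis unfolding left(4) by (intro keys_two) (auto simp: add_closed)
  next
    case (right x y y')
    then show ?thesis unfolding right(4) by (intro keys_two) (auto simp: N_add)
  next
    case (scalar a x y)
    then show ?thesis unfolding scalar(4) by (intro keys_two) (auto simp: smult_closed N_smult)
  qed
  then show "t \<in> carrier (free j)" by simp
qed

lemma null_subgroup: "subgroup (null j) (free j)"
  unfolding tensor_null_def
  by (rule group.generate_is_subgroup[OF group_free_Abelian_group rels_carrier])

lemma null_carrier: "t \<in> null j \<Longrightarrow> Poly_Mapping.keys t \<subseteq> pairs j"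
  using subsetD[OF subgroup.subset[OF null_subgroup[of j]], of t] by simp

lemma null_zero: "0 \<in> null j"
  using subgroup.one_closed[OF null_subgroup[of j]] by simp

lemma null_add: "s \<in> null j \<Longrightarrow> t \<in> null j \<Longrightarrow> s + t \<in> null j"
  using subgroup.m_closed[OF null_subgroup[of j]] by simp

lemma null_uminus: "t \<in> null j \<Longrightarrow> - t \<in> null j"
  using subgroup.m_inv_closed[OF null_subgroup[of j], of t] null_carrier[of t j] by simp

lemma null_diff: "s \<in> null j \<Longrightarrow> t \<in> null j \<Longrightarrow> s - t \<in> null j"
  using null_add[OF _ null_uminus, of s j t] by simp

lemma null_sum: "(\<And>b. b \<in> S \<Longrightarrow> f b \<in> null j) \<Longrightarrow> sum f S \<in> null j"
  by (induction S rule: infinite_finite_induct) (auto simp: null_zero null_add)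

lemma rels_null: "t \<in> rels j \<Longrightarrow> t \<in> null j"
  unfolding tensor_null_def by (rule generate.incl)

lemma null_left: "x \<in> carrier (F j) \<Longrightarrow> x' \<in> carrier (F j) \<Longrightarrow> y \<in> carrier N \<Longrightarrow>
    frag_of (x \<oplus>\<^bsub>F j\<^esub> x', y) - frag_of (x, y) - frag_of (x', y) \<in> null j"
  by (rule rels_null) (unfold tensor_relations_def, blast)

lemma null_right: "x \<in> carrier (F j) \<Longrightarrow> y \<in> carrier N \<Longrightarrow> y' \<in> carrier N \<Longrightarrow>
    frag_of (x, y \<oplus>\<^bsub>L\<^esub> y') - frag_of (x, y) - frag_of (x, y') \<in> null j"
  by (rule rels_null) (unfold tensor_relations_def N_simps(2), blast)

lemma null_scalar: "a \<in> carrier R \<Longrightarrow> x \<in> carrier (F j) \<Longrightarrow> y \<in> carrier N \<Longrightarrow>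
    frag_of (a \<odot>\<^bsub>F j\<^esub> x, y) - frag_of (x, \<phi> a \<otimes>\<^bsub>L\<^esub> y) \<in> null j"
  by (rule rels_null) (unfold tensor_relations_def N_simps(3), blast)

lemma null_zero_left: "y \<in> carrier N \<Longrightarrow> frag_of (\<zero>\<^bsub>F j\<^esub>, y) \<in> null j"
proof -
  interpret M: abelian_group "F j" by (rule F_abelian)
  assume "y \<in> carrier N"
  then show ?thesis using null_uminus[OF null_left[OF zero_closed[of j] zero_closed[of j]], of y] by simp
qed

lemma null_zero_right: "x \<in> carrier (F j) \<Longrightarrow> frag_of (x, \<zero>\<^bsub>L\<^esub>) \<in> null j"
  using null_uminus[OF null_right[OF _ N_zero N_zero], of x j] by simp

lemma null_comb:
  assumes y: "y \<in> carrier N" and T: "finite T" "T \<subseteq> carrier (F j)" "\<And>x. x \<in> T \<Longrightarrow> c x \<in> carrier R"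
  shows "frag_of (comb j T c, y) - (\<Sum>b\<in>T. frag_of (b, \<phi> (c b) \<otimes>\<^bsub>L\<^esub> y)) \<in> null j"
  using T
proof (induction T rule: finite_induct)
  case empty
  then show ?case using null_zero_left[OF y] by (simp add: comb_empty)
next
  case (insert b T)
  have *: "comb j (insert b T) c = c b \<odot>\<^bsub>F j\<^esub> b \<oplus>\<^bsub>F j\<^esub> comb j T c"
    using insert by (intro comb_insert) auto
  have 1: "frag_of (comb j (insert b T) c, y) - frag_of (c b \<odot>\<^bsub>F j\<^esub> b, y) - frag_of (comb j T c, y) \<in> null j"
    unfolding * using insert y smult_closed comb_closed by (intro null_left) auto
  have 2: "frag_of (c b \<odot>\<^bsub>F j\<^esub> b, y) - frag_of (b, \<phi> (c b) \<otimes>\<^bsub>L\<^esub> y) \<in> null j"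
    using insert y by (intro null_scalar) auto
  have 3: "frag_of (comb j T c, y) - (\<Sum>b\<in>T. frag_of (b, \<phi> (c b) \<otimes>\<^bsub>L\<^esub> y)) \<in> null j" using insert by auto
  show ?case
    using null_add[OF 1 null_add[OF 2 3]] insert(1,2) by (simp add: algebra_simps)
qed

lemma null_sum_right:
  assumes x: "x \<in> carrier (F j)" and u: "\<And>b. b \<in> S \<Longrightarrow> D.integral A (u b)" and S: "finite S"
  shows "(\<Sum>b\<in>S. frag_of (x, L.pr (u b))) - frag_of (x, L.pr (sum u S)) \<in> null j"
  using S u
proof (induction S rule: finite_induct)
  case empty
  then show ?case using null_uminus[OF null_zero_right[OF x]] by (simp add: L.pr_simps)
next
  case (insert b S)
  have 1: "frag_of (x, L.pr (u b) \<oplus>\<^bsub>L\<^esub> L.pr (sum u S)) - frag_of (x, L.pr (u b)) - frag_of (x, L.pr (sum u S)) \<in> null j"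
    using insert integral_sum[of S u] by (intro null_right x) (auto simp: pr_in_N)
  have 2: "(\<Sum>b\<in>S. frag_of (x, L.pr (u b))) - frag_of (x, L.pr (sum u S)) \<in> null j" using insert by auto
  show ?case using null_diff[OF 2 1] insert(1,2) by (simp add: L.pr_simps algebra_simps)
qed

text \<open>The homomorphism of free abelian groups that induces the differential on the tensor
  products.\<close>

abbreviation tensor_d :: "nat \<Rightarrow> ('p \<times> 'c \<Rightarrow>\<^sub>0 int) \<Rightarrow> ('p \<times> 'c \<Rightarrow>\<^sub>0 int)" where
  "tensor_d j \<equiv> frag_extend (\<lambda>(x, y). frag_of (d j x, y))"

lemma tensor_d_null:
  assumes "t \<in> null (Suc j)"
  shows "tensor_d j t \<in> null j"
  using assms unfolding tensor_null_def[of R "F (Suc j)"]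
proof (induction rule: generate.induct)
  case one
  then show ?case by (simp add: null_zero)
next
  case (incl h)
  then show ?case
    by (cases rule: rels_cases)
      (auto simp: frag_extend_diff d_add d_smult intro!: null_left null_right null_scalar d_closed)
next
  case (inv h)
  have "tensor_d j h \<in> null j"
    using inv by (cases rule: rels_cases)
      (auto simp: frag_extend_diff d_add d_smult intro!: null_left null_right null_scalar d_closed)
  moreover have "Poly_Mapping.keys h \<subseteq> pairs (Suc j)" using subsetD[OF rels_carrier inv] by simp
  ultimately show ?case using null_uminus by (simp add: frag_extend_minus)
next
  case (eng h1 h2)
  then show ?case by (simp add: frag_extend_add null_add)
qed

lemma tensor_d_carrier: "Poly_Mapping.keys t \<subseteq> pairs (Suc j) \<Longrightarrow> Poly_Mapping.keys (tensor_d j t) \<subseteq> pairs j"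
proof (induction t rule: frag_induction)
  case (one x)
  then show ?case using d_closed by (cases x) auto
next
  case (diff a b)
  then show ?case using keys_two by (simp add: frag_extend_diff)
qed simp

lemma coset_eq_iff:
  assumes "Poly_Mapping.keys s \<subseteq> pairs j" "Poly_Mapping.keys t \<subseteq> pairs j" "s - t \<in> null j"
  shows "null j #>\<^bsub>free j\<^esub> s = null j #>\<^bsub>free j\<^esub> t"
proof -
  have "s \<in> null j #>\<^bsub>free j\<^esub> t" using assms(3) by (auto simp: r_coset_def intro!: bexI[of _ "s - t"])
  then show ?thesis
    using group.repr_independence[OF group_free_Abelian_group _ _ null_subgroup, of s j t] assms(2) by simp
qed

lemma coset_self: "s \<in> null j #>\<^bsub>free j\<^esub> s"
  using null_zero by (auto simp: r_coset_def intro!: bexI[of _ 0])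

lemma coset_diff: "s \<in> null j #>\<^bsub>free j\<^esub> t \<Longrightarrow> s - t \<in> null j"
  by (auto simp: r_coset_def)

text \<open>The induced map is defined as the only member of an image of a coset; it is well-defined
  since \<open>tensor_d\<close> preserves the relations of the tensor product.\<close>

lemma tensor_map_coset:
  assumes z: "Poly_Mapping.keys z \<subseteq> pairs (Suc j)"
  shows "tensor_map R (F j) N (d j) (null (Suc j) #>\<^bsub>free (Suc j)\<^esub> z) = null j #>\<^bsub>free j\<^esub> tensor_d j z"
proof -
  have "null j #>\<^bsub>free j\<^esub> tensor_d j w = null j #>\<^bsub>free j\<^esub> tensor_d j z" if w: "w \<in> null (Suc j) #>\<^bsub>free (Suc j)\<^esub> z" for w
  proof (rule coset_eq_iff)
    have wz: "w - z \<in> null (Suc j)" by (rule coset_diff[OF w])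
    have "Poly_Mapping.keys ((w - z) + z) \<subseteq> pairs (Suc j)"
      using keys_add[of "w - z" z] null_carrier[OF wz] z by blast
    then show "Poly_Mapping.keys (tensor_d j w) \<subseteq> pairs j" by (intro tensor_d_carrier) simp
    show "Poly_Mapping.keys (tensor_d j z) \<subseteq> pairs j" by (rule tensor_d_carrier[OF z])
    show "tensor_d j w - tensor_d j z \<in> null j" using tensor_d_null[OF wz] by (simp add: frag_extend_diff)
  qed
  then have "(\<lambda>w. null j #>\<^bsub>free j\<^esub> tensor_d j w) ` (null (Suc j) #>\<^bsub>free (Suc j)\<^esub> z) = {null j #>\<^bsub>free j\<^esub> tensor_d j z}"
    using coset_self by blast
  then show ?thesis unfolding tensor_map_def by simp
qed

text \<open>Expanding \<open>d j b\<close> in the basis of \<open>F j\<close> turns the sum of the tensors of \<open>d j b\<close> and \<open>n b\<close>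
  into one of tensors of basis elements \<open>c\<close> with the boundary of \<open>n\<close> at \<open>c\<close>, which vanishes.\<close>

lemma cycle_null:
  assumes n: "n \<in> fchains (basis (Suc j)) D.integrals" and cyc: "\<And>c i. boundary (d_matrix j) n c i \<in> L.vanishing"
  shows "tensor_d j (\<Sum>b\<in>supp n. frag_of (b, L.pr (n b ()))) \<in> null j"
proof -
  let ?S = "supp n" and ?y = "\<lambda>b. L.pr (n b ())"
  have fS: "finite ?S" by (rule chainsD(1)[OF n])
  have SF: "b \<in> carrier (F (Suc j))" "b \<in> basis (Suc j)" if "b \<in> ?S" for b
    using that chainsD(2)[OF n] basis_props(1) by blast+
  have nint: "D.integral A (n b ())" for b using chainsD(3)[OF n, of b] by (simp add: D.integrals_def)
  let ?T = "\<Union>b\<in>?S. {c. d_matrix j b c \<noteq> 0}"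
  have fT: "finite ?T" using fS d_matrix_finite by blast
  have TF: "?T \<subseteq> carrier (F j)" using d_matrix_supp SF basis_props(1) by blast
  have tensor_d: "tensor_d j (\<Sum>b\<in>?S. frag_of (b, ?y b)) = (\<Sum>b\<in>?S. frag_of (d j b, ?y b))"
    by (simp add: frag_extend_sum[OF fS] o_def)
  have entry: "\<phi> (coordinate j (d j b) c) \<otimes>\<^bsub>L\<^esub> ?y b = L.pr (d_matrix j b c * n b ())" if b: "b \<in> ?S" for b c
    using SF[OF b] coordinate_closed[OF d_closed[OF SF(1)[OF b]]] by (simp add: d_matrix_def L.pr_simps(5) pr_lift_phi)
  have 1: "frag_of (d j b, ?y b) - (\<Sum>c\<in>?T. frag_of (c, L.pr (d_matrix j b c * n b ()))) \<in> null j" if b: "b \<in> ?S" for b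
  proof -
    have db: "d j b \<in> carrier (F j)" by (rule d_closed[OF SF(1)[OF b]])
    have "{c. coordinate j (d j b) c \<noteq> \<zero>\<^bsub>R\<^esub>} \<subseteq> ?T"
      using SF(2)[OF b] sc_eq_0[OF coordinate_closed[OF db]] b by (auto simp: d_matrix_def)
    then have "d j b = comb j ?T (coordinate j (d j b))"
      using coordinate_props(2)[OF db] comb_superset[OF fT _ TF, of "coordinate j (d j b)"] coordinate_closed[OF db] by simp
    then show ?thesis
      using null_comb[OF _ fT TF, of "?y b" "coordinate j (d j b)"] coordinate_closed[OF db] nint
      by (simp add: entry[OF b] pr_in_N)
  qed
  have "(\<Sum>b\<in>?S. frag_of (d j b, ?y b)) - (\<Sum>b\<in>?S. \<Sum>c\<in>?T. frag_of (c, L.pr (d_matrix j b c * n b ()))) \<in> null j"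
    unfolding sum_subtractf[symmetric] by (rule null_sum) (rule 1)
  moreover have "(\<Sum>b\<in>?S. \<Sum>c\<in>?T. frag_of (c, L.pr (d_matrix j b c * n b ()))) \<in> null j"
  proof -
    have "(\<Sum>b\<in>?S. frag_of (c, L.pr (d_matrix j b c * n b ()))) \<in> null j" if c: "c \<in> ?T" for c
    proof -
      have cF: "c \<in> carrier (F j)" using c TF by blast
      have "(\<Sum>b\<in>?S. frag_of (c, L.pr (d_matrix j b c * n b ()))) - frag_of (c, L.pr (\<Sum>b\<in>?S. d_matrix j b c * n b ())) \<in> null j"
        by (rule null_sum_right[OF cF _ fS]) (rule integral_scalar[OF d_matrix_in_A nint])
      moreover have "L.pr (\<Sum>b\<in>?S. d_matrix j b c * n b ()) = \<zero>\<^bsub>L\<^esub>"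
        using cyc[of c "()"] boundary_superset[OF fS order_refl, of "d_matrix j" c "()"] by (simp add: L.vanishing_iff)
      ultimately show ?thesis using null_add[OF _ null_zero_right[OF cF]] by fastforce
    qed
    then have "(\<Sum>c\<in>?T. \<Sum>b\<in>?S. frag_of (c, L.pr (d_matrix j b c * n b ()))) \<in> null j" by (rule null_sum)
    then show ?thesis by (subst sum.swap)
  qed
  ultimately show ?thesis unfolding tensor_d using null_add by fastforce
qed

text \<open>The tensor product of \<open>F j\<close> and \<open>N\<close> is a direct sum of copies of \<open>N\<close>, one for each basis
  element. This is the projection to the copy at \<open>b\<close>, on pure tensors.\<close>

definition tensor_coordinate :: "nat \<Rightarrow> 'p \<Rightarrow> 'p \<times> 'c \<Rightarrow> 'c universal_ring" where
  "tensor_coordinate j b = (\<lambda>(x, y). sc (coordinate j x b) * L.lift y)"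

lemma tensor_coordinate_rels:
  assumes "t \<in> rels j"
  shows "frag_eval (tensor_coordinate j b) t \<in> L.vanishing"
  using assms
proof (cases rule: rels_cases)
  case (left x x' y)
  have "sc (coordinate j x b \<oplus>\<^bsub>R\<^esub> coordinate j x' b) * L.lift y \<asymp> (sc (coordinate j x b) + sc (coordinate j x' b)) * L.lift y"
    using left coordinate_closed by (intro L.quot.eqv_mult_right sc_simps) auto
  moreover have "frag_eval (tensor_coordinate j b) t =
      sc (coordinate j x b \<oplus>\<^bsub>R\<^esub> coordinate j x' b) * L.lift y - sc (coordinate j x b) * L.lift y - sc (coordinate j x' b) * L.lift y"
    unfolding left(4) frag_eval_diff frag_eval_of tensor_coordinate_def by (simp only: prod.case coordinate_add[OF left(1,2)])
  ultimately show ?thesis by (simp only: L.quot.eqv_def distrib_right diff_diff_eq)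
next
  case (right x y y')
  have "L.lift (y \<oplus>\<^bsub>L\<^esub> y') \<asymp> L.lift y + L.lift y'"
    using right N_carrier by (simp add: L.eqv_iff L.pr_simps L.pr_lift)
  then have "sc (coordinate j x b) * L.lift (y \<oplus>\<^bsub>L\<^esub> y') \<asymp> sc (coordinate j x b) * (L.lift y + L.lift y')"
    by (rule L.quot.eqv_mult_left)
  moreover have "frag_eval (tensor_coordinate j b) t =
      sc (coordinate j x b) * L.lift (y \<oplus>\<^bsub>L\<^esub> y') - sc (coordinate j x b) * L.lift y - sc (coordinate j x b) * L.lift y'"
    unfolding right(4) frag_eval_diff frag_eval_of tensor_coordinate_def by (simp only: prod.case)
  ultimately show ?thesis by (simp only: L.quot.eqv_def distrib_left diff_diff_eq)
next
  case (scalar a x y)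
  have c: "coordinate j x b \<in> carrier R" using coordinate_closed scalar by blast
  have "L.pr (sc (a \<otimes>\<^bsub>R\<^esub> coordinate j x b) * L.lift y) = L.pr (sc (coordinate j x b) * L.lift (\<phi> a \<otimes>\<^bsub>L\<^esub> y))"
    using scalar c N_carrier by (simp add: L.pr_simps(5) L.pr_lift L.m_ac)
  then show ?thesis
    using scalar by (simp add: frag_eval_diff tensor_coordinate_def coordinate_smult L.vanishing_iff L.pr_diff L.eqv_iff[symmetric] L.quot.eqv_def)
qed

lemma tensor_coordinate_null:
  assumes "t \<in> null j"
  shows "frag_eval (tensor_coordinate j b) t \<in> L.vanishing"
  using assms unfolding tensor_null_def
proof (induction rule: generate.induct)
  case one
  then show ?case by (simp add: L.quot.Z_zero)
next
  case (incl h)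
  then show ?case by (rule tensor_coordinate_rels)
next
  case (inv h)
  have "Poly_Mapping.keys h \<subseteq> pairs j" using subsetD[OF rels_carrier inv] by simp
  then show ?case using tensor_coordinate_rels[OF inv] L.quot.Z_minus by (simp add: frag_eval_uminus)
next
  case (eng h1 h2)
  then show ?case by (simp add: frag_eval_add L.quot.Z_add)
qed

lemma tensor_coordinate_chain:
  assumes t: "Poly_Mapping.keys t \<subseteq> pairs j"
  shows "(\<lambda>b (_::unit). frag_eval (tensor_coordinate j b) t) \<in> fchains (basis j) D.integrals"
proof -
  let ?n = "\<lambda>b (_::unit). frag_eval (tensor_coordinate j b) t"
  let ?T = "\<Union>k\<in>Poly_Mapping.keys t. {b. coordinate j (fst k) b \<noteq> \<zero>\<^bsub>R\<^esub>}"
  have kc: "fst k \<in> carrier (F j)" "snd k \<in> carrier N" if "k \<in> Poly_Mapping.keys t" for k using t that by auto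
  have sub: "supp ?n \<subseteq> ?T"
  proof (rule subsetI, rule ccontr)
    fix b assume b: "b \<in> supp ?n" "b \<notin> ?T"
    then have "frag_eval (tensor_coordinate j b) t = 0"
      unfolding frag_eval_def tensor_coordinate_def by (intro sum.neutral) (auto split: prod.splits)
    then show False using b(1) by (simp add: supp_def)
  qed
  have "finite ?T" using coordinate_finite kc by auto
  moreover have "?T \<subseteq> basis j" using coordinate_outside kc by blast
  moreover have "D.integral A (frag_eval (tensor_coordinate j b) t)" for b
    unfolding frag_eval_def
  proof (rule integral_sum)
    fix k assume k: "k \<in> Poly_Mapping.keys t"
    have nat: "of_nat n \<in> A" for n by (induction n) (auto intro: L.quot.subrD[OF A_subr])
    have int: "of_int z \<in> A" for z
    proof (cases z)
      case (nonneg n)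
      then show ?thesis using nat by simp
    next
      case (neg n)
      have "(of_int z :: 'c universal_ring) = - of_nat (Suc n)" using neg by simp
      then show ?thesis using L.quot.subrD(6)[OF A_subr nat[of "Suc n"]] by (simp only:)
    qed
    have "D.integral A (tensor_coordinate j b k)"
      using integral_scalar[OF lift_phi_in_A[OF coordinate_closed[OF kc(1)[OF k]]] lift_integral[OF kc(2)[OF k]]]
      by (simp add: tensor_coordinate_def case_prod_beta)
    then show "D.integral A (of_int (Poly_Mapping.lookup t k) * tensor_coordinate j b k)" by (rule integral_scalar[OF int])
  qed
  ultimately show ?thesis
    using finite_subset[OF sub] subset_trans[OF sub] by (simp add: fchains_def D.integrals_def)
qed

lemma tensor_coordinate_tensor_d:
  assumes "Poly_Mapping.keys t \<subseteq> pairs (Suc j)"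
  shows "frag_eval (tensor_coordinate j c) (tensor_d j t) \<asymp> boundary (d_matrix j) (\<lambda>b (_::unit). frag_eval (tensor_coordinate (Suc j) b) t) c ()"
proof -
  have "Poly_Mapping.keys t \<subseteq> pairs (Suc j) \<and>
    frag_eval (tensor_coordinate j c) (tensor_d j t) \<asymp> boundary (d_matrix j) (\<lambda>b (_::unit). frag_eval (tensor_coordinate (Suc j) b) t) c ()"
    using assms
  proof (induction t rule: frag_induction)
    case zero
    have "boundary (d_matrix j) (\<lambda>b (_::unit). 0) c () = 0" by (simp add: boundary_def scalar_boundary_def)
    then show ?case by simp
  next
    case (one k)
    obtain x y where k: "k = (x, y)" "x \<in> carrier (F (Suc j))" "y \<in> carrier N" using one by auto
    let ?n = "\<lambda>b. sc (coordinate (Suc j) x b)"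
    have fin: "finite {b. ?n b \<noteq> 0}" using chain_of[OF k(2)] by blast
    have "sc (coordinate j (d j x) c) * L.lift y \<asymp> scalar_boundary (d_matrix j) ?n c * L.lift y"
      by (rule L.quot.eqv_mult_right[OF sc_coordinate_d[OF k(2)]])
    also have "scalar_boundary (d_matrix j) ?n c * L.lift y = (\<Sum>b | ?n b \<noteq> 0. d_matrix j b c * (?n b * L.lift y))"
      by (simp add: scalar_boundary_def sum_distrib_right mult.assoc)
    also have "\<dots> = boundary (d_matrix j) (\<lambda>b (_::unit). ?n b * L.lift y) c ()"
      unfolding boundary_def by (rule scalar_boundary_superset[symmetric, OF fin]) auto
    finally show ?case using k one by (simp add: tensor_coordinate_def)
  next
    case (diff a b)
    have ka: "Poly_Mapping.keys a \<subseteq> pairs (Suc j)" and kb: "Poly_Mapping.keys b \<subseteq> pairs (Suc j)" using diff by auto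
    have "boundary (d_matrix j) (\<lambda>x (i::unit). frag_eval (tensor_coordinate (Suc j) x) a - frag_eval (tensor_coordinate (Suc j) x) b) c () =
        boundary (d_matrix j) (\<lambda>x (_::unit). frag_eval (tensor_coordinate (Suc j) x) a) c () -
        boundary (d_matrix j) (\<lambda>x (_::unit). frag_eval (tensor_coordinate (Suc j) x) b) c ()"
      using chainsD(1)[OF tensor_coordinate_chain[OF ka]] chainsD(1)[OF tensor_coordinate_chain[OF kb]]
      by (rule boundary_diff)
    then show ?case
      using diff L.quot.eqv_diff keys_two[OF ka kb] by (simp add: frag_extend_diff frag_eval_diff)
  qed
  then show ?thesis ..
qed

text \<open>The chain \<open>n\<close> corresponds to the sum of the tensors of \<open>b\<close> and \<open>n b\<close>, which is a cycle. By
  assumption it is the boundary of an element \<open>t\<close> of the next tensor product, and the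
  coordinates of \<open>t\<close> form a chain with boundary \<open>n\<close>.\<close>

theorem Tor_exact:
  assumes Tor: "trivial_group (Tor R F d N (Suc j))"
    and n: "n \<in> fchains (basis (Suc j)) (D.integrals :: (unit \<Rightarrow> 'c universal_ring) set)"
    and cyc: "\<And>c i. boundary (d_matrix j) n c i \<in> L.vanishing"
  shows "\<exists>n'\<in>fchains (basis (Suc (Suc j))) D.integrals. \<forall>c i. n c i \<asymp> boundary (d_matrix (Suc j)) n' c i"
proof -
  define z where "z = (\<Sum>b\<in>supp n. frag_of (b, L.pr (n b ())))"
  have fS: "finite (supp n)" by (rule chainsD(1)[OF n])
  have nint: "D.integral A (n b ())" for b using chainsD(3)[OF n, of b] by (simp add: D.integrals_def)
  have SB: "b \<in> basis (Suc j)" "b \<in> carrier (F (Suc j))" if "b \<in> supp n" for b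
    using that chainsD(2)[OF n] basis_props(1) by blast+
  have zk: "Poly_Mapping.keys z \<subseteq> pairs (Suc j)"
  proof -
    have "Poly_Mapping.keys (frag_of (b, L.pr (n b ())) :: 'p \<times> 'c \<Rightarrow>\<^sub>0 int) \<subseteq> pairs (Suc j)" if "b \<in> supp n" for b
      using SB[OF that] nint pr_in_N by simp
    then show ?thesis unfolding z_def by (rule order_trans[OF keys_sum UN_least])
  qed
  let ?T = "\<lambda>j. tensor R (F j) N" and ?\<delta> = "\<lambda>j. tensor_map R (F j) N (d j)"
  have Tc: "carrier (?T j) = (\<lambda>t. null j #>\<^bsub>free j\<^esub> t) ` {t. Poly_Mapping.keys t \<subseteq> pairs j}" for j
    unfolding tensor_def carrier_FactGroup by auto
  have Tone: "one (?T j) = null j" for j by (simp add: tensor_def)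
  let ?C = "null (Suc j) #>\<^bsub>free (Suc j)\<^esub> z"
  let ?Z = "kernel (?T (Suc j)) (?T j) (?\<delta> j)"
  let ?B = "?\<delta> (Suc j) ` carrier (?T (Suc (Suc j)))"
  have CT: "?C \<in> carrier (?T (Suc j))" using Tc zk by blast
  have "?\<delta> j ?C = null j #>\<^bsub>free j\<^esub> tensor_d j z" by (rule tensor_map_coset[OF zk])
  also have "\<dots> = null j #>\<^bsub>free j\<^esub> 0"
    using cycle_null[OF n cyc] tensor_d_carrier[OF zk] unfolding z_def[symmetric] by (intro coset_eq_iff) auto
  also have "\<dots> = null j" by (auto simp: r_coset_def)
  finally have CZ: "?C \<in> ?Z" using CT by (simp add: kernel_def Tone)
  have car: "carrier (Tor R F d N (Suc j)) = (\<lambda>C. ?B #>\<^bsub>?T (Suc j)\<^esub> C) ` ?Z"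
    by (simp add: Tor_def Let_def carrier_FactGroup r_coset_def)
  have one: "one (Tor R F d N (Suc j)) = ?B" by (simp add: Tor_def Let_def)
  have "carrier (Tor R F d N (Suc j)) = {one (Tor R F d N (Suc j))}"
    using Tor by (simp add: trivial_group_def)
  then have "(\<lambda>C. ?B #>\<^bsub>?T (Suc j)\<^esub> C) ` ?Z = {?B}" unfolding car one .
  with imageI[OF CZ, of "\<lambda>C. ?B #>\<^bsub>?T (Suc j)\<^esub> C"]
  have BC: "?B #>\<^bsub>?T (Suc j)\<^esub> ?C = ?B" by simp
  have nullB: "null (Suc j) \<in> ?B"
  proof (rule image_eqI[of _ _ "null (Suc (Suc j)) #>\<^bsub>free (Suc (Suc j))\<^esub> 0"])
    have "null (Suc j) #>\<^bsub>free (Suc j)\<^esub> 0 = null (Suc j)" by (auto simp: r_coset_def)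
    then show "null (Suc j) = ?\<delta> (Suc j) (null (Suc (Suc j)) #>\<^bsub>free (Suc (Suc j))\<^esub> 0)"
      by (simp add: tensor_map_coset)
    show "null (Suc (Suc j)) #>\<^bsub>free (Suc (Suc j))\<^esub> 0 \<in> carrier (?T (Suc (Suc j)))" unfolding Tc by auto
  qed
  have nullC: "null (Suc j) \<otimes>\<^bsub>?T (Suc j)\<^esub> ?C = ?C"
  proof -
    interpret Tg: group "?T (Suc j)"
      unfolding tensor_def
      by (rule normal.factorgroup_is_group[OF comm_group.subgroup_imp_normal[OF abelian_free_Abelian_group null_subgroup]])
    show ?thesis using Tg.l_one[OF CT] by (simp add: Tone)
  qed
  have "null (Suc j) \<otimes>\<^bsub>?T (Suc j)\<^esub> ?C \<in> ?B #>\<^bsub>?T (Suc j)\<^esub> ?C"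
    unfolding r_coset_def[of _ ?B] by (rule UN_I[OF nullB]) (rule singletonI)
  then have "?C \<in> ?B" unfolding nullC BC .
  then obtain C' where C': "C' \<in> carrier (?T (Suc (Suc j)))" "?C = ?\<delta> (Suc j) C'" by blast
  then obtain t where t: "Poly_Mapping.keys t \<subseteq> pairs (Suc (Suc j))" "C' = null (Suc (Suc j)) #>\<^bsub>free (Suc (Suc j))\<^esub> t"
    unfolding Tc by blast
  have "?C = null (Suc j) #>\<^bsub>free (Suc j)\<^esub> tensor_d (Suc j) t" unfolding C'(2) t(2) by (rule tensor_map_coset[OF t(1)])
  then have zt: "z - tensor_d (Suc j) t \<in> null (Suc j)" using coset_self[of z "Suc j"] coset_diff by blast
  let ?n = "\<lambda>b (_::unit). frag_eval (tensor_coordinate (Suc (Suc j)) b) t"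
  have "n c i \<asymp> boundary (d_matrix (Suc j)) ?n c i" for c i
  proof -
    have "frag_eval (tensor_coordinate (Suc j) c) z = (\<Sum>b\<in>supp n. sc (coordinate (Suc j) b c) * L.lift (L.pr (n b ())))"
      by (simp add: z_def frag_eval_sum tensor_coordinate_def)
    also have "\<dots> \<asymp> (\<Sum>b\<in>supp n. (if b = c then 1 else 0) * n b ())"
    proof (intro L.quot.eqv_sum L.quot.eqv_mult)
      fix b assume "b \<in> supp n"
      then show "sc (coordinate (Suc j) b c) \<asymp> (if b = c then 1 else 0)"
        using coordinate_basis[OF SB(1)] sc_one by auto
      show "L.lift (L.pr (n b ())) \<asymp> n b ()" by (simp add: L.eqv_iff L.pr_lift L.pr_simps(1))
    qed
    also have "(\<Sum>b\<in>supp n. (if b = c then 1 else 0) * n b ()) = (\<Sum>b\<in>supp n. if b = c then n b () else 0)"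
      by (intro sum.cong) auto
    also have "\<dots> = n c ()" using fS by (simp add: supp_outside)
    finally have 1: "frag_eval (tensor_coordinate (Suc j) c) z \<asymp> n c ()" .
    have 2: "frag_eval (tensor_coordinate (Suc j) c) z \<asymp> frag_eval (tensor_coordinate (Suc j) c) (tensor_d (Suc j) t)"
      using tensor_coordinate_null[OF zt, of c] by (simp add: frag_eval_diff L.quot.eqv_def)
    have 3: "frag_eval (tensor_coordinate (Suc j) c) (tensor_d (Suc j) t) \<asymp> boundary (d_matrix (Suc j)) ?n c ()"
      by (rule tensor_coordinate_tensor_d[OF t(1)])
    show ?thesis using L.quot.eqv_trans[OF L.quot.eqv_sym[OF 1] L.quot.eqv_trans[OF 2 3]] by simp
  qed
  then show ?thesis using tensor_coordinate_chain[OF t(1)] by blast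
qed

end

section \<open>Factoriality\<close>

context resolution
begin

lemma divisorial_ideal_principal:
  assumes tors: "torsion_class_group L (\<phi> ` carrier R)" and Q: "contains_rationals R"
    and Tor: "trivial_group (Tor R F d N (Suc j))" and I: "D.divisorial I"
  shows "\<exists>f\<in>I. f \<notin> L.vanishing \<and> (\<forall>x\<in>I. \<exists>a\<in>A. x \<asymp> a * f)"
proof -
  obtain x0 where x0: "x0 \<in> carrier (F 0)" "\<epsilon> x0 = m +>\<^bsub>R\<^esub> \<one>\<^bsub>R\<^esub>" using unit_lift_exists by blast
  note c0 = chain_of[OF x0(1)]
  have tc: "D.torsion_classes" by (rule torsion_classes[OF tors])
  have repc: "rep (\<epsilon> b) \<in> carrier R" if "b \<in> basis 0" for b
    using rep_props(1)[OF eps(1)] that basis_props(1) by blast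
  interpret C: residue_field_resolution L.vanishing A "max_A m" basis d_matrix eps0 "\<lambda>b. sc (coordinate 0 x0 b)"
  proof unfold_locales
    show "\<And>x t. x \<in> A \<Longrightarrow> x \<notin> L.vanishing \<Longrightarrow> t \<in> D.loc L.vanishing \<Longrightarrow> (\<And>k. x * t ^ k \<in> A) \<Longrightarrow> t \<in> A"
      by (rule D.torsion_imp_completely_integrally_closed[OF tc])
    show "\<And>x. x \<in> A \<Longrightarrow> x \<notin> max_A m \<Longrightarrow> \<exists>y\<in>A. x * y \<asymp> 1" by (rule m_local(3))
    show "\<And>j b c. b \<in> basis (Suc j) \<Longrightarrow> d_matrix j b c \<noteq> 0 \<Longrightarrow> c \<in> basis j" by (rule d_matrix_supp)
    show "\<And>n j. finite {b. n b \<noteq> 0} \<Longrightarrow> {b. n b \<noteq> 0} \<subseteq> basis (Suc j) \<Longrightarrow> (\<And>b. n b \<in> A) \<Longrightarrow>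
      (\<And>c. scalar_boundary (d_matrix j) n c \<in> L.vanishing) \<Longrightarrow>
      \<exists>n'. finite {b. n' b \<noteq> 0} \<and> {b. n' b \<noteq> 0} \<subseteq> basis (Suc (Suc j)) \<and> (\<forall>b. n' b \<in> A) \<and>
        (\<forall>c. n c \<asymp> scalar_boundary (d_matrix (Suc j)) n' c)" by (rule d_matrix_exact)
    show "\<And>b. eps0 b \<in> A"
      using repc lift_phi_in_A L.quot.subrD(1)[OF A_subr] by (simp add: eps0_def)
  qed (use m_local(1,2) d_matrix_in_A d_matrix_finite d_matrix_d_matrix c0 augmentation[OF x0] d_matrix_eps0 in auto)
  have "C.exact_at j (D.integrals :: (unit \<Rightarrow> 'c universal_ring) set)"
    unfolding C.exact_at_def using Tor_exact[OF Tor] by blast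
  then show ?thesis
    using C.divisorial_principal[OF _ tc I] roots_exist of_nat_invertible[OF Q] by blast
qed

text \<open>Let \<open>p\<close> be irreducible and not a divisor of \<open>a\<close>. The divisorial ideal \<open>J\<close> of all \<open>x\<close> with
  \<open>x p\<close> and \<open>x a\<close> in \<open>A\<close> is generated by some \<open>g\<close>, and \<open>1 = t g\<close>. Now \<open>t\<close> is a common
  divisor of \<open>p = t (g p)\<close> and \<open>a = t (g a)\<close>, and so a unit, which shows \<open>J = A\<close>. If \<open>p\<close>
  divides \<open>a b\<close>, the quotient \<open>b / p\<close> lies in \<open>J\<close>, so \<open>p\<close> divides \<open>b\<close>.\<close>

theorem factorial:
  assumes tors: "torsion_class_group L (\<phi> ` carrier R)" and Q: "contains_rationals R"
    and Tor: "trivial_group (Tor R F d N (Suc j))"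
  shows "factorial_domain R"
proof (rule R.factorial_if_irreducible_prime)
  fix p assume p: "p \<in> carrier (mult_of R)" "irreducible (mult_of R) p"
  have pR: "p \<in> carrier R" "p \<noteq> \<zero>\<^bsub>R\<^esub>" using p(1) by auto
  have irr: "ring_irreducible\<^bsub>R\<^esub> p" using R.ring_irreducibleI'[OF _ p(2)] pR by blast
  have pdvd: "p divides\<^bsub>R\<^esub> b"
    if a: "a \<in> carrier R" and b: "b \<in> carrier R" and ab: "p divides\<^bsub>R\<^esub> (a \<otimes>\<^bsub>R\<^esub> b)" and na: "\<not> p divides\<^bsub>R\<^esub> a" for a b
  proof -
    let ?p = "sc p" and ?a = "sc a"
    have pZ: "?p \<notin> L.vanishing"
      using pR phi_eq_iff[of p "\<zero>\<^bsub>R\<^esub>"] by (simp add: L.vanishing_iff pr_lift_phi)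
    have pA: "?p \<in> A" "?a \<in> A" using lift_phi_in_A pR a by auto
    let ?J = "D.dual {?p, ?a}"
    have SK: "{?p, ?a} \<subseteq> D.loc L.vanishing" using pA D.A_subset_K by blast
    have oneJ: "1 \<in> ?J" using pA L.quot.subrD(2)[OF D.K_subr] by (simp add: D.dual_def)
    have J: "D.divisorial ?J"
      by (rule D.divisorial_dual[OF SK oneJ L.quot.Z_proper pA(1) _ pZ]) simp
    obtain g where g: "g \<in> ?J" "g \<notin> L.vanishing" "\<forall>x\<in>?J. \<exists>c\<in>A. x \<asymp> c * g"
      using divisorial_ideal_principal[OF tors Q Tor J] by blast
    obtain t where t: "t \<in> A" "1 \<asymp> t * g" using g(3) oneJ by blast
    have gpA: "g * ?p \<in> A" "g * ?a \<in> A" using g(1) by (auto simp: D.dual_def)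
    obtain tr where tr: "tr \<in> carrier R" "L.pr t = \<phi> tr" using t(1) by (auto simp: A_iff)
    obtain pr' where pr': "pr' \<in> carrier R" "L.pr (g * ?p) = \<phi> pr'" using gpA(1) by (auto simp: A_iff)
    obtain ar where ar: "ar \<in> carrier R" "L.pr (g * ?a) = \<phi> ar" using gpA(2) by (auto simp: A_iff)
    have fac: "x = tr \<otimes>\<^bsub>R\<^esub> xr" if x: "x \<in> carrier R" and xr: "xr \<in> carrier R" "L.pr (g * sc x) = \<phi> xr" for x xr
    proof -
      have "L.pr (sc x) = L.pr (t * (g * sc x))"
        using L.quot.eqv_mult_right[OF t(2), of "sc x"] by (simp add: L.eqv_iff mult.assoc)
      then have "\<phi> x = \<phi> (tr \<otimes>\<^bsub>R\<^esub> xr)"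
        using x xr tr by (simp add: L.pr_simps(5)[of t] pr_lift_phi)
      then show ?thesis using phi_eq_iff[OF x R.m_closed[OF tr(1) xr(1)]] by blast
    qed
    have ptr: "p = tr \<otimes>\<^bsub>R\<^esub> pr'" by (rule fac[OF pR(1) pr'])
    have atr: "a = tr \<otimes>\<^bsub>R\<^esub> ar" by (rule fac[OF a ar])
    have "tr \<in> Units R"
    proof (rule ccontr)
      assume "tr \<notin> Units R"
      then have "pr' \<in> Units R" using R.ring_irreducibleE(5)[OF pR(1) irr tr(1) pr'(1) ptr] by blast
      then obtain v where v: "v \<in> carrier R" "pr' \<otimes>\<^bsub>R\<^esub> v = \<one>\<^bsub>R\<^esub>" using R.Units_r_inv_ex by blast
      have "p \<otimes>\<^bsub>R\<^esub> (v \<otimes>\<^bsub>R\<^esub> ar) = tr \<otimes>\<^bsub>R\<^esub> ((pr' \<otimes>\<^bsub>R\<^esub> v) \<otimes>\<^bsub>R\<^esub> ar)"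
        unfolding ptr using tr(1) pr'(1) v(1) ar(1) by (simp add: R.m_assoc)
      also have "\<dots> = a" using v(2) atr ar(1) by simp
      finally have "p divides\<^bsub>R\<^esub> a" using v(1) ar(1) by (intro dividesI[of "v \<otimes>\<^bsub>R\<^esub> ar"]) auto
      then show False using na by blast
    qed
    then obtain s where s: "s \<in> carrier R" "tr \<otimes>\<^bsub>R\<^esub> s = \<one>\<^bsub>R\<^esub>" using R.Units_r_inv_ex by blast
    \<comment> \<open>So \<open>g\<close> is in \<open>A\<close>, and \<open>?J = A\<close>.\<close>
    have "g \<asymp> sc s"
    proof -
      have ts: "t * sc s \<asymp> 1"
        using tr s phi.hom_mult[OF tr(1) s(1)] by (simp add: L.eqv_iff L.pr_simps pr_lift_phi)
      have "g = 1 * g" by simp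
      also have "1 * g \<asymp> t * sc s * g" by (rule L.quot.eqv_mult_right[OF L.quot.eqv_sym[OF ts]])
      also have "t * sc s * g = sc s * (t * g)" by (simp add: ac_simps)
      also have "sc s * (t * g) \<asymp> sc s * 1" by (rule L.quot.eqv_mult_left[OF L.quot.eqv_sym[OF t(2)]])
      finally show ?thesis by simp
    qed
    then have gA: "g \<in> A" using L.quot.subr_cong[OF A_subr lift_phi_in_A[OF s(1)]] by blast
    obtain c where c: "c \<in> carrier R" "a \<otimes>\<^bsub>R\<^esub> b = p \<otimes>\<^bsub>R\<^esub> c" using ab by (auto simp: factor_def)
    obtain q where q: "?p * q \<asymp> 1" using L.quot.inverse_exists[OF pZ] by blast
    have qK: "q \<in> D.loc L.vanishing" by (rule D.K_inverse[OF _ q]) (use SK in blast)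
    let ?x = "sc b * q"
    have "?x \<in> ?J"
    proof -
      have "?x \<in> D.loc L.vanishing"
        using L.quot.subrD(5)[OF D.K_subr _ qK] lift_phi_in_A[OF b] D.A_subset_K by blast
      moreover have "?x * ?p \<in> A"
      proof -
        have "sc b * (?p * q) \<asymp> sc b * 1" by (rule L.quot.eqv_mult_left[OF q])
        then have "?x * ?p \<asymp> sc b" by (simp add: ac_simps)
        then show ?thesis using L.quot.subr_cong[OF A_subr lift_phi_in_A[OF b]] by blast
      qed
      moreover have "?x * ?a \<in> A"
      proof -
        have "sc a * sc b \<asymp> ?p * sc c"
          using L.quot.eqv_sym[OF sc_simps(2)[OF a b]] sc_simps(2)[OF pR(1) c(1)] c(2) L.quot.eqv_trans by metis
        then have "sc a * sc b * q \<asymp> ?p * sc c * q" by (rule L.quot.eqv_mult_right)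
        also have "?p * sc c * q = (?p * q) * sc c" by (simp add: ac_simps)
        also have "(?p * q) * sc c \<asymp> 1 * sc c" by (rule L.quot.eqv_mult_right[OF q])
        finally have "?x * ?a \<asymp> sc c" by (simp add: ac_simps)
        then show ?thesis using L.quot.subr_cong[OF A_subr lift_phi_in_A[OF c(1)]] by blast
      qed
      ultimately show ?thesis by (simp add: D.dual_def)
    qed
    then obtain e where e: "e \<in> A" "?x \<asymp> e * g" using g(3) by blast
    have "?x \<in> A" using L.quot.subr_cong[OF A_subr L.quot.subrD(5)[OF A_subr e(1) gA] e(2)] .
    then obtain y where y: "y \<in> carrier R" "L.pr ?x = \<phi> y" by (auto simp: A_iff)
    have "sc b * (?p * q) \<asymp> sc b * 1" by (rule L.quot.eqv_mult_left[OF q])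
    then have "L.pr (?p * ?x) = \<phi> b" using pr_lift_phi[OF b] by (simp add: L.eqv_iff ac_simps)
    then have "\<phi> (p \<otimes>\<^bsub>R\<^esub> y) = \<phi> b"
      using y pR by (simp only: L.pr_simps(5)[of ?p] pr_lift_phi phi.hom_mult)
    then have "b = p \<otimes>\<^bsub>R\<^esub> y" using phi_eq_iff[of "p \<otimes>\<^bsub>R\<^esub> y" b] y pR b by simp
    then show ?thesis using y(1) by (auto simp: factor_def)
  qed
  have "ring_prime\<^bsub>R\<^esub> p"
  proof (rule R.ring_primeI[OF pR(2)])
    show "prime R p"
      unfolding prime_def
    proof (intro conjI ballI impI)
      show "p \<notin> Units R" using R.ring_irreducibleE(4)[OF pR(1) irr] .
      show "p divides\<^bsub>R\<^esub> a \<or> p divides\<^bsub>R\<^esub> b"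
        if "a \<in> carrier R" "b \<in> carrier R" "p divides\<^bsub>R\<^esub> (a \<otimes>\<^bsub>R\<^esub> b)" for a b
        using pdvd[OF that] by blast
    qed
  qed
  then show "prime (mult_of R) p" using R.ring_primeE(2) pR(1) by blast
qed

end

theorem corollary1p3:
  fixes R :: "('a, 'b) ring_scheme" and m :: "'a set"
    and L :: "('c, 'd) ring_scheme" and \<phi> :: "'a \<Rightarrow> 'c"
    and F :: "nat \<Rightarrow> ('a, 'p) module" and d :: "nat \<Rightarrow> 'p \<Rightarrow> 'p" and \<epsilon> :: "'p \<Rightarrow> 'a set"
    and i :: nat
  assumes "noetherian_domain R"
    and "local_ring R m"
    and "contains_rationals R"
    and "closure_of_fraction_field R L \<phi>"
    and "torsion_class_group L (\<phi> ` carrier R)"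
    and "free_resolution R (residue_module R m) F d \<epsilon>"
    and "i > 0"
    and "trivial_group (Tor R F d (absolute_integral_closure R L \<phi>) i)"
  shows "factorial_domain R"
proof -
  have cl: "\<phi> \<in> ring_hom R L" "inj_on \<phi> (carrier R)" "algebraic_closure L (fraction_field L (\<phi> ` carrier R))"
    using assms(4) by (auto simp: closure_of_fraction_field_def)
  interpret resolution R L \<phi> m F d \<epsilon>
    by (intro resolution.intro fraction_closure.intro fraction_closure_axioms.intro resolution_axioms.intro
        assms cl)
  obtain j where "i = Suc j" using assms(7) by (cases i) auto
  then show ?thesis using factorial[OF assms(5,3)] assms(8) by simp
qed

end
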